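(* Let $\Omega\subset\mathbb{R}^d$ be a bounded $C^{1,1}$-domain, $\Lambda\ge1$, and $s\in(0,1)$. Let $J_s:\{(x,y)\in\mathbb{R}^d\times\mathbb{R}^d:x\neq y\}\to(0,\infty)$ be symmetric with $$\tfrac{\kappa_{d,s}}{\Lambda}|x-y|^{-d-2s}\le J_s(x,y)\le\Lambda\kappa_{d,s}|x-y|^{-d-2s}\quad\text{for all }x\ne y,$$ and let $G\in\mathcal{T}^s(\Omega^c)'$ and $F\in V^s_\perp(\Omega\,|\,\mathbb{R}^d)'$. Then there exists a weak solution $u\in V^s_\perp(\Omega\,|\,\mathbb{R}^d)$ of the nonlocal Neumann problem, i.e. $$\mathcal{E}^s(u,v)=F(v)+G(v|_{\Omega^c})\quad\text{for every }v\in V^s_\perp(\Omega\,|\,\mathbb{R}^d).$$ Additionally, for $s_\star\in(0,s)$ there exists a constant $C=C(d,\Omega,s_\star,\Lambda)>0$, not depending on $s$, $J_s$, $F$, $G$, such that the solution $u$ satisfies $$\|u\|_{V^s(\Omega|\mathbb{R}^d)}\le C\big(\|F\|_{V^s_\perp\to\mathbb{R}}+\|G\|_{\mathcal{T}^s\to\mathbb{R}}\big).$$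
   Context: Fix $d\ge2$. A domain is an open connected set; $\Omega^c=\mathbb{R}^d\setminus\Omega$; $d_x=\operatorname{dist}(x,\partial\Omega)$. Functions are Borel measurable and identified if equal a.e. A prime denotes the dual space and $\|\cdot\|_{X\to\mathbb{R}}$ the operator norm. $\kappa_{d,s}=\dfrac{2^{2s}s\,\Gamma(\frac{d+2s}{2})}{\pi^{d/2}\Gamma(1-s)}$. $V^s(\Omega\,|\,\mathbb{R}^d)$ is the space of $u:\mathbb{R}^d\to\mathbb{R}$ with $[u,u]_{V^s}:=\frac{\kappa_{d,s}}{2}\iint_{(\mathbb{R}^d\times\mathbb{R}^d)\setminus(\Omega^c\times\Omega^c)}\frac{(u(x)-u(y))^2}{|x-y|^{d+2s}}dx\,dy<\infty$, with norm $\|u\|_{V^s(\Omega|\mathbb{R}^d)}=(\|u\|_{L^2(\Omega)}^2+[u,u]_{V^s})^{1/2}$; $V^s_\perp(\Omega\,|\,\mathbb{R}^d)$ is its closed subspace of $u$ with $\int_\Omega u=0$. $\mathcal{T}^s(\Omega^c)$ is the space of $g:\Omega^c\to\mathbb{R}$ with finite norm $\big(\int_{\Omega^c}g^2\tau_s\,dx+\int_{\Omega^c}\int_{\Omega^c}(g(x)-g(y))^2k_s(x,y)\,dx\,dy\big)^{1/2}$, where $\tau_s(x)=\frac{1-s}{d_x^s(1+d_x)^{d+s}}$ and $k_s(x,y)=\frac{(1-s)^2}{d_x^s(1+d_x)^sd_y^s(1+d_y)^s(|x-y|+d_xd_y+d_x+d_y)^d}$. The restriction $v\mapsto v|_{\Omega^c}$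 maps $V^s(\Omega\,|\,\mathbb{R}^d)$ into $\mathcal{T}^s(\Omega^c)$. $\mathcal{E}^s(u,v)=\frac12\iint_{(\Omega^c\times\Omega^c)^c}(u(x)-u(y))(v(x)-v(y))J_s(x,y)\,dx\,dy$. *)

theory Defs
  imports "HOL-Analysis.Analysis"
begin

definition C11_function :: "('a::euclidean_space \<Rightarrow> real) \<Rightarrow> bool" where
  "C11_function \<phi> \<longleftrightarrow> (\<exists>D L. (\<forall>x. GDERIV \<phi> x :> D x) \<and> L-lipschitz_on UNIV D)"

text \<open>
  Near each boundary point, \<open>\<Omega>\<close> is the strict epigraph, in the direction of a unit vector \<open>e\<close>,
  of a function on the hyperplane orthogonal to \<open>e\<close>. The point \<open>x\<close> has coordinates
  \<open>x - (x \<bullet> e) *\<^sub>R e\<close> in the hyperplane and height \<open>x \<bullet> e\<close>. The function \<open>\<phi>\<close> lives on the whole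
  space, but only its values on the hyperplane are used; every \<open>C\<^sup>1\<^sup>,\<^sup>1\<close> function on the hyperplane
  extends by composition with the orthogonal projection.
\<close>

definition C11_domain :: "'a::euclidean_space set \<Rightarrow> bool" where
  "C11_domain \<Omega> \<longleftrightarrow> open \<Omega> \<and> connected \<Omega> \<and>
     (\<forall>z\<in>frontier \<Omega>. \<exists>r>0. \<exists>e \<phi>. norm e = 1 \<and> C11_function \<phi> \<and>
        \<Omega> \<inter> ball z r = {x \<in> ball z r. \<phi> (x - (x \<bullet> e) *\<^sub>R e) < x \<bullet> e})"

definition kappa :: "nat \<Rightarrow> real \<Rightarrow> real" where
  "kappa d s = 2 powr (2 * s) * s * Gamma ((real d + 2 * s) / 2) / (pi powr (real d / 2) * Gamma (1 - s))"

definition interaction_set :: "'a set \<Rightarrow> ('a \<times> 'a) set" where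
  "interaction_set \<Omega> = UNIV - (- \<Omega>) \<times> (- \<Omega>)"

text \<open>
  Function spaces are sets of Borel functions (not of equivalence classes), so the norms below are
  only seminorms, vanishing on functions that are zero almost everywhere. A bounded linear functional
  takes equal values on functions at seminorm distance zero, so passing to classes changes neither
  the dual space nor the operator norm.
\<close>

definition V_energy :: "'a::euclidean_space set \<Rightarrow> real \<Rightarrow> ('a \<Rightarrow> real) \<Rightarrow> ennreal" where
  "V_energy \<Omega> s u = ennreal (kappa DIM('a) s / 2) *
     (\<integral>\<^sup>+(x, y)\<in>interaction_set \<Omega>.
        ennreal ((u x - u y)\<^sup>2 / norm (x - y) powr (real DIM('a) + 2 * s)) \<partial>lborel)"

definition V_space :: "'a::euclidean_space set \<Rightarrow> real \<Rightarrow> ('a \<Rightarrow> real) set" where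
  "V_space \<Omega> s = {u \<in> borel_measurable borel. V_energy \<Omega> s u < \<infinity>}"

text \<open>For bounded \<open>\<Omega>\<close>, finite energy forces \<open>u\<close> to be square integrable over \<open>\<Omega>\<close>,
  so the argument of \<open>enn2real\<close> is finite on \<open>V_space\<close>.\<close>

definition V_norm :: "'a::euclidean_space set \<Rightarrow> real \<Rightarrow> ('a \<Rightarrow> real) \<Rightarrow> real" where
  "V_norm \<Omega> s u = sqrt (enn2real ((\<integral>\<^sup>+x\<in>\<Omega>. ennreal ((u x)\<^sup>2) \<partial>lborel) + V_energy \<Omega> s u))"

definition V_perp :: "'a::euclidean_space set \<Rightarrow> real \<Rightarrow> ('a \<Rightarrow> real) set" where
  "V_perp \<Omega> s = {u \<in> V_space \<Omega> s. (LINT x:\<Omega>|lborel. u x) = 0}"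

definition bdist :: "'a::euclidean_space set \<Rightarrow> 'a \<Rightarrow> real" where
  "bdist \<Omega> x = infdist x (frontier \<Omega>)"

definition tau :: "'a::euclidean_space set \<Rightarrow> real \<Rightarrow> 'a \<Rightarrow> real" where
  "tau \<Omega> s x = (1 - s) / (bdist \<Omega> x powr s * (1 + bdist \<Omega> x) powr (real DIM('a) + s))"

definition trace_kernel :: "'a::euclidean_space set \<Rightarrow> real \<Rightarrow> 'a \<Rightarrow> 'a \<Rightarrow> real" where
  "trace_kernel \<Omega> s x y = (1 - s)\<^sup>2 /
     (bdist \<Omega> x powr s * (1 + bdist \<Omega> x) powr s * bdist \<Omega> y powr s * (1 + bdist \<Omega> y) powr s *
      (norm (x - y) + bdist \<Omega> x * bdist \<Omega> y + bdist \<Omega> x + bdist \<Omega> y) ^ DIM('a))"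

text \<open>A function on the complement of \<open>\<Omega>\<close> is represented by its extension by zero to the whole space.\<close>

definition restrict_compl :: "'a set \<Rightarrow> ('a \<Rightarrow> real) \<Rightarrow> 'a \<Rightarrow> real" where
  "restrict_compl \<Omega> v = (\<lambda>x. if x \<in> \<Omega> then 0 else v x)"

definition T_sqnorm :: "'a::euclidean_space set \<Rightarrow> real \<Rightarrow> ('a \<Rightarrow> real) \<Rightarrow> ennreal" where
  "T_sqnorm \<Omega> s g =
     (\<integral>\<^sup>+x\<in>- \<Omega>. ennreal ((g x)\<^sup>2 * tau \<Omega> s x) \<partial>lborel) +
     (\<integral>\<^sup>+x\<in>- \<Omega>. (\<integral>\<^sup>+y\<in>- \<Omega>. ennreal ((g x - g y)\<^sup>2 * trace_kernel \<Omega> s x y) \<partial>lborel) \<partial>lborel)"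

definition T_space :: "'a::euclidean_space set \<Rightarrow> real \<Rightarrow> ('a \<Rightarrow> real) set" where
  "T_space \<Omega> s = {g \<in> borel_measurable borel. (\<forall>x\<in>\<Omega>. g x = 0) \<and> T_sqnorm \<Omega> s g < \<infinity>}"

definition T_norm :: "'a::euclidean_space set \<Rightarrow> real \<Rightarrow> ('a \<Rightarrow> real) \<Rightarrow> real" where
  "T_norm \<Omega> s g = sqrt (enn2real (T_sqnorm \<Omega> s g))"

definition dual_space ::
    "('a \<Rightarrow> real) set \<Rightarrow> (('a \<Rightarrow> real) \<Rightarrow> real) \<Rightarrow> (('a \<Rightarrow> real) \<Rightarrow> real) set" where
  "dual_space X N = {F.
     (\<forall>u\<in>X. \<forall>v\<in>X. F (\<lambda>x. u x + v x) = F u + F v) \<and>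
     (\<forall>c. \<forall>u\<in>X. F (\<lambda>x. c * u x) = c * F u) \<and>
     (\<exists>K. \<forall>u\<in>X. \<bar>F u\<bar> \<le> K * N u)}"

definition op_norm ::
    "('a \<Rightarrow> real) set \<Rightarrow> (('a \<Rightarrow> real) \<Rightarrow> real) \<Rightarrow> (('a \<Rightarrow> real) \<Rightarrow> real) \<Rightarrow> real" where
  "op_norm X N F = (SUP u\<in>{u \<in> X. N u \<le> 1}. \<bar>F u\<bar>)"

text \<open>\<open>J\<close> is only constrained off the diagonal; its diagonal values do not affect \<open>energy_form\<close>.\<close>

definition admissible_kernel :: "real \<Rightarrow> real \<Rightarrow> ('a::euclidean_space \<Rightarrow> 'a \<Rightarrow> real) \<Rightarrow> bool" where
  "admissible_kernel \<Lambda> s J \<longleftrightarrow>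
     (\<lambda>(x, y). J x y) \<in> borel_measurable (restrict_space borel {(x, y). x \<noteq> y}) \<and>
     (\<forall>x y. x \<noteq> y \<longrightarrow> 0 < J x y \<and> J x y = J y x \<and>
        kappa DIM('a) s / \<Lambda> * norm (x - y) powr (- real DIM('a) - 2 * s) \<le> J x y \<and>
        J x y \<le> \<Lambda> * kappa DIM('a) s * norm (x - y) powr (- real DIM('a) - 2 * s))"

definition energy_form ::
    "'a::euclidean_space set \<Rightarrow> ('a \<Rightarrow> 'a \<Rightarrow> real) \<Rightarrow> ('a \<Rightarrow> real) \<Rightarrow> ('a \<Rightarrow> real) \<Rightarrow> real" where
  "energy_form \<Omega> J u v =
     1 / 2 * (LINT (x, y):interaction_set \<Omega>|lborel. (u x - u y) * (v x - v y) * J x y)"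

definition weak_solution ::
    "'a::euclidean_space set \<Rightarrow> real \<Rightarrow> ('a \<Rightarrow> 'a \<Rightarrow> real) \<Rightarrow> (('a \<Rightarrow> real) \<Rightarrow> real) \<Rightarrow>
     (('a \<Rightarrow> real) \<Rightarrow> real) \<Rightarrow> ('a \<Rightarrow> real) \<Rightarrow> bool" where
  "weak_solution \<Omega> s J F G u \<longleftrightarrow> u \<in> V_perp \<Omega> s \<and>
     (\<forall>v\<in>V_perp \<Omega> s. energy_form \<Omega> J u v = F v + G (restrict_compl \<Omega> v))"

end

theory Submission
  imports Defs
begin

text \<open>
  The form \<open>energy_form\<close> is symmetric and comparable with the energy \<open>V_energy\<close>, so the theorem is
  the Riesz representation theorem on \<open>V_perp\<close> as soon as two inequalities hold with constants that stay
  bounded for \<open>s\<close> in \<open>[s0, 1)\<close>. The first is a Poincare inequality: the square integral over \<open>\<Omega>\<close> of a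
  function with mean zero is controlled by its energy. The second is a trace inequality: the energy and
  the square integral over \<open>\<Omega>\<close> control the norm of the trace space on the complement. Both are proved for
  \<open>cross_energy\<close>, which is \<open>1 - s\<close> times the Gagliardo integral over \<open>\<Omega>\<close> times the whole space and is
  dominated by \<open>V_energy\<close> because \<open>kappa d s\<close> is at least a constant times \<open>1 - s\<close>
  (\<open>kappa_lower_bound\<close>).

  All uniformity as \<open>s\<close> tends to \<open>1\<close> comes from \<open>segment_poincare\<close>. An increment of \<open>u\<close> over a vector \<open>h\<close>
  is the sum of \<open>n\<close> increments over \<open>h / n\<close>, so by the Cauchy-Schwarz inequality oscillation at one
  scale is controlled by oscillation at each of the scales \<open>h / 2^m\<close>; the loss is \<open>2^(- 2 m (1 - s))\<close>,
  which is bounded for \<open>m\<close> up to \<open>1 / (1 - s)\<close>. Adding these scales wins the factor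
  \<open>1 / (1 - s)\<close>. It only needs segments inside \<open>\<Omega>\<close>. This gives \<open>whitney_poincare\<close>, the control of the
  oscillation on balls whose radius is proportional to the distance from the boundary.

  For the Poincare inequality, two sets whose points are joined by segments inside \<open>\<Omega>\<close> control each
  other, and such pairs can be chained. At a boundary point all nearby points of \<open>\<Omega>\<close> see a common ball
  inside a cone; connectedness and compactness do the rest (\<open>poincare_pair_domain\<close>).

  For the trace inequality, near a boundary point \<open>\<Omega>\<close> lies above a Lipschitz graph, and a point \<open>x\<close> outside
  is compared with \<open>x + h\<close> for \<open>h\<close> in a cone around the vertical. Telescoping over the scales \<open>\<mu>^k h\<close>
  would be a Hardy inequality; as consecutive scales differ by a fixed factor and the weight is a power,
  it reduces to absorbing a term with factor \<open>\<mu>^(s0 / 2)\<close> (\<open>cone_hardy\<close>). What remains are increments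
  over \<open>h\<close> of length comparable with the distance of \<open>x\<close> from the boundary, which occur in \<open>cross_energy\<close>
  (\<open>short_rays_bound\<close>), and increments between \<open>x + \<mu> h\<close> and \<open>x + h\<close>, both well inside \<open>\<Omega>\<close>. The latter are
  averaged over Whitney balls, after which \<open>x\<close> can be integrated out, because the singular weight
  \<open>(1 - s) d\<^sub>x\<^sup>-\<^sup>s\<close> has integral at most a constant times \<open>R\<^sup>d\<^sup>-\<^sup>s\<close> over balls of radius \<open>R\<close> (\<open>bdist_layer\<close>);
  this is \<open>oscillation_along_rays\<close>. Together they give \<open>cone_trace_estimate\<close>, from which both terms of the
  trace norm follow locally: two exterior points are compared through a common point of their cones.
  Pairs that are not close to each other and to the boundary have a trace kernel below a constant times
  the product of the weights \<open>\<tau>\<close>, whose total integral is bounded (\<open>trace_estimate\<close>).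

  For existence, the quadratic functional of the problem is minimised. The parallelogram law makes a
  minimising sequence Cauchy with any prescribed speed; a fast Cauchy sequence converges almost everywhere,
  and Fatou's lemma identifies the limit (\<open>V_perp_complete\<close>).
\<close>

section \<open>Increments along segments\<close>

lemma nn_integral_lborel_affine:
  fixes f :: "'a::euclidean_space \<Rightarrow> ennreal"
  assumes [measurable]: "f \<in> borel_measurable borel" and "c > 0"
  shows "(\<integral>\<^sup>+x. f (a + c *\<^sub>R x) \<partial>lborel) = ennreal (1 / c ^ DIM('a)) * (\<integral>\<^sup>+x. f x \<partial>lborel)"
proof -
  have "(\<integral>\<^sup>+x. f x \<partial>lborel) = (\<integral>\<^sup>+x. f x \<partial>density (distr lborel borel (\<lambda>x. a + c *\<^sub>R x)) (\<lambda>_. ennreal (\<bar>c\<bar>^DIM('a))))"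
    using lborel_affine[of c a] assms(2) by simp
  also have "\<dots> = ennreal (c ^ DIM('a)) * (\<integral>\<^sup>+x. f (a + c *\<^sub>R x) \<partial>lborel)"
    using assms(2) by (simp add: nn_integral_density nn_integral_distr nn_integral_cmult)
  finally have "(\<integral>\<^sup>+x. f x \<partial>lborel) = ennreal (c ^ DIM('a)) * (\<integral>\<^sup>+x. f (a + c *\<^sub>R x) \<partial>lborel)" .
  moreover have "ennreal (1 / c ^ DIM('a)) * ennreal (c ^ DIM('a)) = 1"
    using assms(2) by (simp add: ennreal_mult[symmetric])
  ultimately show ?thesis by (simp add: mult.assoc[symmetric])
qed

lemma nn_integral_lborel_shift:
  fixes f :: "'a::euclidean_space \<Rightarrow> ennreal"
  assumes [measurable]: "f \<in> borel_measurable borel"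
  shows "(\<integral>\<^sup>+x. f (x + a) \<partial>lborel) = (\<integral>\<^sup>+x. f x \<partial>lborel)"
  using nn_integral_lborel_affine[of f 1 a] by (simp add: add.commute)

lemma lborel_swap:
  fixes f :: "'a::euclidean_space \<Rightarrow> 'b::euclidean_space \<Rightarrow> ennreal"
  assumes "case_prod f \<in> borel_measurable (borel \<Otimes>\<^sub>M borel)"
  shows "(\<integral>\<^sup>+x. \<integral>\<^sup>+y. f x y \<partial>lborel \<partial>lborel) = (\<integral>\<^sup>+y. \<integral>\<^sup>+x. f x y \<partial>lborel \<partial>lborel)"
proof -
  have [measurable]: "case_prod f \<in> borel_measurable (lborel \<Otimes>\<^sub>M lborel)"
    using assms by (simp cong: measurable_cong_sets sets_pair_measure_cong)
  show ?thesis by (rule lborel_pair.Fubini') measurable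
qed

text \<open>
  A difference \<open>a - b\<close> is passed through intermediate values \<open>u w\<close> and averaged over \<open>w\<close> in \<open>W\<close>: two
  points that do not see each other are compared through a set that both of them see.
\<close>

lemma averaging:
  assumes [measurable]: "u \<in> borel_measurable borel" "W \<in> sets borel"
  shows "ennreal ((a - b)\<^sup>2) * emeasure lborel W \<le>
    2 * (\<integral>\<^sup>+w. indicator W w * ennreal ((a - u w)\<^sup>2) \<partial>lborel) +
    2 * (\<integral>\<^sup>+w. indicator W w * ennreal ((b - u w)\<^sup>2) \<partial>lborel)"
proof -
  have *: "(a - b)\<^sup>2 \<le> 2 * (a - t)\<^sup>2 + 2 * (b - t)\<^sup>2" for t :: real
  proof -
    have "0 \<le> ((a - t) + (b - t))\<^sup>2" by simp
    then show ?thesis by (simp add: power2_eq_square algebra_simps)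
  qed
  have "ennreal ((a - b)\<^sup>2) * emeasure lborel W = (\<integral>\<^sup>+w. indicator W w * ennreal ((a - b)\<^sup>2) \<partial>lborel)"
    by (simp add: nn_integral_multc nn_integral_indicator mult.commute)
  also have "\<dots> \<le> (\<integral>\<^sup>+w. 2 * (indicator W w * ennreal ((a - u w)\<^sup>2)) + 2 * (indicator W w * ennreal ((b - u w)\<^sup>2)) \<partial>lborel)"
    by (intro nn_integral_mono)
      (auto simp: indicator_def * ennreal_plus[symmetric] ennreal_mult[symmetric] ennreal_numeral[symmetric] simp del: ennreal_plus ennreal_numeral intro!: ennreal_leI)
  also have "\<dots> = 2 * (\<integral>\<^sup>+w. indicator W w * ennreal ((a - u w)\<^sup>2) \<partial>lborel) +
    2 * (\<integral>\<^sup>+w. indicator W w * ennreal ((b - u w)\<^sup>2) \<partial>lborel)"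
    by (subst nn_integral_add; simp add: nn_integral_cmult)
  finally show ?thesis .
qed

text \<open>
  The sum is geometric and is dominated by its last nonzero term, whose index satisfies \<open>2 ^ m < R / t\<close>.
\<close>

lemma dyadic_sum_le:
  fixes p t R :: real
  assumes "1 \<le> p" "0 < t" "0 < R"
  shows "(\<Sum>m<M. if 2 ^ m * t < R then (2 ^ m) powr p * R powr (- p) else 0) \<le> 2 * t powr (- p)"
proof -
  let ?f = "\<lambda>m. if 2 ^ m * t < R then (2 ^ m) powr p else (0::real)"
  have "sum ?f {..<M} \<le> (2 ^ M) powr p \<and> sum ?f {..<M} \<le> 2 * (R / t) powr p"
  proof (induction M)
    case 0 then show ?case by simp
  next
    case (Suc M)
    have "2 * (2 ^ M) powr p \<le> (2 ^ Suc M) powr p"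
    proof -
      have "(2::real) powr 1 \<le> 2 powr p" using assms by (intro powr_mono) auto
      then show ?thesis by (simp add: powr_mult)
    qed
    moreover from this have "(2 ^ M) powr p \<le> (2 ^ Suc M) powr p"
      using powr_ge_zero[of "2 ^ M" p] by linarith
    moreover have "(2 ^ M) powr p \<le> (R / t) powr p" if "2 ^ M * t < R"
      using that assms by (intro powr_mono2) (auto simp: field_simps)
    ultimately show ?case using Suc by (auto simp del: power_Suc)
  qed
  then have "sum ?f {..<M} * R powr (-p) \<le> 2 * (R / t) powr p * R powr (-p)"
    by (intro mult_right_mono) auto
  also have "\<dots> = 2 * t powr (-p)"
    using assms by (simp add: powr_divide powr_minus field_simps)
  finally show ?thesis by (simp add: sum_distrib_right if_distrib[of "\<lambda>x. x * _"] cong: if_cong)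
qed

text \<open>
  The two kernels are positive powers of \<open>1 / norm h\<close>: the first is that of the Gagliardo energy,
  the second is what remains of it after one factor \<open>d\<^sub>x\<^sup>-\<^sup>s\<close> is split off as a boundary weight.
\<close>

abbreviation gagliardo_kernel :: "real \<Rightarrow> 'a::euclidean_space \<Rightarrow> real" where
  "gagliardo_kernel s h \<equiv> norm h powr (- (real DIM('a) + 2 * s))"

abbreviation ray_kernel :: "real \<Rightarrow> 'a::euclidean_space \<Rightarrow> real" where
  "ray_kernel s h \<equiv> norm h powr (- (real DIM('a) + s))"

abbreviation layer_weight :: "'a::euclidean_space set \<Rightarrow> real \<Rightarrow> 'a \<Rightarrow> real" where
  "layer_weight \<Omega> s x \<equiv> (1 - s) * bdist \<Omega> x powr (- s)"

abbreviation sq_integral :: "'a::euclidean_space set \<Rightarrow> ('a \<Rightarrow> real) \<Rightarrow> ennreal" where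
  "sq_integral S u \<equiv> \<integral>\<^sup>+x. indicator S x * ennreal ((u x)\<^sup>2) \<partial>lborel"

abbreviation pair_oscillation :: "'a::euclidean_space set \<Rightarrow> 'a set \<Rightarrow> ('a \<Rightarrow> real) \<Rightarrow> ennreal" where
  "pair_oscillation S T u \<equiv>
     \<integral>\<^sup>+x. \<integral>\<^sup>+y. indicator S x * (indicator T y * ennreal ((u x - u y)\<^sup>2)) \<partial>lborel \<partial>lborel"

abbreviation exterior_energy :: "'a::euclidean_space set \<Rightarrow> real \<Rightarrow> 'a set \<Rightarrow> ('a \<Rightarrow> real) \<Rightarrow> ennreal" where
  "exterior_energy \<Omega> s N u \<equiv> \<integral>\<^sup>+x. \<integral>\<^sup>+y. indicator N x * (indicator N y *
     ennreal ((u x - u y)\<^sup>2 * trace_kernel \<Omega> s x y)) \<partial>lborel \<partial>lborel"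

definition cross_energy :: "'a::euclidean_space set \<Rightarrow> real \<Rightarrow> ('a \<Rightarrow> real) \<Rightarrow> ennreal" where
  "cross_energy \<Omega> s u = ennreal (1 - s) * (\<integral>\<^sup>+x. \<integral>\<^sup>+y. indicator \<Omega> x *
     ennreal ((u x - u y)\<^sup>2 * gagliardo_kernel s (x - y)) \<partial>lborel \<partial>lborel)"

text \<open>
  The segment from \<open>x\<close> to \<open>x + h\<close> is cut into \<open>n\<close> equal pieces. Cauchy-Schwarz costs one factor \<open>n\<close>, the
  number of pieces another, and the change of variables \<open>h / n\<close> the factor \<open>n ^ DIM('a)\<close>. The weight
  \<open>a\<close> is bounded through a radius function at every point of the segment because after the
  translation only the starting point of the small piece is known.
\<close>

lemma segment_split:
  fixes u :: "'a::euclidean_space \<Rightarrow> real"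
  assumes [measurable]: "u \<in> borel_measurable borel" "\<Omega> \<in> sets borel" "R \<in> borel_measurable borel"
    and a: "\<And>x h \<theta>. 0 < a x h \<Longrightarrow> \<theta> \<in> {0..1} \<Longrightarrow>
      x + \<theta> *\<^sub>R h \<in> \<Omega> \<and> norm h < R (x + \<theta> *\<^sub>R h) \<and> a x h \<le> R (x + \<theta> *\<^sub>R h) powr (- p)"
    and "0 < n"
  shows "(\<integral>\<^sup>+x. \<integral>\<^sup>+h. ennreal (a x h * (u x - u (x + h))\<^sup>2) \<partial>lborel \<partial>lborel) \<le>
    ennreal (real n ^ (2 + DIM('a))) * (\<integral>\<^sup>+q. \<integral>\<^sup>+h. indicator \<Omega> q *
      ennreal ((if real n * norm h < R q then R q powr (-p) else 0) * (u q - u (q + h))\<^sup>2) \<partial>lborel \<partial>lborel)"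
proof -
  define g where "g q h = indicator \<Omega> q *
      ennreal ((if real n * norm h < R q then R q powr (-p) else 0) * (u q - u (q + h))\<^sup>2)" for q h
  have [measurable]: "case_prod g \<in> borel_measurable (borel \<Otimes>\<^sub>M borel)"
    unfolding g_def by measurable
  have pt: "ennreal (a x h * (u x - u (x + h))\<^sup>2) \<le>
     ennreal (real n) * (\<Sum>j<n. g (x + (j / n) *\<^sub>R h) ((1 / n) *\<^sub>R h))" for x h
  proof (cases "0 < a x h")
    case True
    define q where "q j = x + (real j / n) *\<^sub>R h" for j
    have q: "q 0 = x" "q n = x + h" "\<And>j. q (Suc j) = q j + (1 / n) *\<^sub>R h"
      using \<open>0 < n\<close> by (auto simp: q_def scaleR_add_left[symmetric] add_divide_distrib)
    have "u x - u (x + h) = (\<Sum>j<n. u (q j) - u (q (Suc j)))"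
      using sum_lessThan_telescope'[of "\<lambda>j. u (q j)" n] q(1,2) by simp
    then have "(u x - u (x + h))\<^sup>2 \<le> (\<Sum>j<n. (u (q j) - u (q (Suc j)))\<^sup>2) * n"
      using sum_squared_le_sum_of_squares[of "\<lambda>j. u (q j) - u (q (Suc j))" "{..<n}"] by simp
    then have "a x h * (u x - u (x + h))\<^sup>2 \<le> a x h * (n * (\<Sum>j<n. (u (q j) - u (q (Suc j)))\<^sup>2))"
      using True by (intro mult_left_mono) (auto simp: mult.commute)
    also have "\<dots> = n * (\<Sum>j<n. a x h * (u (q j) - u (q (Suc j)))\<^sup>2)"
      by (simp add: sum_distrib_left algebra_simps)
    finally have "ennreal (a x h * (u x - u (x + h))\<^sup>2) \<le> ennreal (n * (\<Sum>j<n. a x h * (u (q j) - u (q (Suc j)))\<^sup>2))"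
      by (rule ennreal_leI)
    also have "\<dots> = ennreal n * (\<Sum>j<n. ennreal (a x h * (u (q j) - u (q (Suc j)))\<^sup>2))"
      using True by (subst ennreal_mult) (auto simp: sum_nonneg sum_ennreal)
    also have "\<dots> \<le> ennreal n * (\<Sum>j<n. g (q j) ((1 / n) *\<^sub>R h))"
    proof (intro mult_left_mono sum_mono)
      fix j assume "j \<in> {..<n}"
      then have "q j \<in> \<Omega> \<and> norm h < R (q j) \<and> a x h \<le> R (q j) powr (- p)"
        unfolding q_def by (intro a True) auto
      then show "ennreal (a x h * (u (q j) - u (q (Suc j)))\<^sup>2) \<le> g (q j) ((1 / n) *\<^sub>R h)"
        using \<open>0 < n\<close> unfolding g_def q(3) by (auto intro!: ennreal_leI mult_right_mono)
    qed simp
    finally show ?thesis unfolding q_def .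
  next
    case False
    then have "a x h * (u x - u (x + h))\<^sup>2 \<le> 0" by (simp add: mult_nonpos_nonneg)
    then show ?thesis by (simp add: ennreal_neg)
  qed
  have "(\<integral>\<^sup>+x. \<integral>\<^sup>+h. ennreal (a x h * (u x - u (x + h))\<^sup>2) \<partial>lborel \<partial>lborel) \<le>
    (\<integral>\<^sup>+x. \<integral>\<^sup>+h. ennreal (real n) * (\<Sum>j<n. g (x + (j / n) *\<^sub>R h) ((1 / n) *\<^sub>R h)) \<partial>lborel \<partial>lborel)"
    by (intro nn_integral_mono pt)
  also have "\<dots> = ennreal n * (\<Sum>j<n. \<integral>\<^sup>+x. \<integral>\<^sup>+h. g (x + (j / n) *\<^sub>R h) ((1 / n) *\<^sub>R h) \<partial>lborel \<partial>lborel)"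
    by (subst nn_integral_cmult | subst nn_integral_sum | simp)+
  also have "\<dots> = ennreal n * (\<Sum>j<n. ennreal (n ^ DIM('a)) * (\<integral>\<^sup>+x. \<integral>\<^sup>+h. g x h \<partial>lborel \<partial>lborel))"
  proof (intro arg_cong[where f="\<lambda>x. ennreal n * x"] sum.cong refl)
    fix j
    have "(\<integral>\<^sup>+x. \<integral>\<^sup>+h. g (x + (j / n) *\<^sub>R h) ((1 / n) *\<^sub>R h) \<partial>lborel \<partial>lborel) =
       (\<integral>\<^sup>+h. \<integral>\<^sup>+x. g (x + (j / n) *\<^sub>R h) ((1 / n) *\<^sub>R h) \<partial>lborel \<partial>lborel)"
      by (rule lborel_swap) measurable
    also have "\<dots> = (\<integral>\<^sup>+h. \<integral>\<^sup>+x. g x ((1 / n) *\<^sub>R h) \<partial>lborel \<partial>lborel)"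
      by (subst nn_integral_lborel_shift) auto
    also have "\<dots> = ennreal (n ^ DIM('a)) * (\<integral>\<^sup>+h. \<integral>\<^sup>+x. g x h \<partial>lborel \<partial>lborel)"
      using nn_integral_lborel_affine[of "\<lambda>h. \<integral>\<^sup>+x. g x h \<partial>lborel" "1 / n" 0] \<open>0 < n\<close>
      by (simp add: power_one_over)
    also have "(\<integral>\<^sup>+h. \<integral>\<^sup>+x. g x h \<partial>lborel \<partial>lborel) = (\<integral>\<^sup>+x. \<integral>\<^sup>+h. g x h \<partial>lborel \<partial>lborel)"
      by (rule lborel_swap[symmetric]) measurable
    finally show "(\<integral>\<^sup>+x. \<integral>\<^sup>+h. g (x + (j / n) *\<^sub>R h) ((1 / n) *\<^sub>R h) \<partial>lborel \<partial>lborel) =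
       ennreal (n ^ DIM('a)) * (\<integral>\<^sup>+x. \<integral>\<^sup>+h. g x h \<partial>lborel \<partial>lborel)" .
  qed
  also have "\<dots> = ennreal (real n ^ (2 + DIM('a))) * (\<integral>\<^sup>+q. \<integral>\<^sup>+h. g q h \<partial>lborel \<partial>lborel)"
    by (simp add: ennreal_of_nat_eq_real_of_nat ennreal_mult[symmetric] mult.assoc[symmetric])
  finally show ?thesis unfolding g_def .
qed


lemma cross_energy_shift:
  fixes u :: "'a::euclidean_space \<Rightarrow> real"
  assumes [measurable]: "u \<in> borel_measurable borel" "\<Omega> \<in> sets borel"
  shows "cross_energy \<Omega> s u = ennreal (1 - s) * (\<integral>\<^sup>+x. \<integral>\<^sup>+h. indicator \<Omega> x *
     ennreal ((u x - u (x + h))\<^sup>2 * gagliardo_kernel s h) \<partial>lborel \<partial>lborel)"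
proof -
  have "(\<integral>\<^sup>+y. indicator \<Omega> x * ennreal ((u x - u y)\<^sup>2 * gagliardo_kernel s (x - y)) \<partial>lborel)
    = (\<integral>\<^sup>+h. indicator \<Omega> x * ennreal ((u x - u (x + h))\<^sup>2 * gagliardo_kernel s h) \<partial>lborel)" for x
    using nn_integral_lborel_shift[of "\<lambda>y. indicator \<Omega> x * ennreal ((u x - u y)\<^sup>2 * gagliardo_kernel s (x - y))" x]
    by (simp add: add.commute)
  then show ?thesis unfolding cross_energy_def by simp
qed

text \<open>
  The estimate gains the factor \<open>1 - s\<close> that is hidden in \<open>cross_energy\<close>. Splitting into \<open>2 ^ m\<close> pieces
  bounds the left side by \<open>2 ^ (m * (2 + DIM('a)))\<close> times an integral over short increments. Relative to
  the weight \<open>(2 ^ m) powr (DIM('a) + 2 * s)\<close>, with which these integrals add up to the Gagliardo kernel,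
  this loses only \<open>2 powr (- 2 * m * (1 - s))\<close>, so about \<open>1 / (1 - s)\<close> values of \<open>m\<close> contribute equally.
\<close>

lemma segment_poincare:
  fixes u :: "'a::euclidean_space \<Rightarrow> real"
  assumes [measurable]: "u \<in> borel_measurable borel" "\<Omega> \<in> sets borel" "R \<in> borel_measurable borel"
    and s: "0 < s" "s < 1"
    and a: "\<And>x h \<theta>. 0 < a x h \<Longrightarrow> \<theta> \<in> {0..1} \<Longrightarrow>
      x + \<theta> *\<^sub>R h \<in> \<Omega> \<and> norm h < R (x + \<theta> *\<^sub>R h) \<and> a x h \<le> R (x + \<theta> *\<^sub>R h) powr (- (real DIM('a) + 2 * s))"
  shows "(\<integral>\<^sup>+x. \<integral>\<^sup>+h. ennreal (a x h * (u x - u (x + h))\<^sup>2) \<partial>lborel \<partial>lborel) \<le> 8 * cross_energy \<Omega> s u"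
proof -
  define p where "p = real DIM('a) + 2 * s"
  have "1 \<le> p" using s DIM_positive[where 'a='a] unfolding p_def by linarith
  define L where "L = (\<integral>\<^sup>+x. \<integral>\<^sup>+h. ennreal (a x h * (u x - u (x + h))\<^sup>2) \<partial>lborel \<partial>lborel)"
  define g where "g n q h = indicator \<Omega> q *
      ennreal ((if real n * norm h < R q then R q powr (-p) else 0) * (u q - u (q + h))\<^sup>2)" for n q h
  have [measurable]: "case_prod (g n) \<in> borel_measurable (borel \<Otimes>\<^sub>M borel)" for n
    unfolding g_def by measurable
  \<comment> \<open>For \<open>m < M\<close> the loss \<open>2 powr (- 2 * m * (1 - s))\<close> is at least \<open>1 / 4\<close>.\<close>
  define M where "M = nat \<lceil>1 / (1 - s)\<rceil>"
  have split: "ennreal (2 powr (- 2 * real m * (1 - s))) * L \<le>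
     ennreal ((2 ^ m) powr p) * (\<integral>\<^sup>+q. \<integral>\<^sup>+h. g (2 ^ m) q h \<partial>lborel \<partial>lborel)" for m
  proof -
    have "L \<le> ennreal (real (2 ^ m) ^ (2 + DIM('a))) * (\<integral>\<^sup>+q. \<integral>\<^sup>+h. g (2 ^ m) q h \<partial>lborel \<partial>lborel)"
      unfolding L_def g_def by (rule segment_split) (use a in \<open>auto simp: p_def\<close>)
    then have "ennreal (2 powr (- 2 * real m * (1 - s))) * L \<le> ennreal (2 powr (- 2 * real m * (1 - s))) *
       (ennreal (real (2 ^ m) ^ (2 + DIM('a))) * (\<integral>\<^sup>+q. \<integral>\<^sup>+h. g (2 ^ m) q h \<partial>lborel \<partial>lborel))"
      by (intro mult_left_mono) auto
    also have "\<dots> = ennreal (2 powr (- 2 * real m * (1 - s)) * real (2 ^ m) ^ (2 + DIM('a))) *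
       (\<integral>\<^sup>+q. \<integral>\<^sup>+h. g (2 ^ m) q h \<partial>lborel \<partial>lborel)"
      by (simp add: mult.assoc[symmetric] ennreal_mult)
    also have "2 powr (- 2 * real m * (1 - s)) * real (2 ^ m) ^ (2 + DIM('a)) = (2 ^ m) powr p"
    proof -
      have "real (2 ^ m) ^ (2 + DIM('a)) = 2 powr (real m * real (2 + DIM('a)))"
      proof -
        have "real (2 ^ m) ^ (2 + DIM('a)) = 2 ^ (m * (2 + DIM('a)))"
          by (simp only: of_nat_power power_mult of_nat_numeral)
        also have "\<dots> = 2 powr (real (m * (2 + DIM('a))))"
          by (rule powr_realpow[symmetric]) simp
        finally show ?thesis by (simp only: of_nat_mult)
      qed
      moreover have "(2 ^ m :: real) powr p = 2 powr (real m * p)"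
      proof -
        have "(2 ^ m :: real) = 2 powr real m" by (rule powr_realpow[symmetric]) simp
        then show ?thesis by (simp only: powr_powr)
      qed
      ultimately show ?thesis
        by (simp add: powr_add[symmetric] p_def algebra_simps)
    qed
    finally show ?thesis .
  qed
  have coeff: "1 / (4 * (1 - s)) \<le> (\<Sum>m<M. 2 powr (- 2 * real m * (1 - s)))"
  proof -
    have "2 powr (-2) \<le> (2::real) powr (- 2 * real m * (1 - s))" if "m < M" for m
    proof -
      have "real m \<le> 1 / (1 - s)" using that s unfolding M_def
        by (simp add: less_ceiling_iff zless_nat_eq_int_zless)
      then have "real m * (1 - s) \<le> 1" using s by (simp add: field_simps)
      then show ?thesis by (intro powr_mono) auto
    qed
    then have "(\<Sum>m<M. 2 powr (-2)) \<le> (\<Sum>m<M. (2::real) powr (- 2 * real m * (1 - s)))"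
      by (intro sum_mono) auto
    also have "(\<Sum>m<M. (2::real) powr (-2)) = real M / 4" by (simp add: powr_minus)
    finally have M: "real M / 4 \<le> (\<Sum>m<M. (2::real) powr (- 2 * real m * (1 - s)))" .
    have "1 / (4 * (1 - s)) = (1 / (1 - s)) / 4" by simp
    also have "\<dots> \<le> real M / 4"
      unfolding M_def by (intro divide_right_mono real_nat_ceiling_ge) simp
    also note M
    finally show ?thesis .
  qed
  have "ennreal (1 / (4 * (1 - s))) * L \<le> ennreal (\<Sum>m<M. 2 powr (- 2 * real m * (1 - s))) * L"
    by (intro mult_right_mono ennreal_leI coeff) simp
  also have "\<dots> = (\<Sum>m<M. ennreal (2 powr (- 2 * real m * (1 - s))) * L)"
    by (simp add: sum_distrib_right[symmetric])
  also have "\<dots> \<le> (\<Sum>m<M. ennreal ((2 ^ m) powr p) * (\<integral>\<^sup>+q. \<integral>\<^sup>+h. g (2 ^ m) q h \<partial>lborel \<partial>lborel))"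
    by (intro sum_mono split)
  also have "\<dots> = (\<integral>\<^sup>+q. \<integral>\<^sup>+h. (\<Sum>m<M. ennreal ((2 ^ m) powr p) * g (2 ^ m) q h) \<partial>lborel \<partial>lborel)"
    by (simp add: nn_integral_sum nn_integral_cmult)
  also have "\<dots> \<le> (\<integral>\<^sup>+q. \<integral>\<^sup>+h. ennreal 2 * (indicator \<Omega> q * ennreal ((u q - u (q + h))\<^sup>2 * norm h powr (-p))) \<partial>lborel \<partial>lborel)"
  proof (intro nn_integral_mono)
    fix q h
    have "(\<Sum>m<M. (2 ^ m) powr p * ((if 2 ^ m * norm h < R q then R q powr (-p) else 0) * (u q - u (q + h))\<^sup>2))
       \<le> 2 * ((u q - u (q + h))\<^sup>2 * norm h powr (-p))"
    proof (cases "0 < norm h \<and> 0 < R q")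
      case True
      have "(\<Sum>m<M. (if 2 ^ m * norm h < R q then (2 ^ m) powr p * R q powr (-p) else 0)) * (u q - u (q + h))\<^sup>2
         \<le> 2 * norm h powr (-p) * (u q - u (q + h))\<^sup>2"
        using True \<open>1 \<le> p\<close> by (intro mult_right_mono dyadic_sum_le) auto
      moreover have "(2 ^ m) powr p * ((if 2 ^ m * norm h < R q then R q powr (-p) else 0) * (u q - u (q + h))\<^sup>2) =
          (if 2 ^ m * norm h < R q then (2 ^ m) powr p * R q powr (-p) else 0) * (u q - u (q + h))\<^sup>2" for m
        by simp
      ultimately show ?thesis
        by (simp only: sum_distrib_right mult.assoc mult.commute[of "norm h powr (-p)"])
    next
      case False
      moreover have "\<not> 2 ^ m * norm h < R q" if "\<not> 0 < R q" for m
        using that mult_nonneg_nonneg[of "2 ^ m" "norm h"] by (simp add: not_less order_trans)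
      ultimately show ?thesis by (auto simp: sum_nonpos)
    qed
    then show "(\<Sum>m<M. ennreal ((2 ^ m) powr p) * g (2 ^ m) q h) \<le>
       ennreal 2 * (indicator \<Omega> q * ennreal ((u q - u (q + h))\<^sup>2 * norm h powr (-p)))"
      unfolding g_def by (auto simp: indicator_def ennreal_mult[symmetric] sum_ennreal intro!: ennreal_leI
        simp del: ennreal_numeral)
  qed
  also have "\<dots> = ennreal 2 * (\<integral>\<^sup>+q. \<integral>\<^sup>+h. indicator \<Omega> q * ennreal ((u q - u (q + h))\<^sup>2 * norm h powr (-p)) \<partial>lborel \<partial>lborel)"
    by (simp add: nn_integral_cmult)
  finally have *: "ennreal (1 / (4 * (1 - s))) * L \<le> ennreal 2 * (\<integral>\<^sup>+q. \<integral>\<^sup>+h. indicator \<Omega> q * ennreal ((u q - u (q + h))\<^sup>2 * norm h powr (-p)) \<partial>lborel \<partial>lborel)" .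
  have "L = ennreal (4 * (1 - s)) * (ennreal (1 / (4 * (1 - s))) * L)"
    using s by (simp add: mult.assoc[symmetric] ennreal_mult[symmetric])
  also have "\<dots> \<le> ennreal (4 * (1 - s)) * (ennreal 2 * (\<integral>\<^sup>+q. \<integral>\<^sup>+h. indicator \<Omega> q * ennreal ((u q - u (q + h))\<^sup>2 * norm h powr (-p)) \<partial>lborel \<partial>lborel))"
    by (intro mult_left_mono *) simp
  also have "\<dots> = ennreal (8 * (1 - s)) * (\<integral>\<^sup>+q. \<integral>\<^sup>+h. indicator \<Omega> q * ennreal ((u q - u (q + h))\<^sup>2 * norm h powr (-p)) \<partial>lborel \<partial>lborel)"
    using s by (subst mult.assoc[symmetric], subst ennreal_mult[symmetric]) (auto simp: algebra_simps)
  also have "\<dots> = 8 * cross_energy \<Omega> s u"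
  proof -
    have "ennreal (8 * (1 - s)) = 8 * ennreal (1 - s)" using s by (subst ennreal_mult) auto
    then show ?thesis by (subst cross_energy_shift) (simp_all only: assms p_def mult.assoc)
  qed
  finally show ?thesis unfolding L_def .
qed

section \<open>Whitney balls and a Hardy inequality on cones\<close>

lemma bdist_measurable [measurable]: "bdist \<Omega> \<in> borel_measurable borel"
  unfolding bdist_def by (intro borel_measurable_continuous_onI continuous_intros)

lemma bdist_nonneg [simp]: "0 \<le> bdist \<Omega> x"
  by (simp add: bdist_def infdist_nonneg)

lemma bdist_triangle: "bdist \<Omega> x \<le> bdist \<Omega> y + norm (x - y)"
  unfolding bdist_def using infdist_triangle[of x "frontier \<Omega>" y] by (simp add: dist_norm)

text \<open>
  A segment that leaves \<open>\<Omega>\<close> meets the frontier.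
\<close>

lemma bdist_ball_subset:
  assumes "x \<in> \<Omega>" "norm (y - x) < bdist \<Omega> x"
  shows "y \<in> \<Omega>"
proof (rule ccontr)
  assume "y \<notin> \<Omega>"
  then have "closed_segment x y \<inter> frontier \<Omega> \<noteq> {}"
    using assms(1) by (intro connected_Int_frontier) auto
  then obtain w where w: "w \<in> closed_segment x y" "w \<in> frontier \<Omega>" by auto
  have "bdist \<Omega> x \<le> norm (x - w)"
    unfolding bdist_def using infdist_le[OF w(2), of x] by (simp add: dist_norm)
  also have "\<dots> \<le> norm (x - y)"
    using segment_bound1[OF w(1)] by (simp add: norm_minus_commute)
  finally show False using assms(2) by (simp add: norm_minus_commute)
qed

text \<open>
  The oscillation of \<open>u\<close> around \<open>y\<close> on the ball with a quarter of the distance to the boundary as radius;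
  the factor is small enough for the distance to stay comparable on the whole ball.
\<close>

definition local_osc :: "'a::euclidean_space set \<Rightarrow> ('a \<Rightarrow> real) \<Rightarrow> 'a \<Rightarrow> ennreal" where
  "local_osc \<Omega> u y = (\<integral>\<^sup>+z. indicator {z. 4 * norm (z - y) \<le> bdist \<Omega> y} z * ennreal ((u y - u z)\<^sup>2) \<partial>lborel)"

lemma local_osc_measurable [measurable]:
  assumes [measurable]: "u \<in> borel_measurable borel"
  shows "local_osc \<Omega> u \<in> borel_measurable borel"
  unfolding local_osc_def indicator_def by measurable

text \<open>
  This is \<open>segment_poincare\<close> with half the distance to the boundary as radius function.
\<close>

lemma whitney_poincare:
  fixes u :: "'a::euclidean_space \<Rightarrow> real"
  assumes [measurable]: "u \<in> borel_measurable borel" "\<Omega> \<in> sets borel" and s: "0 < s" "s < 1"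
  shows "(\<integral>\<^sup>+y. indicator \<Omega> y * (ennreal (bdist \<Omega> y powr (- (real DIM('a) + 2 * s))) * local_osc \<Omega> u y) \<partial>lborel)
    \<le> 8 * cross_energy \<Omega> s u"
proof -
  define p where "p = real DIM('a) + 2 * s"
  have "1 \<le> p" using s DIM_positive[where 'a='a] unfolding p_def by linarith
  define a where "a y h = (if y \<in> \<Omega> \<and> 4 * norm h \<le> bdist \<Omega> y then bdist \<Omega> y powr (-p) else 0)" for y h :: 'a
  have "(\<integral>\<^sup>+y. indicator \<Omega> y * (ennreal (bdist \<Omega> y powr (-p)) * local_osc \<Omega> u y) \<partial>lborel) =
    (\<integral>\<^sup>+y. \<integral>\<^sup>+h. ennreal (a y h * (u y - u (y + h))\<^sup>2) \<partial>lborel \<partial>lborel)"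
  proof (intro nn_integral_cong)
    fix y
    have "indicator \<Omega> y * (ennreal (bdist \<Omega> y powr (-p)) * local_osc \<Omega> u y) =
      (\<integral>\<^sup>+z. indicator \<Omega> y * (ennreal (bdist \<Omega> y powr (-p)) *
         (indicator {z. 4 * norm (z - y) \<le> bdist \<Omega> y} z * ennreal ((u y - u z)\<^sup>2))) \<partial>lborel)"
      unfolding local_osc_def by (simp add: nn_integral_cmult indicator_def)
    also have "\<dots> = (\<integral>\<^sup>+h. indicator \<Omega> y * (ennreal (bdist \<Omega> y powr (-p)) *
         (indicator {z. 4 * norm (z - y) \<le> bdist \<Omega> y} (h + y) * ennreal ((u y - u (h + y))\<^sup>2))) \<partial>lborel)"
      by (rule nn_integral_lborel_shift[symmetric]) (simp add: indicator_def)
    also have "\<dots> = (\<integral>\<^sup>+h. ennreal (a y h * (u y - u (y + h))\<^sup>2) \<partial>lborel)"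
      by (intro nn_integral_cong) (auto simp: a_def indicator_def ennreal_mult add.commute)
    finally show "indicator \<Omega> y * (ennreal (bdist \<Omega> y powr (-p)) * local_osc \<Omega> u y) =
      (\<integral>\<^sup>+h. ennreal (a y h * (u y - u (y + h))\<^sup>2) \<partial>lborel)" .
  qed
  also have "\<dots> \<le> 8 * cross_energy \<Omega> s u"
  proof (rule segment_poincare[where R="\<lambda>q. bdist \<Omega> q / 2"])
    fix x h and \<theta> :: real assume "0 < a x h" and \<theta>: "\<theta> \<in> {0..1}"
    then have x: "x \<in> \<Omega>" "4 * norm h \<le> bdist \<Omega> x" "bdist \<Omega> x \<noteq> 0" and ax: "a x h = bdist \<Omega> x powr (-p)"
      by (auto simp: a_def split: if_splits)
    then have pos: "0 < bdist \<Omega> x" using bdist_nonneg[of \<Omega> x] by linarith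
    have th: "norm (\<theta> *\<^sub>R h) \<le> norm h" using \<theta> by (simp add: mult_left_le_one_le)
    have d: "bdist \<Omega> (x + \<theta> *\<^sub>R h) \<le> bdist \<Omega> x + norm h" "bdist \<Omega> x \<le> bdist \<Omega> (x + \<theta> *\<^sub>R h) + norm h"
      using bdist_triangle[of \<Omega> "x + \<theta> *\<^sub>R h" x] bdist_triangle[of \<Omega> x "x + \<theta> *\<^sub>R h"] th by (auto simp: norm_minus_commute)
    show "x + \<theta> *\<^sub>R h \<in> \<Omega> \<and> norm h < bdist \<Omega> (x + \<theta> *\<^sub>R h) / 2 \<and>
      a x h \<le> (bdist \<Omega> (x + \<theta> *\<^sub>R h) / 2) powr (- (real DIM('a) + 2 * s))"
    proof (intro conjI)
      show "x + \<theta> *\<^sub>R h \<in> \<Omega>"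
      proof (rule bdist_ball_subset[OF x(1)])
        show "norm (x + \<theta> *\<^sub>R h - x) < bdist \<Omega> x" using th x(2) pos by simp
      qed
      show h: "norm h < bdist \<Omega> (x + \<theta> *\<^sub>R h) / 2" using x(2) pos d by linarith
      show "a x h \<le> (bdist \<Omega> (x + \<theta> *\<^sub>R h) / 2) powr (- (real DIM('a) + 2 * s))"
        unfolding ax p_def[symmetric]
      proof (rule powr_mono2')
        show "- p \<le> 0" using \<open>1 \<le> p\<close> by simp
        show "0 < bdist \<Omega> (x + \<theta> *\<^sub>R h) / 2" using h norm_ge_zero[of h] by linarith
        show "bdist \<Omega> (x + \<theta> *\<^sub>R h) / 2 \<le> bdist \<Omega> x" using d(1) x(2) pos by linarith
      qed
    qed
  qed (use s in auto)
  finally show ?thesis unfolding p_def .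
qed

text \<open>
  With \<open>F h = u (x + h)\<close> and \<open>c = u x\<close> this is a Hardy inequality on the rays starting at \<open>x\<close>, cut off at
  distance \<open>m\<close>. Writing \<open>c - F h\<close> as \<open>(c - F (\<mu> h)) + (F (\<mu> h) - F h)\<close> and using
  \<open>(X + Y)\<^sup>2 \<le> (1 + \<eta>) X\<^sup>2 + (1 + 1 / \<eta>) Y\<^sup>2\<close>, the first part rescales to the left side itself with the
  factor \<open>(1 + \<eta>) \<mu>\<^sup>s\<close>. For \<open>1 + \<eta> = \<mu> powr (- s0 / 2)\<close> this is at most \<open>\<mu> powr (s0 / 2) < 1\<close>, uniformly
  in \<open>s \<ge> s0\<close>. As the left side could be infinite, it is not subtracted; instead the number of
  possible rescalings is bounded by \<open>N\<close> and the estimate is proved by induction on \<open>N\<close>.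
\<close>

lemma cone_hardy:
  fixes s0 \<mu> :: real
  assumes "0 < s0" "0 < \<mu>" "\<mu> < 1"
  obtains K where "0 < K" "\<And>s (F :: 'a::euclidean_space \<Rightarrow> real) H c m \<delta>.
     s0 \<le> s \<Longrightarrow> F \<in> borel_measurable borel \<Longrightarrow> H \<in> sets borel \<Longrightarrow> (\<And>h t. h \<in> H \<Longrightarrow> 0 < t \<Longrightarrow> t *\<^sub>R h \<in> H) \<Longrightarrow> 0 < m \<Longrightarrow>
     (\<integral>\<^sup>+h. indicator {h \<in> H. m \<le> norm h \<and> norm h \<le> \<delta>} h * ennreal (ray_kernel s h * (c - F h)\<^sup>2) \<partial>lborel) \<le>
     ennreal K * (
      (\<integral>\<^sup>+h. indicator {h \<in> H. m \<le> norm h \<and> norm h \<le> \<delta> \<and> \<mu> * norm h < m} h * ennreal (ray_kernel s h * (c - F h)\<^sup>2) \<partial>lborel) +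
      (\<integral>\<^sup>+h. indicator {h \<in> H. m \<le> \<mu> * norm h \<and> norm h \<le> \<delta>} h * ennreal (ray_kernel s h * (F (\<mu> *\<^sub>R h) - F h)\<^sup>2) \<partial>lborel))"
proof -
  define \<eta> where "\<eta> = \<mu> powr (- s0 / 2) - 1"
  define q where "q = \<mu> powr (s0 / 2)"
  have "0 < \<eta>" using assms powr_less_mono'[of \<mu> "-s0/2" 0] by (simp add: \<eta>_def)
  have q: "0 < q" "q < 1" using assms powr_less_mono'[of \<mu> 0 "s0/2"] by (auto simp: q_def)
  define K where "K = (1 + 1 / \<eta>) / (1 - q)"
  have "0 < K" using \<open>0 < \<eta>\<close> q by (simp add: K_def add_pos_pos)
  show thesis
  proof (rule that[OF \<open>0 < K\<close>])
    fix s :: real and F :: "'a \<Rightarrow> real" and H :: "'a set" and c m \<delta> :: real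
    assume s: "s0 \<le> s" and [measurable]: "F \<in> borel_measurable borel" "H \<in> sets borel"
      and cone: "\<And>h t. h \<in> H \<Longrightarrow> 0 < t \<Longrightarrow> t *\<^sub>R h \<in> H" and m: "0 < m"
    define k where "k h = ray_kernel s h" for h :: 'a
    have [measurable]: "k \<in> borel_measurable borel" unfolding k_def by measurable
    define S where "S N = {h \<in> H. m \<le> norm h \<and> norm h \<le> \<delta> \<and> \<mu> ^ N * norm h < m}" for N
    have [measurable]: "S N \<in> sets borel" for N unfolding S_def by measurable
    define f where "f N = (\<integral>\<^sup>+h. indicator (S N) h * ennreal (k h * (c - F h)\<^sup>2) \<partial>lborel)" for N
    define b where "b = (\<integral>\<^sup>+h. indicator {h \<in> H. m \<le> norm h \<and> norm h \<le> \<delta> \<and> \<mu> * norm h < m} h * ennreal (k h * (c - F h)\<^sup>2) \<partial>lborel)"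
    define T where "T = {h \<in> H. m \<le> \<mu> * norm h \<and> norm h \<le> \<delta>}"
    have [measurable]: "T \<in> sets borel" unfolding T_def by measurable
    define g where "g = (\<integral>\<^sup>+h. indicator T h * ennreal (k h * (F (\<mu> *\<^sub>R h) - F h)\<^sup>2) \<partial>lborel)"
    have step: "f (Suc N) \<le> b + (ennreal q * f N + ennreal (1 + 1 / \<eta>) * g)" for N
    proof -
      define \<Phi> where "\<Phi> h = indicator (S N) h * ennreal (k h * (c - F h)\<^sup>2)" for h
      have [measurable]: "\<Phi> \<in> borel_measurable borel" unfolding \<Phi>_def by measurable
      have young: "(X + Y)\<^sup>2 \<le> (1 + \<eta>) * X\<^sup>2 + (1 + 1 / \<eta>) * Y\<^sup>2" for X Y
      proof -
        have "0 \<le> (\<eta> * X - Y)\<^sup>2 / \<eta>" using \<open>0 < \<eta>\<close> by simp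
        also have "\<dots> = \<eta> * X\<^sup>2 - 2 * X * Y + Y\<^sup>2 / \<eta>"
          using \<open>0 < \<eta>\<close> by (simp add: power2_eq_square field_simps)
        finally show ?thesis by (simp add: power2_sum distrib_right)
      qed
      have ineq: "(c - B)\<^sup>2 \<le> (1 + \<eta>) * (c - A)\<^sup>2 + (1 + 1 / \<eta>) * (A - B)\<^sup>2" for A B
        using young[of "c - A" "A - B"] by simp
      have pt: "indicator (S (Suc N)) h * ennreal (k h * (c - F h)\<^sup>2) \<le>
        indicator {h \<in> H. m \<le> norm h \<and> norm h \<le> \<delta> \<and> \<mu> * norm h < m} h * ennreal (k h * (c - F h)\<^sup>2) +
        (ennreal ((1 + \<eta>) * \<mu> powr (real DIM('a) + s)) * \<Phi> (0 + \<mu> *\<^sub>R h) +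
         ennreal (1 + 1 / \<eta>) * (indicator T h * ennreal (k h * (F (\<mu> *\<^sub>R h) - F h)\<^sup>2)))" for h
      proof (cases "h \<in> S (Suc N) \<and> m \<le> \<mu> * norm h")
        case True
        have "\<mu> * norm h \<le> norm h" using assms by (simp add: mult_left_le_one_le)
        then have "\<mu> *\<^sub>R h \<in> S N" "h \<in> T"
          using True assms by (auto simp: S_def T_def mult_ac intro!: cone)
        have k: "k h = \<mu> powr (real DIM('a) + s) * k (\<mu> *\<^sub>R h)"
          unfolding k_def using assms by (simp add: powr_mult powr_add[symmetric])
        have "k h * (c - F h)\<^sup>2 \<le> k h * ((1 + \<eta>) * (c - F (\<mu> *\<^sub>R h))\<^sup>2 + (1 + 1 / \<eta>) * (F (\<mu> *\<^sub>R h) - F h)\<^sup>2)"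
          by (intro mult_left_mono ineq) (simp add: k_def)
        also have "\<dots> = (1 + \<eta>) * \<mu> powr (real DIM('a) + s) * (k (\<mu> *\<^sub>R h) * (c - F (\<mu> *\<^sub>R h))\<^sup>2) +
            (1 + 1 / \<eta>) * (k h * (F (\<mu> *\<^sub>R h) - F h)\<^sup>2)"
          unfolding distrib_left using k by (simp add: mult_ac)
        finally have "ennreal (k h * (c - F h)\<^sup>2) \<le> ennreal ((1 + \<eta>) * \<mu> powr (real DIM('a) + s) * (k (\<mu> *\<^sub>R h) * (c - F (\<mu> *\<^sub>R h))\<^sup>2) +
            (1 + 1 / \<eta>) * (k h * (F (\<mu> *\<^sub>R h) - F h)\<^sup>2))"
          by (rule ennreal_leI)
        also have "\<dots> = ennreal ((1 + \<eta>) * \<mu> powr (real DIM('a) + s)) * ennreal (k (\<mu> *\<^sub>R h) * (c - F (\<mu> *\<^sub>R h))\<^sup>2) +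
            ennreal (1 + 1 / \<eta>) * ennreal (k h * (F (\<mu> *\<^sub>R h) - F h)\<^sup>2)"
          using \<open>0 < \<eta>\<close> by (subst ennreal_plus) (auto simp: k_def ennreal_mult intro!: mult_nonneg_nonneg)
        finally show ?thesis
          using True \<open>\<mu> *\<^sub>R h \<in> S N\<close> \<open>h \<in> T\<close> by (simp add: \<Phi>_def add_increasing)
      next
        case False
        then show ?thesis by (auto simp: S_def indicator_def)
      qed
      have "f (Suc N) \<le> (\<integral>\<^sup>+h. (indicator {h \<in> H. m \<le> norm h \<and> norm h \<le> \<delta> \<and> \<mu> * norm h < m} h * ennreal (k h * (c - F h)\<^sup>2) +
        (ennreal ((1 + \<eta>) * \<mu> powr (real DIM('a) + s)) * \<Phi> (0 + \<mu> *\<^sub>R h) +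
         ennreal (1 + 1 / \<eta>) * (indicator T h * ennreal (k h * (F (\<mu> *\<^sub>R h) - F h)\<^sup>2)))) \<partial>lborel)"
        unfolding f_def by (intro nn_integral_mono pt)
      also have "\<dots> = b + ((\<integral>\<^sup>+h. ennreal ((1 + \<eta>) * \<mu> powr (real DIM('a) + s)) * \<Phi> (0 + \<mu> *\<^sub>R h) \<partial>lborel) +
         ennreal (1 + 1 / \<eta>) * g)"
        unfolding b_def g_def by (subst nn_integral_add; (subst nn_integral_add)?; simp add: nn_integral_cmult)
      also have "(\<integral>\<^sup>+h. ennreal ((1 + \<eta>) * \<mu> powr (real DIM('a) + s)) * \<Phi> (0 + \<mu> *\<^sub>R h) \<partial>lborel) =
         ennreal ((1 + \<eta>) * \<mu> powr (real DIM('a) + s)) * (ennreal (1 / \<mu> ^ DIM('a)) * f N)"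
        using assms by (subst nn_integral_cmult, simp, subst nn_integral_lborel_affine) (auto simp: f_def \<Phi>_def[abs_def])
      also have "\<dots> = ennreal ((1 + \<eta>) * \<mu> powr s) * f N"
        using assms \<open>0 < \<eta>\<close> by (simp add: mult.assoc[symmetric] ennreal_mult[symmetric] powr_add powr_realpow)
      also have "ennreal ((1 + \<eta>) * \<mu> powr s) * f N \<le> ennreal q * f N"
      proof (intro mult_right_mono ennreal_leI)
        have "(1 + \<eta>) * \<mu> powr s \<le> \<mu> powr (- s0 / 2) * \<mu> powr s0"
          unfolding \<eta>_def using s assms by (intro mult_mono powr_mono') auto
        then show "(1 + \<eta>) * \<mu> powr s \<le> q" by (simp add: q_def powr_add[symmetric])
      qed simp
      finally show ?thesis by (simp add: add_left_mono add_right_mono)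
    qed
    have bound: "f N \<le> ennreal (1 / (1 - q)) * (b + ennreal (1 + 1 / \<eta>) * g)" for N
    proof (induction N)
      case 0
      have "S 0 = {}" unfolding S_def by auto
      then show ?case by (simp add: f_def)
    next
      case (Suc N)
      let ?B = "b + ennreal (1 + 1 / \<eta>) * g"
      have "f (Suc N) \<le> b + (ennreal q * (ennreal (1 / (1 - q)) * ?B) + ennreal (1 + 1 / \<eta>) * g)"
        by (rule order_trans[OF step]) (intro add_mono mult_left_mono Suc order_refl zero_le)
      also have "\<dots> = ?B + ennreal (q / (1 - q)) * ?B"
        using q by (simp add: mult.assoc[symmetric] ennreal_mult[symmetric] add_ac)
      also have "\<dots> = ennreal (1 + q / (1 - q)) * ?B"
        using q by (simp add: ennreal_plus distrib_right)
      also have "1 + q / (1 - q) = 1 / (1 - q)" using q by (simp add: field_simps)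
      finally show ?case .
    qed
    obtain N where N: "\<mu> ^ N * \<bar>\<delta>\<bar> < m"
    proof -
      have "(\<lambda>N. \<mu> ^ N * \<bar>\<delta>\<bar>) \<longlonglongrightarrow> 0 * \<bar>\<delta>\<bar>" using assms by (intro tendsto_intros LIMSEQ_power_zero) auto
      then have "\<forall>\<^sub>F N in sequentially. \<mu> ^ N * \<bar>\<delta>\<bar> < m" using m by (intro order_tendstoD) auto
      then show ?thesis using that by (auto dest: eventually_happens)
    qed
    have "\<mu> ^ N * norm h < m" if "norm h \<le> \<delta>" for h :: 'a
    proof -
      have "\<mu> ^ N * norm h \<le> \<mu> ^ N * \<bar>\<delta>\<bar>" using that assms by (intro mult_left_mono) auto
      then show ?thesis using N by linarith
    qed
    then have "S N = {h \<in> H. m \<le> norm h \<and> norm h \<le> \<delta>}" unfolding S_def by auto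
    then have "(\<integral>\<^sup>+h. indicator {h \<in> H. m \<le> norm h \<and> norm h \<le> \<delta>} h * ennreal (k h * (c - F h)\<^sup>2) \<partial>lborel) = f N"
      unfolding f_def by simp
    also note bound
    also have "ennreal (1 / (1 - q)) * (b + ennreal (1 + 1 / \<eta>) * g) \<le> ennreal (1 / (1 - q)) * (ennreal (1 + 1 / \<eta>) * b + ennreal (1 + 1 / \<eta>) * g)"
    proof (intro mult_left_mono add_right_mono)
      have "1 * b \<le> ennreal (1 + 1 / \<eta>) * b" using \<open>0 < \<eta>\<close> by (intro mult_right_mono) (auto simp flip: ennreal_1 intro!: ennreal_leI)
      then show "b \<le> ennreal (1 + 1 / \<eta>) * b" by simp
    qed auto
    also have "\<dots> = ennreal K * (b + g)"
      using \<open>0 < \<eta>\<close> q by (simp add: K_def distrib_left[symmetric] mult.assoc[symmetric] ennreal_mult[symmetric] del: ennreal_plus)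
    finally show "(\<integral>\<^sup>+h. indicator {h \<in> H. m \<le> norm h \<and> norm h \<le> \<delta>} h * ennreal (ray_kernel s h * (c - F h)\<^sup>2) \<partial>lborel) \<le>
     ennreal K * (
      (\<integral>\<^sup>+h. indicator {h \<in> H. m \<le> norm h \<and> norm h \<le> \<delta> \<and> \<mu> * norm h < m} h * ennreal (ray_kernel s h * (c - F h)\<^sup>2) \<partial>lborel) +
      (\<integral>\<^sup>+h. indicator {h \<in> H. m \<le> \<mu> * norm h \<and> norm h \<le> \<delta>} h * ennreal (ray_kernel s h * (F (\<mu> *\<^sub>R h) - F h)\<^sup>2) \<partial>lborel))"
      unfolding b_def g_def T_def k_def .
  qed
qed

section \<open>Lipschitz charts and the boundary layer\<close>

lemma ball_borel [measurable]: "ball p R \<in> sets (borel :: 'a::metric_space measure)"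
  by simp

text \<open>
  Where \<open>\<bar>a + t\<bar> \<le> R\<close> the integrand is integrated explicitly on both sides of its singularity; elsewhere it
  is at most \<open>R powr (- s)\<close>.
\<close>

lemma nn_integral_abs_powr_Icc:
  assumes s: "0 < s" "s < 1" and R: "0 < R"
  shows "(\<integral>\<^sup>+t. indicator {0..R} t * ennreal (\<bar>a + t\<bar> powr (- s)) \<partial>lborel) \<le> ennreal (3 * R powr (1 - s) / (1 - s))"
proof -
  let ?I = "\<integral>\<^sup>+v. indicator {0..R} v * ennreal (v powr (- s)) \<partial>lborel"
  have I: "?I = ennreal (R powr (1 - s) / (1 - s))"
  proof -
    have "((\<lambda>v. v powr (- s)) has_integral (R powr (- s + 1) / (- s + 1))) {0..R}"
      using s R by (intro has_integral_powr_from_0) auto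
    then have "((\<lambda>v. if v \<in> {0..R} then v powr (- s) else 0) has_integral (R powr (1 - s) / (1 - s))) UNIV"
      by (subst has_integral_restrict_UNIV) (simp add: algebra_simps)
    then have "(\<integral>\<^sup>+v. ennreal (if v \<in> {0..R} then v powr (- s) else 0) \<partial>lborel) = ennreal (R powr (1 - s) / (1 - s))"
      by (intro nn_integral_has_integral_lborel) auto
    moreover have "indicator {0..R} v * ennreal (v powr (- s)) = ennreal (if v \<in> {0..R} then v powr (- s) else 0)" for v
      by (simp add: indicator_def)
    ultimately show ?thesis by simp
  qed
  have I': "(\<integral>\<^sup>+v. indicator {0..R} (- v) * ennreal ((- v) powr (- s)) \<partial>lborel) = ?I"
    by (subst (2) nn_integral_real_affine[where c="-1" and t=0]) auto
  have "(\<integral>\<^sup>+t. indicator {0..R} t * ennreal (\<bar>a + t\<bar> powr (- s)) \<partial>lborel) \<le>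
    (\<integral>\<^sup>+t. (indicator {0..R} (a + 1 * t) * ennreal ((a + 1 * t) powr (- s)) +
      indicator {0..R} (- (a + 1 * t)) * ennreal ((- (a + 1 * t)) powr (- s))) + indicator {0..R} t * ennreal (R powr (- s)) \<partial>lborel)"
  proof (intro nn_integral_mono)
    fix t
    consider "0 \<le> a + t" "a + t \<le> R" | "a + t < 0" "- (a + t) \<le> R" | "R < \<bar>a + t\<bar>" by linarith
    then show "indicator {0..R} t * ennreal (\<bar>a + t\<bar> powr (- s)) \<le>
     (indicator {0..R} (a + 1 * t) * ennreal ((a + 1 * t) powr (- s)) +
      indicator {0..R} (- (a + 1 * t)) * ennreal ((- (a + 1 * t)) powr (- s))) + indicator {0..R} t * ennreal (R powr (- s))"
    proof cases
      case 3
      then have "\<bar>a + t\<bar> powr (- s) \<le> R powr (- s)" using s R by (intro powr_mono2') auto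
      then show ?thesis by (auto simp: indicator_def add_increasing intro: ennreal_leI)
    qed (auto simp: indicator_def add_increasing2)
  qed
  also have "\<dots> = (\<integral>\<^sup>+t. indicator {0..R} (a + 1 * t) * ennreal ((a + 1 * t) powr (- s)) \<partial>lborel) +
      (\<integral>\<^sup>+t. indicator {0..R} (- (a + 1 * t)) * ennreal ((- (a + 1 * t)) powr (- s)) \<partial>lborel) + ennreal (R powr (1 - s))"
    using R by (simp add: nn_integral_add nn_integral_multc ennreal_mult[symmetric] powr_diff powr_minus field_simps)
  also have "\<dots> = ?I + ?I + ennreal (R powr (1 - s))"
    using nn_integral_real_affine[of "\<lambda>v. indicator {0..R} v * ennreal (v powr (- s))" 1 a]
      nn_integral_real_affine[of "\<lambda>v. indicator {0..R} (- v) * ennreal ((- v) powr (- s))" 1 a] I' by simp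
  also have "\<dots> = ennreal (R powr (1 - s) / (1 - s) + R powr (1 - s) / (1 - s) + R powr (1 - s))"
    unfolding I using s by (simp add: ennreal_plus[symmetric] del: ennreal_plus)
  also have "\<dots> \<le> ennreal (3 * R powr (1 - s) / (1 - s))"
  proof (rule ennreal_leI)
    have "R powr (1 - s) * (1 - s) \<le> R powr (1 - s) * 1" using s by (intro mult_left_mono) auto
    then have "R powr (1 - s) \<le> R powr (1 - s) / (1 - s)" using s by (simp add: field_simps)
    then show "R powr (1 - s) / (1 - s) + R powr (1 - s) / (1 - s) + R powr (1 - s) \<le> 3 * R powr (1 - s) / (1 - s)"
      by simp
  qed
  finally show ?thesis .
qed

lemma cross_energy_swap:
  fixes u :: "'a::euclidean_space \<Rightarrow> real"
  assumes [measurable]: "u \<in> borel_measurable borel" "\<Omega> \<in> sets borel"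
  shows "cross_energy \<Omega> s u = ennreal (1 - s) * (\<integral>\<^sup>+x. \<integral>\<^sup>+h. indicator \<Omega> (x + h) *
     ennreal ((u x - u (x + h))\<^sup>2 * gagliardo_kernel s h) \<partial>lborel \<partial>lborel)"
proof -
  have "(\<integral>\<^sup>+x. \<integral>\<^sup>+y. indicator \<Omega> x *
      ennreal ((u x - u y)\<^sup>2 * gagliardo_kernel s (x - y)) \<partial>lborel \<partial>lborel) =
    (\<integral>\<^sup>+y. \<integral>\<^sup>+x. indicator \<Omega> x *
      ennreal ((u x - u y)\<^sup>2 * gagliardo_kernel s (x - y)) \<partial>lborel \<partial>lborel)"
    by (rule lborel_swap) measurable
  also have "\<dots> = (\<integral>\<^sup>+y. \<integral>\<^sup>+h. indicator \<Omega> (h + y) *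
      ennreal ((u (h + y) - u y)\<^sup>2 * norm (h + y - y) powr (- (real DIM('a) + 2 * s))) \<partial>lborel \<partial>lborel)"
    by (intro nn_integral_cong nn_integral_lborel_shift[symmetric]) measurable
  also have "\<dots> = (\<integral>\<^sup>+x. \<integral>\<^sup>+h. indicator \<Omega> (x + h) *
     ennreal ((u x - u (x + h))\<^sup>2 * gagliardo_kernel s h) \<partial>lborel \<partial>lborel)"
    by (simp add: add.commute power2_commute)
  finally show ?thesis unfolding cross_energy_def by simp
qed

text \<open>
  The function \<open>\<psi>\<close> is the signed height over the graph that bounds \<open>\<Omega>\<close> near \<open>z\<close>, measured along \<open>e\<close>. It is
  Lipschitz only near \<open>z\<close>, since the derivative of a \<open>C\<^sup>1\<^sup>,\<^sup>1\<close> function may grow linearly, but its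
  behaviour under vertical translations is global. These properties replace a flattening of the boundary.
\<close>

locale lipschitz_chart =
  fixes \<Omega> :: "'a::euclidean_space set" and z e :: 'a and r L :: real and \<psi> :: "'a \<Rightarrow> real"
  assumes open_\<Omega>: "open \<Omega>" and norm_e: "norm e = 1" and r_pos: "0 < r" and L_ge: "1 \<le> L"
    and psi_measurable [measurable]: "\<psi> \<in> borel_measurable borel"
    and psi_shift: "\<psi> (x + t *\<^sub>R e) = \<psi> x + t"
    and psi_lip: "x \<in> ball z r \<Longrightarrow> y \<in> ball z r \<Longrightarrow> \<bar>\<psi> x - \<psi> y\<bar> \<le> L * norm (x - y)"
    and psi_graph: "x \<in> ball z r \<Longrightarrow> x \<in> \<Omega> \<longleftrightarrow> 0 < \<psi> x"
    and center: "z \<in> frontier \<Omega>"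
begin

lemma omega_borel [measurable]: "\<Omega> \<in> sets borel"
  using open_\<Omega> by simp

lemma frontier_iff_psi:
  assumes "f \<in> ball z r"
  shows "f \<in> frontier \<Omega> \<longleftrightarrow> \<psi> f = 0"
proof
  assume f: "f \<in> frontier \<Omega>"
  then have "f \<notin> \<Omega>" using open_\<Omega> by (simp add: frontier_def interior_open)
  then have "\<psi> f \<le> 0" using psi_graph[OF assms] by simp
  moreover have "\<not> \<psi> f < 0"
  proof
    assume neg: "\<psi> f < 0"
    define \<epsilon> where "\<epsilon> = min (r - dist z f) (- \<psi> f / L)"
    have "0 < \<epsilon>" using assms neg L_ge by (simp add: \<epsilon>_def divide_neg_pos)
    moreover have "f \<in> closure \<Omega>" using f by (simp add: frontier_def)
    ultimately obtain y where y: "y \<in> \<Omega>" "dist y f < \<epsilon>"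
      unfolding closure_approachable by blast
    have "y \<in> ball z r"
      using y(2) dist_triangle[of z y f] by (simp add: \<epsilon>_def dist_commute)
    then have "0 < \<psi> y" and "\<psi> y - \<psi> f \<le> L * dist y f"
      using y(1) psi_graph psi_lip[of y f] assms by (auto simp: dist_norm)
    moreover have "L * dist y f < - \<psi> f" using y(2) L_ge by (simp add: \<epsilon>_def field_simps)
    ultimately show False by simp
  qed
  ultimately show "\<psi> f = 0" by simp
next
  assume 0: "\<psi> f = 0"
  have "\<exists>y\<in>\<Omega>. dist y f < \<epsilon>" if "0 < \<epsilon>" for \<epsilon>
  proof -
    define t where "t = min \<epsilon> (r - dist z f) / 2"
    have t: "0 < t" "t < \<epsilon>" "dist z f + t < r" using that assms by (auto simp: t_def min_def field_simps)
    have "dist (f + t *\<^sub>R e) f = t" using t norm_e by (simp add: dist_norm)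
    moreover have "f + t *\<^sub>R e \<in> ball z r"
      using dist_triangle[of z "f + t *\<^sub>R e" f] calculation t by (simp add: dist_commute)
    then have "f + t *\<^sub>R e \<in> \<Omega>" using psi_graph t 0 by (simp add: psi_shift)
    ultimately show ?thesis using t by (intro bexI[of _ "f + t *\<^sub>R e"]) auto
  qed
  then have "f \<in> closure \<Omega>" by (simp add: closure_approachable)
  moreover have "f \<notin> \<Omega>" using psi_graph[OF assms] 0 by simp
  ultimately show "f \<in> frontier \<Omega>" using open_\<Omega> by (simp add: frontier_def interior_open)
qed

text \<open>
  The height vanishes on the frontier, so the Lipschitz bound applies to the nearest frontier points
  inside the chart; those outside are further away from \<open>x\<close> than \<open>z\<close> is.
\<close>

lemma abs_psi_le_bdist:
  assumes "x \<in> ball z (r / 2)"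
  shows "\<bar>\<psi> x\<bar> \<le> L * bdist \<Omega> x"
proof -
  have x: "x \<in> ball z r" "z \<in> ball z r" using assms r_pos by auto
  have z0: "\<psi> z = 0" using frontier_iff_psi[of z] center x by simp
  have "\<bar>\<psi> x\<bar> / L \<le> dist x f" if f: "f \<in> frontier \<Omega>" for f
  proof (cases "f \<in> ball z r")
    case True
    then have "\<bar>\<psi> x\<bar> \<le> L * dist x f" using psi_lip[of x f] frontier_iff_psi[of f] f x by (simp add: dist_norm)
    then show ?thesis using L_ge by (simp add: field_simps)
  next
    case False
    have "\<bar>\<psi> x\<bar> \<le> L * dist x z" using psi_lip[of x z] x z0 by (simp add: dist_norm)
    moreover have "dist x z \<le> dist x f" using False assms dist_triangle[of z f x] by (simp add: dist_commute)
    then have "L * dist x z \<le> L * dist x f" using L_ge by (intro mult_left_mono) auto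
    ultimately have "\<bar>\<psi> x\<bar> \<le> L * dist x f" by linarith
    then show ?thesis using L_ge by (simp add: field_simps)
  qed
  then have "\<bar>\<psi> x\<bar> / L \<le> bdist \<Omega> x"
    unfolding bdist_def infdist_def using center by (auto intro!: cINF_greatest)
  then show ?thesis using L_ge by (simp add: field_simps)
qed

text \<open>
  The condition is the one under which moving by \<open>h\<close> raises \<open>\<psi>\<close> by at least half the length of \<open>h\<close>: the
  vertical part outweighs the change of the graph over the horizontal part.
\<close>

definition vcone :: "'a set" where
  "vcone = {h. L * norm (h - (h \<bullet> e) *\<^sub>R e) + norm h / 2 \<le> h \<bullet> e}"

lemma vcone_borel [measurable]: "vcone \<in> sets borel"
  unfolding vcone_def by measurable

lemma vcone_scale: "h \<in> vcone \<Longrightarrow> 0 < t \<Longrightarrow> t *\<^sub>R h \<in> vcone"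
proof -
  assume h: "h \<in> vcone" and t: "0 < t"
  have "t *\<^sub>R h - ((t *\<^sub>R h) \<bullet> e) *\<^sub>R e = t *\<^sub>R (h - (h \<bullet> e) *\<^sub>R e)" by (simp add: algebra_simps)
  then have "norm (t *\<^sub>R h - ((t *\<^sub>R h) \<bullet> e) *\<^sub>R e) = t * norm (h - (h \<bullet> e) *\<^sub>R e)"
    using t by simp
  moreover have "norm (t *\<^sub>R h) = t * norm h" using t by simp
  ultimately have "L * norm (t *\<^sub>R h - ((t *\<^sub>R h) \<bullet> e) *\<^sub>R e) + norm (t *\<^sub>R h) / 2 = t * (L * norm (h - (h \<bullet> e) *\<^sub>R e) + norm h / 2)"
    by (simp add: algebra_simps)
  also have "\<dots> \<le> t * (h \<bullet> e)" using h t by (intro mult_left_mono) (auto simp: vcone_def)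
  finally show ?thesis by (simp add: vcone_def)
qed

text \<open>
  The cone contains a ball around each vertical vector \<open>t *\<^sub>R e\<close>, of radius proportional to \<open>t\<close>.
\<close>

lemma vcone_near_axis:
  assumes "norm (h - t *\<^sub>R e) \<le> t / (4 * L + 3)"
  shows "h \<in> vcone"
proof -
  define w where "w = h - t *\<^sub>R e"
  define \<epsilon> where "\<epsilon> = t / (4 * L + 3)"
  have w: "norm w \<le> \<epsilon>" and t: "t = (4 * L + 3) * \<epsilon>" and h: "h = t *\<^sub>R e + w"
    using assms L_ge by (auto simp: w_def \<epsilon>_def)
  have ee: "e \<bullet> e = 1" using norm_e by (simp add: dot_square_norm)
  have we: "\<bar>w \<bullet> e\<bar> \<le> norm w" using Cauchy_Schwarz_ineq2[of w e] norm_e by simp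
  have he: "h \<bullet> e = t + w \<bullet> e" by (simp add: h inner_add_left ee)
  have "h - (h \<bullet> e) *\<^sub>R e = w - (w \<bullet> e) *\<^sub>R e" unfolding he by (simp add: h algebra_simps)
  then have "norm (h - (h \<bullet> e) *\<^sub>R e) \<le> norm w + \<bar>w \<bullet> e\<bar>"
    using norm_triangle_ineq4[of w "(w \<bullet> e) *\<^sub>R e"] norm_e by simp
  then have "norm (h - (h \<bullet> e) *\<^sub>R e) \<le> 2 * \<epsilon>" using we w by simp
  then have 1: "L * norm (h - (h \<bullet> e) *\<^sub>R e) \<le> L * (2 * \<epsilon>)" using L_ge by (intro mult_left_mono) auto
  have \<epsilon>0: "0 \<le> \<epsilon>" using w norm_ge_zero[of w] by linarith
  have t0: "0 \<le> t" using \<epsilon>0 L_ge unfolding t by simp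
  have "norm h \<le> t + \<epsilon>" using norm_triangle_ineq[of "t *\<^sub>R e" w] w norm_e t0 by (simp add: h)
  then have "L * norm (h - (h \<bullet> e) *\<^sub>R e) + norm h / 2 \<le> L * (2 * \<epsilon>) + (t + \<epsilon>) / 2" using 1 by (intro add_mono divide_right_mono) auto
  also have "\<dots> = t - \<epsilon>" unfolding t by (simp add: algebra_simps)
  also have "\<dots> \<le> h \<bullet> e" unfolding he using we w by linarith
  finally show ?thesis by (simp add: vcone_def)
qed

lemma psi_cone_increase:
  assumes h: "h \<in> vcone" and in_ball: "norm (x - z) + norm h < r"
  shows "\<psi> x + norm h / 2 \<le> \<psi> (x + h)"
proof -
  have "norm ((h \<bullet> e) *\<^sub>R e) \<le> norm h" using Cauchy_Schwarz_ineq2[of h e] norm_e by simp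
  then have 1: "x + (h \<bullet> e) *\<^sub>R e \<in> ball z r"
    using in_ball norm_triangle_ineq[of "x - z" "(h \<bullet> e) *\<^sub>R e"] by (simp add: dist_norm norm_minus_commute algebra_simps)
  have 2: "x + h \<in> ball z r"
    using in_ball norm_triangle_ineq[of "x - z" h] by (simp add: dist_norm norm_minus_commute algebra_simps)
  have "\<bar>\<psi> (x + h) - \<psi> (x + (h \<bullet> e) *\<^sub>R e)\<bar> \<le> L * norm (h - (h \<bullet> e) *\<^sub>R e)"
    using psi_lip[OF 2 1] by simp
  then show ?thesis using h by (simp add: psi_shift vcone_def)
qed

text \<open>
  Averaging over the vertical translations of length at most \<open>R\<close> turns the integral into one-dimensional
  integrals of \<open>\<bar>\<psi> x + t\<bar> powr (- s)\<close> over \<open>t\<close>; no coordinates are needed.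
\<close>

lemma psi_layer:
  assumes s: "0 < s" "s < 1" and R: "0 < R"
  shows "(\<integral>\<^sup>+x. indicator (ball p R) x * ennreal (\<bar>\<psi> x\<bar> powr (- s)) \<partial>lborel) \<le>
    ennreal (3 * 2 ^ DIM('a) * unit_ball_vol (real DIM('a)) * R powr (real DIM('a) - s) / (1 - s))"
proof -
  define F where "F x = indicator (ball p R) x * ennreal (\<bar>\<psi> x\<bar> powr (- s))" for x
  have [measurable]: "F \<in> borel_measurable borel" unfolding F_def by measurable
  have "ennreal R * (\<integral>\<^sup>+x. F x \<partial>lborel) = (\<integral>\<^sup>+t. indicator {0..R} t * (\<integral>\<^sup>+x. F (x + t *\<^sub>R e) \<partial>lborel) \<partial>lborel)"
    using R by (subst nn_integral_lborel_shift) (auto simp: nn_integral_multc)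
  also have "\<dots> = (\<integral>\<^sup>+t. (\<integral>\<^sup>+x. indicator {0..R} t * F (x + t *\<^sub>R e) \<partial>lborel) \<partial>lborel)"
    by (subst nn_integral_cmult) auto
  also have "\<dots> = (\<integral>\<^sup>+x. (\<integral>\<^sup>+t. indicator {0..R} t * F (x + t *\<^sub>R e) \<partial>lborel) \<partial>lborel)"
    by (rule lborel_swap) measurable
  also have "\<dots> \<le> (\<integral>\<^sup>+x. indicator (ball p (2 * R)) x * ennreal (3 * R powr (1 - s) / (1 - s)) \<partial>lborel)"
  proof (intro nn_integral_mono)
    fix x
    have "(\<integral>\<^sup>+t. indicator {0..R} t * F (x + t *\<^sub>R e) \<partial>lborel) \<le>
      (\<integral>\<^sup>+t. indicator (ball p (2 * R)) x * (indicator {0..R} t * ennreal (\<bar>\<psi> x + t\<bar> powr (- s))) \<partial>lborel)"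
    proof (intro nn_integral_mono)
      fix t :: real
      show "indicator {0..R} t * F (x + t *\<^sub>R e) \<le> indicator (ball p (2 * R)) x * (indicator {0..R} t * ennreal (\<bar>\<psi> x + t\<bar> powr (- s)))"
      proof (cases "t \<in> {0..R} \<and> x + t *\<^sub>R e \<in> ball p R")
        case True
        then have "dist p x < 2 * R"
          using dist_triangle[of p x "x + t *\<^sub>R e"] norm_e by (simp add: dist_norm)
        then show ?thesis using True by (simp add: F_def psi_shift)
      qed (auto simp: F_def indicator_def)
    qed
    also have "\<dots> = indicator (ball p (2 * R)) x * (\<integral>\<^sup>+t. indicator {0..R} t * ennreal (\<bar>\<psi> x + t\<bar> powr (- s)) \<partial>lborel)"
      by (subst nn_integral_cmult) auto
    also have "\<dots> \<le> indicator (ball p (2 * R)) x * ennreal (3 * R powr (1 - s) / (1 - s))"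
      by (intro mult_left_mono nn_integral_abs_powr_Icc s R) auto
    finally show "(\<integral>\<^sup>+t. indicator {0..R} t * F (x + t *\<^sub>R e) \<partial>lborel) \<le> \<dots>" .
  qed
  also have "\<dots> = ennreal (unit_ball_vol (real DIM('a)) * (2 * R) ^ DIM('a)) * ennreal (3 * R powr (1 - s) / (1 - s))"
    using R by (simp add: nn_integral_multc emeasure_ball)
  also have "\<dots> = ennreal R * ennreal (3 * 2 ^ DIM('a) * unit_ball_vol (real DIM('a)) * R powr (real DIM('a) - s) / (1 - s))"
  proof -
    have "R powr (1 - s) * R ^ DIM('a) = R * R powr (real DIM('a) - s)"
      using R by (simp add: powr_diff powr_realpow)
    then show ?thesis using R s
      by (simp add: ennreal_mult[symmetric] power_mult_distrib mult_ac)
  qed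
  finally have "ennreal R * (\<integral>\<^sup>+x. F x \<partial>lborel) \<le> ennreal R * ennreal (3 * 2 ^ DIM('a) * unit_ball_vol (real DIM('a)) * R powr (real DIM('a) - s) / (1 - s))" .
  then show ?thesis unfolding F_def using R by (subst (asm) ennreal_mult_le_mult_iff) auto
qed

definition layer_const :: real where
  "layer_const = 3 * 2 ^ DIM('a) * unit_ball_vol (real DIM('a)) * L"

lemma layer_const_pos: "0 < layer_const"
  using L_ge by (simp add: layer_const_def unit_ball_vol_pos)

text \<open>
  The factor \<open>1 - s\<close> in the weight compensates exactly for the blow-up of the integral of \<open>t powr (- s)\<close> at zero.
\<close>

lemma bdist_layer:
  assumes s: "0 < s" "s < 1" and R: "0 < R"
  shows "(\<integral>\<^sup>+x. indicator (ball p R \<inter> ball z (r / 2)) x * ennreal (layer_weight \<Omega> s x) \<partial>lborel) \<le>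
    ennreal (layer_const * R powr (real DIM('a) - s))"
proof -
  have "(\<integral>\<^sup>+x. indicator (ball p R \<inter> ball z (r / 2)) x * ennreal (layer_weight \<Omega> s x) \<partial>lborel) \<le>
     (\<integral>\<^sup>+x. ennreal ((1 - s) * L) * (indicator (ball p R) x * ennreal (\<bar>\<psi> x\<bar> powr (- s))) \<partial>lborel)"
  proof (intro nn_integral_mono)
    fix x
    show "indicator (ball p R \<inter> ball z (r / 2)) x * ennreal (layer_weight \<Omega> s x) \<le>
      ennreal ((1 - s) * L) * (indicator (ball p R) x * ennreal (\<bar>\<psi> x\<bar> powr (- s)))"
    proof (cases "x \<in> ball p R \<inter> ball z (r / 2)")
      case True
      have "bdist \<Omega> x powr (- s) \<le> L * \<bar>\<psi> x\<bar> powr (- s)"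
      proof (cases "\<psi> x = 0")
        case True
        then have "bdist \<Omega> x = 0"
          using frontier_iff_psi[of x] \<open>x \<in> ball p R \<inter> ball z (r / 2)\<close> r_pos by (simp add: bdist_def)
        then show ?thesis using True by simp
      next
        case False
        have "bdist \<Omega> x powr (- s) \<le> (\<bar>\<psi> x\<bar> / L) powr (- s)"
          using False True L_ge s abs_psi_le_bdist[of x] by (intro powr_mono2') (auto simp: field_simps)
        also have "\<dots> = L powr s * \<bar>\<psi> x\<bar> powr (- s)" using L_ge by (simp add: powr_divide powr_minus field_simps)
        also have "\<dots> \<le> L * \<bar>\<psi> x\<bar> powr (- s)"
          using powr_mono[of s 1 L] s L_ge by (intro mult_right_mono) auto
        finally show ?thesis .
      qed
      then have "layer_weight \<Omega> s x \<le> (1 - s) * L * \<bar>\<psi> x\<bar> powr (- s)"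
        using s by (simp add: mult.assoc)
      then show ?thesis using True s L_ge by (simp add: ennreal_mult[symmetric] ennreal_leI)
    qed simp
  qed
  also have "\<dots> = ennreal ((1 - s) * L) * (\<integral>\<^sup>+x. indicator (ball p R) x * ennreal (\<bar>\<psi> x\<bar> powr (- s)) \<partial>lborel)"
    by (subst nn_integral_cmult) auto
  also have "\<dots> \<le> ennreal ((1 - s) * L) * ennreal (3 * 2 ^ DIM('a) * unit_ball_vol (real DIM('a)) * R powr (real DIM('a) - s) / (1 - s))"
    by (intro mult_left_mono psi_layer s R) auto
  also have "\<dots> = ennreal (layer_const * R powr (real DIM('a) - s))"
    using s L_ge by (simp add: ennreal_mult[symmetric] layer_const_def mult_ac)
  finally show ?thesis .
qed

end

section \<open>Rays from exterior points into the domain\<close>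

context lipschitz_chart
begin

text \<open>
  Only directions in which \<open>\<psi>\<close> rises are used, and only rays long enough for the
  rise to exceed the depth \<open>L * bdist \<Omega> x\<close> by a fixed fraction of \<open>norm h\<close>: their end points lie in \<open>\<Omega>\<close>,
  at a distance from the boundary comparable to \<open>norm h\<close>.
\<close>

abbreviation ray_energy :: "real \<Rightarrow> real \<Rightarrow> ('a \<Rightarrow> real) \<Rightarrow> 'a \<Rightarrow> ennreal" where
  "ray_energy \<delta> s u x \<equiv> \<integral>\<^sup>+h. indicator {h \<in> vcone. 4 * L * bdist \<Omega> x \<le> norm h \<and> norm h \<le> \<delta>} h *
     ennreal (ray_kernel s h * (u x - u (x + h))\<^sup>2) \<partial>lborel"

text \<open>
  The height of \<open>x\<close> is at least \<open>- L * bdist \<Omega> x\<close>, and the shift gains half its length; the cut-off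
  \<open>4 * L * bdist \<Omega> x\<close> is chosen so that half of this gain is left.
\<close>

lemma cone_shift:
  assumes x: "x \<in> ball z r1" and h: "h \<in> vcone" "norm h \<le> \<delta>" and mu: "1 / 2 \<le> \<mu>" "\<mu> \<le> 1"
    and r1: "r1 + \<delta> < r / 2" "0 < h \<bullet> e"
    and m: "4 * L * bdist \<Omega> x \<le> \<mu> * norm h"
  shows "x + \<mu> *\<^sub>R h \<in> \<Omega>" "norm h \<le> 8 * L * bdist \<Omega> (x + \<mu> *\<^sub>R h)" "bdist \<Omega> (x + \<mu> *\<^sub>R h) \<le> 2 * norm h"
proof -
  have n: "norm (\<mu> *\<^sub>R h) = \<mu> * norm h" "\<mu> * norm h \<le> norm h" "norm h / 2 \<le> \<mu> * norm h"
    using mu mult_right_mono[of \<mu> 1 "norm h"] mult_right_mono[of "1/2" \<mu> "norm h"] by auto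
  have hpos: "0 < norm h" using r1(2) by auto
  have xz: "norm (x - z) < r1" using x by (simp add: dist_norm norm_minus_commute)
  have x2: "x \<in> ball z (r / 2)" and y2: "x + \<mu> *\<^sub>R h \<in> ball z (r / 2)"
    using xz r1 n h(2) norm_triangle_ineq[of "x - z" "\<mu> *\<^sub>R h"] norm_ge_zero[of h]
    by (auto simp: dist_norm norm_minus_commute algebra_simps intro: le_less_trans)
  have "\<mu> *\<^sub>R h \<in> vcone" using h mu by (intro vcone_scale) auto
  then have "\<psi> x + \<mu> * norm h / 2 \<le> \<psi> (x + \<mu> *\<^sub>R h)"
    using psi_cone_increase[of "\<mu> *\<^sub>R h" x] unfolding n(1) using xz n(2) h(2) r1(1) r_pos by linarith
  moreover have "\<bar>\<psi> x\<bar> \<le> \<mu> * norm h / 4" using abs_psi_le_bdist[OF x2] m by simp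
  ultimately have psi: "norm h / 8 \<le> \<psi> (x + \<mu> *\<^sub>R h)" using n by linarith
  have "x + \<mu> *\<^sub>R h \<in> ball z r" using y2 r_pos by auto
  then show "x + \<mu> *\<^sub>R h \<in> \<Omega>" using psi_graph[of "x + \<mu> *\<^sub>R h"] hpos psi by linarith
  show "norm h \<le> 8 * L * bdist \<Omega> (x + \<mu> *\<^sub>R h)" using abs_psi_le_bdist[OF y2] psi by simp
  have "1 * bdist \<Omega> x \<le> 4 * L * bdist \<Omega> x" using L_ge by (intro mult_right_mono) auto
  then show "bdist \<Omega> (x + \<mu> *\<^sub>R h) \<le> 2 * norm h"
    using bdist_triangle[of \<Omega> "x + \<mu> *\<^sub>R h" x] n m by simp
qed

lemma vcone_inner_pos: "h \<in> vcone \<Longrightarrow> h \<noteq> 0 \<Longrightarrow> 0 < h \<bullet> e"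
proof -
  assume "h \<in> vcone" "h \<noteq> 0"
  moreover have "0 \<le> L * norm (h - (h \<bullet> e) *\<^sub>R e)" using L_ge by simp
  moreover have "0 < norm h" using \<open>h \<noteq> 0\<close> by simp
  ultimately show ?thesis unfolding vcone_def mem_Collect_eq by linarith
qed

text \<open>
  When \<open>norm h\<close> is comparable with \<open>bdist \<Omega> x\<close>, the weight \<open>bdist \<Omega> x powr (- s)\<close> supplies the missing factor
  \<open>norm h powr (- s)\<close> of the Gagliardo kernel, and \<open>x + h\<close> lies in \<open>\<Omega>\<close>.
\<close>

lemma short_rays_bound:
  fixes u :: "'a \<Rightarrow> real"
  assumes [measurable]: "u \<in> borel_measurable borel" and s: "0 < s" "s < 1" and \<mu>: "1 / 2 \<le> \<mu>" "\<mu> < 1"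
    and r1: "r1 + \<delta> < r / 2"
  shows "(\<integral>\<^sup>+x. indicator (ball z r1 - \<Omega>) x * (ennreal (layer_weight \<Omega> s x) *
      (\<integral>\<^sup>+h. indicator {h \<in> vcone. 4 * L * bdist \<Omega> x \<le> norm h \<and> norm h \<le> \<delta> \<and> \<mu> * norm h < 4 * L * bdist \<Omega> x} h *
         ennreal (ray_kernel s h * (u x - u (x + h))\<^sup>2) \<partial>lborel)) \<partial>lborel)
    \<le> ennreal (8 * L) * cross_energy \<Omega> s u"
proof -
  have "(\<integral>\<^sup>+x. indicator (ball z r1 - \<Omega>) x * (ennreal (layer_weight \<Omega> s x) *
      (\<integral>\<^sup>+h. indicator {h \<in> vcone. 4 * L * bdist \<Omega> x \<le> norm h \<and> norm h \<le> \<delta> \<and> \<mu> * norm h < 4 * L * bdist \<Omega> x} h *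
         ennreal (ray_kernel s h * (u x - u (x + h))\<^sup>2) \<partial>lborel)) \<partial>lborel) =
    (\<integral>\<^sup>+x. \<integral>\<^sup>+h. indicator (ball z r1 - \<Omega>) x * (ennreal (layer_weight \<Omega> s x) *
      (indicator {h \<in> vcone. 4 * L * bdist \<Omega> x \<le> norm h \<and> norm h \<le> \<delta> \<and> \<mu> * norm h < 4 * L * bdist \<Omega> x} h *
         ennreal (ray_kernel s h * (u x - u (x + h))\<^sup>2))) \<partial>lborel \<partial>lborel)"
    by (simp add: nn_integral_cmult)
  also have "\<dots> \<le> (\<integral>\<^sup>+x. \<integral>\<^sup>+h. ennreal (8 * L * (1 - s)) * (indicator \<Omega> (x + h) *
     ennreal ((u x - u (x + h))\<^sup>2 * gagliardo_kernel s h)) \<partial>lborel \<partial>lborel)"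
  proof (intro nn_integral_mono)
    fix x h
    show "indicator (ball z r1 - \<Omega>) x * (ennreal (layer_weight \<Omega> s x) *
      (indicator {h \<in> vcone. 4 * L * bdist \<Omega> x \<le> norm h \<and> norm h \<le> \<delta> \<and> \<mu> * norm h < 4 * L * bdist \<Omega> x} h *
         ennreal (ray_kernel s h * (u x - u (x + h))\<^sup>2))) \<le>
      ennreal (8 * L * (1 - s)) * (indicator \<Omega> (x + h) *
     ennreal ((u x - u (x + h))\<^sup>2 * gagliardo_kernel s h))"
    proof (cases "x \<in> ball z r1 \<and> h \<in> vcone \<and> 4 * L * bdist \<Omega> x \<le> norm h \<and> norm h \<le> \<delta> \<and> \<mu> * norm h < 4 * L * bdist \<Omega> x")
      case True
      have "norm h / 2 \<le> \<mu> * norm h" using \<mu> mult_right_mono[of "1/2" \<mu> "norm h"] by simp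
      then have hb: "norm h < 8 * L * bdist \<Omega> x" using True by linarith
      then have b: "0 < bdist \<Omega> x" by (cases "bdist \<Omega> x = 0") (auto simp: less_le)
      then have "0 < 4 * L * bdist \<Omega> x" using L_ge by simp
      then have h0: "0 < norm h" using True by linarith
      have "x + 1 *\<^sub>R h \<in> \<Omega>"
        using True r1 h0 by (intro cone_shift(1)[of x r1 h \<delta> 1] vcone_inner_pos) auto
      then have xh: "x + h \<in> \<Omega>" by simp
      have "bdist \<Omega> x powr (- s) \<le> (norm h / (8 * L)) powr (- s)"
        using hb h0 L_ge s by (intro powr_mono2') (auto simp: field_simps)
      also have "\<dots> = (8 * L) powr s * norm h powr (- s)"
        using L_ge by (simp add: powr_divide powr_minus field_simps)
      also have "\<dots> \<le> 8 * L * norm h powr (- s)"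
        using powr_mono[of s 1 "8 * L"] s L_ge by (intro mult_right_mono) auto
      finally have "layer_weight \<Omega> s x * (ray_kernel s h * (u x - u (x + h))\<^sup>2) \<le>
         (1 - s) * (8 * L * norm h powr (- s)) * (ray_kernel s h * (u x - u (x + h))\<^sup>2)"
        using s by (intro mult_right_mono mult_left_mono) auto
      also have "\<dots> = 8 * L * (1 - s) * ((u x - u (x + h))\<^sup>2 * (norm h powr (- s) * ray_kernel s h))"
        by (simp only: mult_ac)
      also have "norm h powr (- s) * ray_kernel s h = gagliardo_kernel s h"
      proof -
        have "- s + - (real DIM('a) + s) = - (real DIM('a) + 2 * s)" by simp
        then show ?thesis by (simp only: powr_add[symmetric])
      qed
      finally show ?thesis using True xh s L_ge
        by (auto simp: ennreal_mult[symmetric] indicator_def intro!: ennreal_leI)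
    next
      case False
      then show ?thesis by (auto simp: indicator_def)
    qed
  qed
  also have "\<dots> = ennreal (8 * L * (1 - s)) * (\<integral>\<^sup>+x. \<integral>\<^sup>+h. indicator \<Omega> (x + h) *
     ennreal ((u x - u (x + h))\<^sup>2 * gagliardo_kernel s h) \<partial>lborel \<partial>lborel)"
    by (simp add: nn_integral_cmult)
  also have "\<dots> = ennreal (8 * L) * cross_energy \<Omega> s u"
    using s L_ge by (subst cross_energy_swap) (simp_all add: ennreal_mult mult.assoc)
  finally show ?thesis .
qed

text \<open>
  In terms of the end point \<open>y = x + \<mu> *\<^sub>R h\<close> the length of \<open>h\<close> is comparable with \<open>bdist \<Omega> y\<close>, so \<open>x\<close>
  ranges over a ball around \<open>y\<close> of radius comparable with \<open>bdist \<Omega> y\<close>. Integrating its weight with \<open>bdist_layer\<close> leaves the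
  power of \<open>bdist \<Omega> y\<close> that \<open>whitney_poincare\<close> requires.
\<close>

lemma oscillation_along_rays:
  fixes u :: "'a \<Rightarrow> real"
  assumes [measurable]: "u \<in> borel_measurable borel" and s: "0 < s" "s < 1" and \<mu>: "1 / 2 \<le> \<mu>" "\<mu> \<le> 1"
    and r1: "r1 \<le> r / 2"
  shows "(\<integral>\<^sup>+x. indicator (ball z r1) x * (ennreal (layer_weight \<Omega> s x) *
      (\<integral>\<^sup>+h. indicator {h. x + \<mu> *\<^sub>R h \<in> \<Omega> \<and> norm h \<le> 8 * L * bdist \<Omega> (x + \<mu> *\<^sub>R h) \<and> bdist \<Omega> (x + \<mu> *\<^sub>R h) \<le> 2 * norm h} h *
         (ennreal (norm h powr (- (2 * real DIM('a) + s))) * local_osc \<Omega> u (x + \<mu> *\<^sub>R h)) \<partial>lborel)) \<partial>lborel)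
    \<le> ennreal (layer_const * (16 * 8 * (9 * L)) ^ (DIM('a) + 1)) * cross_energy \<Omega> s u"
proof -
  define d where "d = real DIM('a)"
  have d1: "1 \<le> d" using DIM_positive[where 'a='a] unfolding d_def by linarith
  define w where "w x = ennreal (layer_weight \<Omega> s x)" for x
  have [measurable]: "w \<in> borel_measurable borel" unfolding w_def by measurable
  define g where "g x y = indicator (ball z r1) x * (w x * (indicator \<Omega> y *
    (indicator {x. norm (x - y) \<le> 8 * L * bdist \<Omega> y} x *
      (ennreal (2 powr (2 * d + s) * bdist \<Omega> y powr (- (2 * d + s))) * local_osc \<Omega> u y))))" for x y
  have [measurable]: "case_prod g \<in> borel_measurable (borel \<Otimes>\<^sub>M borel)"
    unfolding g_def indicator_def by measurable
  have "(\<integral>\<^sup>+x. indicator (ball z r1) x * (w x *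
      (\<integral>\<^sup>+h. indicator {h. x + \<mu> *\<^sub>R h \<in> \<Omega> \<and> norm h \<le> 8 * L * bdist \<Omega> (x + \<mu> *\<^sub>R h) \<and> bdist \<Omega> (x + \<mu> *\<^sub>R h) \<le> 2 * norm h} h *
         (ennreal (norm h powr (- (2 * d + s))) * local_osc \<Omega> u (x + \<mu> *\<^sub>R h)) \<partial>lborel)) \<partial>lborel)
    = (\<integral>\<^sup>+x. \<integral>\<^sup>+h. indicator (ball z r1) x * (w x *
      (indicator {h. x + \<mu> *\<^sub>R h \<in> \<Omega> \<and> norm h \<le> 8 * L * bdist \<Omega> (x + \<mu> *\<^sub>R h) \<and> bdist \<Omega> (x + \<mu> *\<^sub>R h) \<le> 2 * norm h} h *
         (ennreal (norm h powr (- (2 * d + s))) * local_osc \<Omega> u (x + \<mu> *\<^sub>R h)))) \<partial>lborel \<partial>lborel)"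
    by (simp add: nn_integral_cmult)
  also have "\<dots> \<le> (\<integral>\<^sup>+x. \<integral>\<^sup>+h. g x (x + \<mu> *\<^sub>R h) \<partial>lborel \<partial>lborel)"
  proof (intro nn_integral_mono)
    fix x h :: 'a
    let ?y = "x + \<mu> *\<^sub>R h"
    show "indicator (ball z r1) x * (w x *
      (indicator {h. x + \<mu> *\<^sub>R h \<in> \<Omega> \<and> norm h \<le> 8 * L * bdist \<Omega> (x + \<mu> *\<^sub>R h) \<and> bdist \<Omega> (x + \<mu> *\<^sub>R h) \<le> 2 * norm h} h *
         (ennreal (norm h powr (- (2 * d + s))) * local_osc \<Omega> u (x + \<mu> *\<^sub>R h)))) \<le> g x (x + \<mu> *\<^sub>R h)"
    proof (cases "?y \<in> \<Omega> \<and> norm h \<le> 8 * L * bdist \<Omega> ?y \<and> bdist \<Omega> ?y \<le> 2 * norm h")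
      case True
      have "norm (\<mu> *\<^sub>R h) \<le> norm h" using \<mu> by (simp add: mult_left_le_one_le)
      then have n: "norm (x - ?y) \<le> 8 * L * bdist \<Omega> ?y" using True by simp
      have "norm h powr (- (2 * d + s)) \<le> 2 powr (2 * d + s) * bdist \<Omega> ?y powr (- (2 * d + s))"
      proof (cases "bdist \<Omega> ?y = 0")
        case False
        then have "0 < bdist \<Omega> ?y" using bdist_nonneg[of \<Omega> ?y] by linarith
        then have "norm h powr (- (2 * d + s)) \<le> (bdist \<Omega> ?y / 2) powr (- (2 * d + s))"
          using True s d1 by (intro powr_mono2') auto
        also have "\<dots> = 2 powr (2 * d + s) * bdist \<Omega> ?y powr (- (2 * d + s))"
          using powr_minus[of 2 "2 * d + s"] by (simp add: powr_divide field_simps)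
        finally show ?thesis .
      qed (use True in auto)
      then show ?thesis
        using True n unfolding g_def by (auto intro!: mult_left_mono mult_right_mono ennreal_leI)
    qed auto
  qed
  also have "\<dots> \<le> (\<integral>\<^sup>+x. ennreal (2 ^ DIM('a)) * (\<integral>\<^sup>+y. g x y \<partial>lborel) \<partial>lborel)"
  proof (intro nn_integral_mono)
    fix x
    have "1 / \<mu> ^ DIM('a) \<le> 1 / (1 / 2) ^ DIM('a)"
      using \<mu> by (intro divide_left_mono power_mono mult_pos_pos) auto
    then have "ennreal (1 / \<mu> ^ DIM('a)) * (\<integral>\<^sup>+y. g x y \<partial>lborel) \<le> ennreal (2 ^ DIM('a)) * (\<integral>\<^sup>+y. g x y \<partial>lborel)"
      by (intro mult_right_mono ennreal_leI) (auto simp: power_one_over)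
    then show "(\<integral>\<^sup>+h. g x (x + \<mu> *\<^sub>R h) \<partial>lborel) \<le> ennreal (2 ^ DIM('a)) * (\<integral>\<^sup>+y. g x y \<partial>lborel)"
      using \<mu> by (subst nn_integral_lborel_affine) auto
  qed
  also have "\<dots> = ennreal (2 ^ DIM('a)) * (\<integral>\<^sup>+x. \<integral>\<^sup>+y. g x y \<partial>lborel \<partial>lborel)"
    by (subst nn_integral_cmult) auto
  also have "(\<integral>\<^sup>+x. \<integral>\<^sup>+y. g x y \<partial>lborel \<partial>lborel) = (\<integral>\<^sup>+y. \<integral>\<^sup>+x. g x y \<partial>lborel \<partial>lborel)"
    by (rule lborel_swap) measurable
  also have "ennreal (2 ^ DIM('a)) * (\<integral>\<^sup>+y. \<integral>\<^sup>+x. g x y \<partial>lborel \<partial>lborel) \<le> ennreal (2 ^ DIM('a)) *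
    (\<integral>\<^sup>+y. ennreal (2 powr (2 * d + s) * layer_const * (9 * L) powr (d - s)) *
      (indicator \<Omega> y * (ennreal (bdist \<Omega> y powr (- (d + 2 * s))) * local_osc \<Omega> u y)) \<partial>lborel)"
  proof (intro mult_left_mono nn_integral_mono)
    fix y
    define c where "c = indicator \<Omega> y * (ennreal (2 powr (2 * d + s) * bdist \<Omega> y powr (- (2 * d + s))) * local_osc \<Omega> u y)"
    have "(\<integral>\<^sup>+x. g x y \<partial>lborel) = (\<integral>\<^sup>+x. (indicator (ball z r1) x * (w x * indicator {x. norm (x - y) \<le> 8 * L * bdist \<Omega> y} x)) * c \<partial>lborel)"
      by (simp add: g_def c_def mult_ac)
    also have "\<dots> = (\<integral>\<^sup>+x. indicator (ball z r1) x * (w x * indicator {x. norm (x - y) \<le> 8 * L * bdist \<Omega> y} x) \<partial>lborel) * c"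
      by (rule nn_integral_multc) measurable
    finally have 1: "(\<integral>\<^sup>+x. g x y \<partial>lborel) = (\<integral>\<^sup>+x. indicator (ball z r1) x * (w x * indicator {x. norm (x - y) \<le> 8 * L * bdist \<Omega> y} x) \<partial>lborel) * c" .
    show "(\<integral>\<^sup>+x. g x y \<partial>lborel) \<le> ennreal (2 powr (2 * d + s) * layer_const * (9 * L) powr (d - s)) *
      (indicator \<Omega> y * (ennreal (bdist \<Omega> y powr (- (d + 2 * s))) * local_osc \<Omega> u y))"
    proof (cases "bdist \<Omega> y = 0")
      case True
      then show ?thesis by (subst 1) (simp add: c_def)
    next
      case False
      then have b: "0 < bdist \<Omega> y" using bdist_nonneg[of \<Omega> y] by linarith
      have "(\<integral>\<^sup>+x. indicator (ball z r1) x * (w x * indicator {x. norm (x - y) \<le> 8 * L * bdist \<Omega> y} x) \<partial>lborel) \<le>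
        (\<integral>\<^sup>+x. indicator (ball y (9 * L * bdist \<Omega> y) \<inter> ball z (r / 2)) x * ennreal (layer_weight \<Omega> s x) \<partial>lborel)"
      proof (intro nn_integral_mono)
        fix x
        have "8 * L * bdist \<Omega> y < 9 * L * bdist \<Omega> y" using b L_ge by simp
        then show "indicator (ball z r1) x * (w x * indicator {x. norm (x - y) \<le> 8 * L * bdist \<Omega> y} x) \<le>
          indicator (ball y (9 * L * bdist \<Omega> y) \<inter> ball z (r / 2)) x * ennreal (layer_weight \<Omega> s x)"
          using r1 by (auto simp: w_def indicator_def dist_norm norm_minus_commute)
      qed
      also have "\<dots> \<le> ennreal (layer_const * (9 * L * bdist \<Omega> y) powr (real DIM('a) - s))"
        using b L_ge by (intro bdist_layer s) auto
      finally have "(\<integral>\<^sup>+x. g x y \<partial>lborel) \<le> ennreal (layer_const * (9 * L * bdist \<Omega> y) powr (real DIM('a) - s)) * c"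
        unfolding 1 by (rule mult_right_mono) simp
      also have "\<dots> = ennreal (layer_const * (9 * L * bdist \<Omega> y) powr (d - s) * (2 powr (2 * d + s) * bdist \<Omega> y powr (- (2 * d + s)))) *
          (indicator \<Omega> y * local_osc \<Omega> u y)"
        unfolding c_def d_def[symmetric] using layer_const_pos by (simp add: ennreal_mult mult_ac)
      also have "layer_const * (9 * L * bdist \<Omega> y) powr (d - s) * (2 powr (2 * d + s) * bdist \<Omega> y powr (- (2 * d + s)))
         = 2 powr (2 * d + s) * layer_const * (9 * L) powr (d - s) * (bdist \<Omega> y powr (d - s) * bdist \<Omega> y powr (- (2 * d + s)))"
        using L_ge by (simp add: powr_mult mult_ac)
      also have "bdist \<Omega> y powr (d - s) * bdist \<Omega> y powr (- (2 * d + s)) = bdist \<Omega> y powr (- (d + 2 * s))"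
        by (simp add: powr_add[symmetric])
      finally show ?thesis using layer_const_pos by (simp add: ennreal_mult mult_ac)
    qed
  qed simp
  also have "\<dots> = ennreal (2 ^ DIM('a)) * (ennreal (2 powr (2 * d + s) * layer_const * (9 * L) powr (d - s)) *
    (\<integral>\<^sup>+y. indicator \<Omega> y * (ennreal (bdist \<Omega> y powr (- (d + 2 * s))) * local_osc \<Omega> u y) \<partial>lborel))"
    by (subst nn_integral_cmult) auto
  also have "\<dots> \<le> ennreal (2 ^ DIM('a)) * (ennreal (2 powr (2 * d + s) * layer_const * (9 * L) powr (d - s)) * (8 * cross_energy \<Omega> s u))"
    unfolding d_def by (intro mult_left_mono whitney_poincare s) auto
  also have "\<dots> = ennreal (2 ^ DIM('a) * (2 powr (2 * d + s) * layer_const * (9 * L) powr (d - s)) * 8) * cross_energy \<Omega> s u"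
    using layer_const_pos by (simp add: ennreal_mult mult_ac)
  also have "\<dots> \<le> ennreal (layer_const * (16 * 8 * (9 * L)) ^ (DIM('a) + 1)) * cross_energy \<Omega> s u"
  proof (intro mult_right_mono ennreal_leI)
    have "2 powr (2 * d + s) \<le> 2 powr (2 * d + 1)" using s by (intro powr_mono) auto
    also have "\<dots> = 2 * 4 ^ DIM('a)"
      by (simp add: powr_add d_def powr_powr[symmetric] powr_realpow)
    finally have 1: "2 powr (2 * d + s) \<le> 2 * 4 ^ DIM('a)" .
    have "(9 * L) powr (d - s) \<le> (9 * L) powr d" using s L_ge by (intro powr_mono) auto
    also have "\<dots> = (9 * L) ^ DIM('a)" using L_ge by (simp add: d_def powr_realpow)
    finally have 2: "(9 * L) powr (d - s) \<le> (9 * L) ^ DIM('a)" .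
    have "2 ^ DIM('a) * (2 powr (2 * d + s) * layer_const * (9 * L) powr (d - s)) * 8 \<le>
      2 ^ DIM('a) * ((2 * 4 ^ DIM('a)) * layer_const * (9 * L) ^ DIM('a)) * 8"
      using 1 2 layer_const_pos L_ge
      by (intro mult_right_mono[of _ _ 8] mult_left_mono[of _ _ "2 ^ DIM('a)"] mult_mono[of _ _ "_ powr _"] mult_right_mono[of _ _ layer_const]) auto
    also have "\<dots> = layer_const * (16 * (8 * (9 * L)) ^ DIM('a))"
    proof -
      have "(72::real) ^ DIM('a) = 2 ^ DIM('a) * (4 ^ DIM('a) * 9 ^ DIM('a))"
        by (simp add: power_mult_distrib[symmetric])
      then show ?thesis by (simp add: power_mult_distrib)
    qed
    also have "\<dots> \<le> layer_const * (16 * 8 * (9 * L)) ^ (DIM('a) + 1)"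
    proof (intro mult_left_mono)
      have *: "16 * A ^ n \<le> B ^ (n + 1)" if "0 \<le> A" "A \<le> B" "16 \<le> B" for A B :: real and n
        using that by (auto intro!: mult_mono power_mono)
      show "16 * (8 * (9 * L)) ^ DIM('a) \<le> (16 * 8 * (9 * L)) ^ (DIM('a) + 1)"
        by (rule *) (use L_ge in auto)
    qed (use layer_const_pos in simp)
    finally show "2 ^ DIM('a) * (2 powr (2 * d + s) * layer_const * (9 * L) powr (d - s)) * 8 \<le> layer_const * (16 * 8 * (9 * L)) ^ (DIM('a) + 1)" .
  qed simp
  finally show ?thesis unfolding w_def d_def .
qed

text \<open>
  For each exterior point \<open>x\<close> \<open>cone_hardy\<close> leaves short rays and differences between \<open>x + \<mu> *\<^sub>R h\<close> and \<open>x + h\<close>.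
  The ratio \<open>\<mu>\<close> is so close to \<open>1\<close> that both points lie in a common small ball, over which the difference is
  averaged; the ball is contained in the Whitney balls of both points.
\<close>

lemma cone_trace_estimate:
  assumes s0: "0 < s0" and r1: "r1 + \<delta> < r / 2" "0 \<le> \<delta>"
  obtains C where "0 < C" "\<And>s u. s0 \<le> s \<Longrightarrow> s < 1 \<Longrightarrow> u \<in> borel_measurable borel \<Longrightarrow>
    (\<integral>\<^sup>+x. indicator (ball z r1 - \<Omega>) x * (ennreal (layer_weight \<Omega> s x) *
      ray_energy \<delta> s u x) \<partial>lborel)
    \<le> ennreal C * cross_energy \<Omega> s u"
proof -
  \<comment> \<open>Both \<open>x + \<mu> *\<^sub>R h\<close> and \<open>x + h\<close> have distance at least \<open>norm h / (8 * L)\<close> from the boundary, eight times their distance from each other.\<close>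
  define \<mu> where "\<mu> = 1 - 1 / (64 * L)"
  have "1 / (64 * L) \<le> 1 / 64" using L_ge by (intro divide_left_mono) auto
  then have \<mu>: "1 / 2 \<le> \<mu>" "0 < \<mu>" "\<mu> < 1" using L_ge by (auto simp: \<mu>_def)
  obtain K where K: "0 < K" "\<And>s (F :: 'a \<Rightarrow> real) H c m \<delta>.
     s0 \<le> s \<Longrightarrow> F \<in> borel_measurable borel \<Longrightarrow> H \<in> sets borel \<Longrightarrow> (\<And>h t. h \<in> H \<Longrightarrow> 0 < t \<Longrightarrow> t *\<^sub>R h \<in> H) \<Longrightarrow> 0 < m \<Longrightarrow>
     (\<integral>\<^sup>+h. indicator {h \<in> H. m \<le> norm h \<and> norm h \<le> \<delta>} h * ennreal (ray_kernel s h * (c - F h)\<^sup>2) \<partial>lborel) \<le>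
     ennreal K * (
      (\<integral>\<^sup>+h. indicator {h \<in> H. m \<le> norm h \<and> norm h \<le> \<delta> \<and> \<mu> * norm h < m} h * ennreal (ray_kernel s h * (c - F h)\<^sup>2) \<partial>lborel) +
      (\<integral>\<^sup>+h. indicator {h \<in> H. m \<le> \<mu> * norm h \<and> norm h \<le> \<delta>} h * ennreal (ray_kernel s h * (F (\<mu> *\<^sub>R h) - F h)\<^sup>2) \<partial>lborel))"
    using cone_hardy[OF s0 \<mu>(2,3)] by blast
  define v where "v = unit_ball_vol (real DIM('a))"
  have v: "0 < v" by (simp add: v_def unit_ball_vol_pos)
  define C1 where "C1 = 2 * (64 * L) ^ DIM('a) / v"
  have C1: "0 < C1" using v L_ge by (simp add: C1_def)
  define C2 where "C2 = layer_const * (16 * 8 * (9 * L)) ^ (DIM('a) + 1)"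
  have C2: "0 < C2" using layer_const_pos L_ge by (simp add: C2_def)
  show thesis
  proof (rule that)
    show "0 < K * (8 * L + C1 * (2 * C2))" using K C1 C2 L_ge by (intro mult_pos_pos add_pos_pos) auto
    fix s and u :: "'a \<Rightarrow> real"
    assume s: "s0 \<le> s" "s < 1" and [measurable]: "u \<in> borel_measurable borel"
    have s': "0 < s" using s s0 by simp
    define w where "w x = ennreal (layer_weight \<Omega> s x)" for x
    have [measurable]: "w \<in> borel_measurable borel" unfolding w_def by measurable
    define b where "b x = (\<integral>\<^sup>+h. indicator {h \<in> vcone. 4 * L * bdist \<Omega> x \<le> norm h \<and> norm h \<le> \<delta> \<and> \<mu> * norm h < 4 * L * bdist \<Omega> x} h *
         ennreal (ray_kernel s h * (u x - u (x + h))\<^sup>2) \<partial>lborel)" for x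
    have [measurable]: "b \<in> borel_measurable borel" unfolding b_def indicator_def by measurable
    define S where "S t x = {h. x + t *\<^sub>R h \<in> \<Omega> \<and> norm h \<le> 8 * L * bdist \<Omega> (x + t *\<^sub>R h) \<and> bdist \<Omega> (x + t *\<^sub>R h) \<le> 2 * norm h}" for t x
    define ray_osc where "ray_osc t x = (\<integral>\<^sup>+h. indicator (S t x) h *
         (ennreal (norm h powr (- (2 * real DIM('a) + s))) * local_osc \<Omega> u (x + t *\<^sub>R h)) \<partial>lborel)" for t x
    have [measurable]: "ray_osc t \<in> borel_measurable borel" for t unfolding ray_osc_def S_def indicator_def by measurable
    have osc: "ennreal (ray_kernel s h * (u (x + \<mu> *\<^sub>R h) - u (x + h))\<^sup>2) \<le>
        ennreal C1 * (indicator (S \<mu> x) h * (ennreal (norm h powr (- (2 * real DIM('a) + s))) * local_osc \<Omega> u (x + \<mu> *\<^sub>R h)) +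
          indicator (S 1 x) h * (ennreal (norm h powr (- (2 * real DIM('a) + s))) * local_osc \<Omega> u (x + 1 *\<^sub>R h)))"
      if x: "x \<in> ball z r1" and h: "h \<in> vcone" "4 * L * bdist \<Omega> x \<le> \<mu> * norm h" "norm h \<le> \<delta>" for x h
    proof (cases "h = 0")
      case False
      let ?A = "x + \<mu> *\<^sub>R h" and ?B = "x + h" and ?p = "norm h / (64 * L)"
      have hpos: "0 < norm h" using False by simp
      have "\<mu> * norm h \<le> 1 * norm h" using \<mu> by (intro mult_right_mono) auto
      then have m1: "4 * L * bdist \<Omega> x \<le> 1 * norm h" using h by linarith
      note A = cone_shift[OF x h(1,3) \<mu>(1) less_imp_le[OF \<mu>(3)] r1(1) vcone_inner_pos[OF h(1) False] h(2)]
      have B: "x + 1 *\<^sub>R h \<in> \<Omega>" "norm h \<le> 8 * L * bdist \<Omega> (x + 1 *\<^sub>R h)" "bdist \<Omega> (x + 1 *\<^sub>R h) \<le> 2 * norm h"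
        using m1 by (intro cone_shift[OF x h(1,3) _ _ r1(1) vcone_inner_pos[OF h(1) False]]; simp)+
      have SA: "h \<in> S \<mu> x" "h \<in> S 1 x" using A B by (auto simp: S_def)
      have p: "0 < ?p" "8 * ?p \<le> bdist \<Omega> ?A" "8 * ?p \<le> bdist \<Omega> ?B"
        using A(2) B(2) hpos L_ge by (auto simp: field_simps)
      have AB: "norm (?B - ?A) \<le> ?p"
      proof -
        have "?B - ?A = (1 / (64 * L)) *\<^sub>R h" by (simp add: \<mu>_def algebra_simps)
        then show ?thesis using L_ge by simp
      qed
      have sub: "(\<integral>\<^sup>+q. indicator (ball ?B ?p) q * ennreal ((u y - u q)\<^sup>2) \<partial>lborel) \<le> local_osc \<Omega> u y"
        if "norm (?B - y) \<le> ?p" "8 * ?p \<le> bdist \<Omega> y" for y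
        unfolding local_osc_def
      proof (intro nn_integral_mono mult_right_mono)
        fix q
        have "4 * norm (q - y) \<le> bdist \<Omega> y" if "q \<in> ball ?B ?p"
        proof -
          have "norm (q - y) \<le> norm (q - ?B) + norm (?B - y)" using norm_triangle_ineq[of "q - ?B" "?B - y"] by simp
          moreover have "norm (q - ?B) < ?p" using that by (simp only: mem_ball dist_norm norm_minus_commute)
          ultimately show ?thesis using \<open>norm (?B - y) \<le> ?p\<close> \<open>8 * ?p \<le> bdist \<Omega> y\<close> by linarith
        qed
        then show "indicator (ball ?B ?p) q \<le> (indicator {z. 4 * norm (z - y) \<le> bdist \<Omega> y} q :: ennreal)"
          by (auto simp: indicator_def)
      qed simp
      have "ennreal ((u ?A - u ?B)\<^sup>2) * ennreal (v * ?p ^ DIM('a)) \<le>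
        2 * (\<integral>\<^sup>+q. indicator (ball ?B ?p) q * ennreal ((u ?A - u q)\<^sup>2) \<partial>lborel) +
        2 * (\<integral>\<^sup>+q. indicator (ball ?B ?p) q * ennreal ((u ?B - u q)\<^sup>2) \<partial>lborel)"
        using averaging[of u "ball ?B ?p" "u ?A" "u ?B"] p by (simp add: emeasure_ball v_def)
      also have "\<dots> \<le> 2 * local_osc \<Omega> u ?A + 2 * local_osc \<Omega> u ?B"
        using p AB by (intro add_mono mult_left_mono sub) auto
      finally have "ennreal ((u ?A - u ?B)\<^sup>2) * ennreal (v * ?p ^ DIM('a)) \<le> 2 * (local_osc \<Omega> u ?A + local_osc \<Omega> u ?B)"
        by (simp add: distrib_left)
      then have "ennreal (ray_kernel s h / (v * ?p ^ DIM('a))) * (ennreal ((u ?A - u ?B)\<^sup>2) * ennreal (v * ?p ^ DIM('a))) \<le>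
          ennreal (ray_kernel s h / (v * ?p ^ DIM('a))) * (2 * (local_osc \<Omega> u ?A + local_osc \<Omega> u ?B))"
        by (rule mult_left_mono) simp
      also have "ennreal (ray_kernel s h / (v * ?p ^ DIM('a))) * (ennreal ((u ?A - u ?B)\<^sup>2) * ennreal (v * ?p ^ DIM('a))) =
          ennreal (ray_kernel s h * (u ?A - u ?B)\<^sup>2)"
        using v p(1) L_ge by (simp add: ennreal_mult[symmetric])
      also have "ennreal (ray_kernel s h / (v * ?p ^ DIM('a))) * (2 * (local_osc \<Omega> u ?A + local_osc \<Omega> u ?B)) =
          ennreal (2 * (ray_kernel s h / (v * ?p ^ DIM('a)))) * (local_osc \<Omega> u ?A + local_osc \<Omega> u ?B)"
      proof -
        have *: "ennreal y * (2 * c) = ennreal (2 * y) * c" if "0 \<le> y" for y c using that by (simp add: ennreal_mult mult_ac)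
        show ?thesis by (rule *) (use v L_ge in simp)
      qed
      also have "2 * (ray_kernel s h / (v * ?p ^ DIM('a))) = C1 * norm h powr (- (2 * real DIM('a) + s))"
      proof -
        have "norm h powr (- (2 * real DIM('a) + s)) = ray_kernel s h * norm h powr (- real DIM('a))"
          by (simp add: powr_add[symmetric])
        also have "norm h powr (- real DIM('a)) = 1 / norm h ^ DIM('a)"
          using hpos by (simp add: powr_minus powr_realpow divide_inverse)
        finally show ?thesis using L_ge v hpos by (simp add: C1_def power_divide field_simps)
      qed
      finally show ?thesis using SA C1 by (simp add: ennreal_mult distrib_left mult.assoc)
    qed simp
    \<comment> \<open>Where \<open>bdist \<Omega> x = 0\<close> the weight is zero by the convention \<open>0 powr a = 0\<close>, so \<open>cone_hardy\<close> is only needed with a positive cut-off.\<close>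
    have pt: "indicator (ball z r1 - \<Omega>) x * (w x *
      ray_energy \<delta> s u x) \<le>
      ennreal K * (indicator (ball z r1 - \<Omega>) x * (w x * b x) +
       ennreal C1 * (indicator (ball z r1) x * (w x * ray_osc \<mu> x) + indicator (ball z r1) x * (w x * ray_osc 1 x)))" for x
    proof (cases "x \<in> ball z r1 - \<Omega> \<and> bdist \<Omega> x \<noteq> 0")
      case True
      then have "0 < bdist \<Omega> x" using bdist_nonneg[of \<Omega> x] by linarith
      then have m: "0 < 4 * L * bdist \<Omega> x" using L_ge by simp
      have "ray_energy \<delta> s u x \<le>
        ennreal K * (b x + (\<integral>\<^sup>+h. indicator {h \<in> vcone. 4 * L * bdist \<Omega> x \<le> \<mu> * norm h \<and> norm h \<le> \<delta>} h *
          ennreal (ray_kernel s h * (u (x + \<mu> *\<^sub>R h) - u (x + h))\<^sup>2) \<partial>lborel))"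
        unfolding b_def by (rule K(2)[of s "\<lambda>h. u (x + h)", OF s(1)]) (use m vcone_scale in auto)
      also have "\<dots> \<le> ennreal K * (b x + (\<integral>\<^sup>+h. ennreal C1 *
          (indicator (S \<mu> x) h * (ennreal (norm h powr (- (2 * real DIM('a) + s))) * local_osc \<Omega> u (x + \<mu> *\<^sub>R h)) +
           indicator (S 1 x) h * (ennreal (norm h powr (- (2 * real DIM('a) + s))) * local_osc \<Omega> u (x + 1 *\<^sub>R h))) \<partial>lborel))"
        using True osc by (intro mult_left_mono add_left_mono nn_integral_mono) (auto split: split_indicator)
      also have "(\<integral>\<^sup>+h. ennreal C1 *
          (indicator (S \<mu> x) h * (ennreal (norm h powr (- (2 * real DIM('a) + s))) * local_osc \<Omega> u (x + \<mu> *\<^sub>R h)) +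
           indicator (S 1 x) h * (ennreal (norm h powr (- (2 * real DIM('a) + s))) * local_osc \<Omega> u (x + 1 *\<^sub>R h))) \<partial>lborel) =
          ennreal C1 * (ray_osc \<mu> x + ray_osc 1 x)"
        unfolding ray_osc_def S_def indicator_def
        by (subst nn_integral_cmult, measurable, subst nn_integral_add, measurable)
      finally have "w x * ray_energy \<delta> s u x \<le>
         w x * (ennreal K * (b x + ennreal C1 * (ray_osc \<mu> x + ray_osc 1 x)))" by (rule mult_left_mono) simp
      then show ?thesis using True by (simp add: distrib_left mult_ac)
    next
      case False
      then show ?thesis by (auto simp: w_def indicator_def)
    qed
    have "(\<integral>\<^sup>+x. indicator (ball z r1 - \<Omega>) x * (w x *
      ray_energy \<delta> s u x) \<partial>lborel) \<le>
      (\<integral>\<^sup>+x. ennreal K * (indicator (ball z r1 - \<Omega>) x * (w x * b x) +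
       ennreal C1 * (indicator (ball z r1) x * (w x * ray_osc \<mu> x) + indicator (ball z r1) x * (w x * ray_osc 1 x))) \<partial>lborel)"
      by (intro nn_integral_mono pt)
    also have "\<dots> = ennreal K * ((\<integral>\<^sup>+x. indicator (ball z r1 - \<Omega>) x * (w x * b x) \<partial>lborel) +
       ennreal C1 * ((\<integral>\<^sup>+x. indicator (ball z r1) x * (w x * ray_osc \<mu> x) \<partial>lborel) + (\<integral>\<^sup>+x. indicator (ball z r1) x * (w x * ray_osc 1 x) \<partial>lborel)))"
      by (simp add: nn_integral_cmult nn_integral_add)
    also have "\<dots> \<le> ennreal K * (ennreal (8 * L) * cross_energy \<Omega> s u +
       ennreal C1 * (2 * (ennreal C2 * cross_energy \<Omega> s u)))"
      unfolding mult_2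
    proof (intro mult_left_mono add_mono)
      show "(\<integral>\<^sup>+x. indicator (ball z r1 - \<Omega>) x * (w x * b x) \<partial>lborel) \<le> ennreal (8 * L) * cross_energy \<Omega> s u"
        unfolding w_def b_def by (rule short_rays_bound) (use s s' \<mu> r1 in auto)
      have "(\<integral>\<^sup>+x. indicator (ball z r1) x * (w x * ray_osc t x) \<partial>lborel) \<le> ennreal C2 * cross_energy \<Omega> s u"
        if "1 / 2 \<le> t" "t \<le> 1" for t
        unfolding w_def ray_osc_def S_def C2_def by (rule oscillation_along_rays) (use s s' that r1 in auto)
      then show "(\<integral>\<^sup>+x. indicator (ball z r1) x * (w x * ray_osc \<mu> x) \<partial>lborel) \<le> ennreal C2 * cross_energy \<Omega> s u"
        "(\<integral>\<^sup>+x. indicator (ball z r1) x * (w x * ray_osc 1 x) \<partial>lborel) \<le> ennreal C2 * cross_energy \<Omega> s u"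
        using \<mu> by auto
    qed auto
    also have "\<dots> = ennreal (K * (8 * L + C1 * (2 * C2))) * cross_energy \<Omega> s u"
      using K(1) C1 C2 L_ge by (simp add: ennreal_mult ennreal_plus distrib_left distrib_right mult.assoc)
    finally show "(\<integral>\<^sup>+x. indicator (ball z r1 - \<Omega>) x * (ennreal (layer_weight \<Omega> s x) *
      ray_energy \<delta> s u x) \<partial>lborel)
      \<le> ennreal (K * (8 * L + C1 * (2 * C2))) * cross_energy \<Omega> s u"
      unfolding w_def .
  qed
qed

end

section \<open>Local trace estimates\<close>

text \<open>
  The factors \<open>1 + bdist\<close> of the kernel describe its decay at infinity. Near the boundary, where they are
  bounded, the estimate loses at most a constant factor.
\<close>

lemma trace_kernel_le:
  fixes x y :: "'a::euclidean_space" and \<Omega> :: "'a set"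
  assumes s: "0 < s" "s < 1"
  defines "\<rho> \<equiv> norm (x - y) + bdist \<Omega> x + bdist \<Omega> y"
  shows "trace_kernel \<Omega> s x y * \<rho> ^ DIM('a) \<le> (layer_weight \<Omega> s x) * (layer_weight \<Omega> s y)"
proof (cases "bdist \<Omega> x = 0 \<or> bdist \<Omega> y = 0")
  case True
  then show ?thesis by (auto simp: trace_kernel_def)
next
  case False
  then have b: "0 < bdist \<Omega> x" "0 < bdist \<Omega> y" by (auto simp: less_le)
  let ?R = "norm (x - y) + bdist \<Omega> x * bdist \<Omega> y + bdist \<Omega> x + bdist \<Omega> y"
  have \<rho>: "0 < \<rho>" "\<rho> \<le> ?R" using b by (auto simp: \<rho>_def add_pos_pos add_nonneg_pos)
  have 1: "1 \<le> (1 + bdist \<Omega> x) powr s" "1 \<le> (1 + bdist \<Omega> y) powr s"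
    using b s by (auto intro!: ge_one_powr_ge_zero)
  have "bdist \<Omega> x powr s * bdist \<Omega> y powr s * \<rho> ^ DIM('a) \<le>
     bdist \<Omega> x powr s * (1 + bdist \<Omega> x) powr s * bdist \<Omega> y powr s * (1 + bdist \<Omega> y) powr s * ?R ^ DIM('a)"
  proof -
    have "bdist \<Omega> x powr s * 1 * bdist \<Omega> y powr s * 1 * \<rho> ^ DIM('a) \<le>
      bdist \<Omega> x powr s * (1 + bdist \<Omega> x) powr s * bdist \<Omega> y powr s * (1 + bdist \<Omega> y) powr s * ?R ^ DIM('a)"
      using 1 \<rho> by (intro mult_mono power_mono mult_nonneg_nonneg) auto
    then show ?thesis by simp
  qed
  then have "trace_kernel \<Omega> s x y \<le> (1 - s)\<^sup>2 / (bdist \<Omega> x powr s * bdist \<Omega> y powr s * \<rho> ^ DIM('a))"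
    unfolding trace_kernel_def using b \<rho> by (intro divide_left_mono mult_pos_pos) (auto simp: add_pos_pos)
  then have "trace_kernel \<Omega> s x y * \<rho> ^ DIM('a) \<le> (1 - s)\<^sup>2 / (bdist \<Omega> x powr s * bdist \<Omega> y powr s * \<rho> ^ DIM('a)) * \<rho> ^ DIM('a)"
    using \<rho> by (intro mult_right_mono) auto
  also have "\<dots> = (layer_weight \<Omega> s x) * (layer_weight \<Omega> s y)"
    using b \<rho> by (simp add: powr_minus field_simps power2_eq_square)
  finally show ?thesis .
qed

lemma trace_kernel_nonneg: "0 \<le> trace_kernel \<Omega> s x y"
  unfolding trace_kernel_def by (intro divide_nonneg_nonneg mult_nonneg_nonneg) auto

lemma trace_kernel_measurable [measurable]:
  "case_prod (trace_kernel (\<Omega> :: 'a::euclidean_space set) s) \<in> borel_measurable (borel \<Otimes>\<^sub>M borel)"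
  unfolding trace_kernel_def by measurable

context lipschitz_chart
begin

lemma bdist_near_center: "x \<in> ball z r1 \<Longrightarrow> bdist \<Omega> x < r1"
  unfolding bdist_def using infdist_le[OF center, of x] by (simp add: dist_commute)

text \<open>
  With \<open>\<rho> = norm (x - y) + bdist \<Omega> x + bdist \<Omega> y\<close>, the ball of radius \<open>\<rho>\<close> around \<open>x + (T * \<rho>) *\<^sub>R e\<close> lies in the
  cones of both \<open>x\<close> and \<open>y\<close>, at distance comparable with \<open>\<rho>\<close>. Averaging over it bounds \<open>(u x - u y)\<^sup>2\<close> by ray increments
  from \<open>x\<close> and from \<open>y\<close>. In the part that belongs to \<open>x\<close> the variable \<open>y\<close> is then integrated out with
  \<open>bdist_layer\<close>, which gives the left side of \<open>cone_trace_estimate\<close>.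
\<close>

lemma local_double_trace:
  assumes s0: "0 < s0" and r1: "0 < r1" "r1 + 32 * (L + 1) * r1 < r / 2"
  obtains C where "0 < C" "\<And>s u. s0 \<le> s \<Longrightarrow> s < 1 \<Longrightarrow> u \<in> borel_measurable borel \<Longrightarrow>
    (exterior_energy \<Omega> s (ball z r1 - \<Omega>) u) \<le> ennreal C * cross_energy \<Omega> s u"
proof -
  define \<delta> where "\<delta> = 32 * (L + 1) * r1"
  have \<delta>: "r1 + \<delta> < r / 2" "0 \<le> \<delta>" using r1 L_ge by (auto simp: \<delta>_def)
  obtain C where C: "0 < C" "\<And>s u. s0 \<le> s \<Longrightarrow> s < 1 \<Longrightarrow> u \<in> borel_measurable borel \<Longrightarrow>
    (\<integral>\<^sup>+x. indicator (ball z r1 - \<Omega>) x * (ennreal (layer_weight \<Omega> s x) *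
      ray_energy \<delta> s u x) \<partial>lborel)
    \<le> ennreal C * cross_energy \<Omega> s u"
    using cone_trace_estimate[OF s0 \<delta>] by blast
  define v where "v = unit_ball_vol (real DIM('a))"
  have v: "0 < v" by (simp add: v_def unit_ball_vol_pos)
  define B where "B = (8 * L + 8) ^ (2 * DIM('a))"
  have B: "0 < B" using L_ge by (simp add: B_def)
  define N where "N = ball z r1 - \<Omega>"
  have [measurable]: "N \<in> sets borel" unfolding N_def by measurable
  show thesis
  proof (rule that)
    show "0 < 2 / v * (2 * (B * layer_const * C))" using v B C(1) layer_const_pos by simp
    fix s and u :: "'a \<Rightarrow> real"
    assume s: "s0 \<le> s" "s < 1" and [measurable]: "u \<in> borel_measurable borel"
    have s': "0 < s" using s s0 by simp
    define w where "w x = layer_weight \<Omega> s x" for x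
    have w: "0 \<le> w x" for x using s by (simp add: w_def)
    have [measurable]: "w \<in> borel_measurable borel" unfolding w_def by measurable
    define \<rho> where "\<rho> x y = norm (x - y) + bdist \<Omega> x + bdist \<Omega> y" for x y
    have [measurable]: "case_prod \<rho> \<in> borel_measurable (borel \<Otimes>\<^sub>M borel)" unfolding \<rho>_def by measurable
    have \<rho>0: "0 \<le> \<rho> x y" for x y by (simp add: \<rho>_def)
    define A where "A x y = {h \<in> vcone. (8 * L + 4) * \<rho> x y \<le> norm h \<and> norm h \<le> (8 * L + 8) * \<rho> x y}" for x y
    define P where "P x y = ennreal (w x * w y / \<rho> x y ^ (2 * DIM('a))) *
       (\<integral>\<^sup>+h. indicator (A x y) h * ennreal ((u x - u (x + h))\<^sup>2) \<partial>lborel)" for x y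
    have [measurable]: "case_prod P \<in> borel_measurable (borel \<Otimes>\<^sub>M borel)"
      unfolding P_def A_def indicator_def by measurable
    have A_comm: "A y x = A x y" and \<rho>_comm: "\<rho> y x = \<rho> x y" for x y
      by (auto simp: A_def \<rho>_def norm_minus_commute add_ac)
    have pt: "ennreal ((u x - u y)\<^sup>2 * trace_kernel \<Omega> s x y) \<le> ennreal (2 / v) * (P x y + P y x)" for x y
    proof (cases "\<rho> x y = 0")
      case True
      then have "norm (x - y) = 0" using bdist_nonneg[of \<Omega> x] bdist_nonneg[of \<Omega> y] norm_ge_zero[of "x - y"]
        unfolding \<rho>_def by linarith
      then show ?thesis by simp
    next
      case False
      define R where "R = \<rho> x y"
      have R: "0 < R" using False \<rho>0[of x y] by (simp add: R_def)
      have xyR: "norm (x - y) \<le> R" by (simp add: R_def \<rho>_def)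
      \<comment> \<open>The ball has to fit into the cones of both points, where the opening of the cone is \<open>1 / (4 * L + 3)\<close> and the two points differ by at most \<open>R\<close>.\<close>
      define T where "T = 8 * L + 6"
      have T: "0 < T" using L_ge by (simp add: T_def)
      define W where "W = ball (x + (T * R) *\<^sub>R e) R"
      have Tdiv: "T * R / (4 * L + 3) = 2 * R"
        using L_ge by (simp add: T_def field_simps)
      have inA: "q - p \<in> A x y" if q: "q \<in> W" and p: "norm (x - p) \<le> R" for q p
      proof -
        have eq: "q - p - (T * R) *\<^sub>R e = (q - (x + (T * R) *\<^sub>R e)) + (x - p)" by simp
        have "norm (q - (x + (T * R) *\<^sub>R e)) < R"
          using q unfolding W_def by (simp only: mem_ball dist_norm norm_minus_commute)
        then have near: "norm (q - p - (T * R) *\<^sub>R e) \<le> 2 * R"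
          unfolding eq using p norm_triangle_ineq[of "q - (x + (T * R) *\<^sub>R e)" "x - p"] by linarith
        have "q - p \<in> vcone" by (rule vcone_near_axis[of _ "T * R"]) (use near Tdiv in simp)
        moreover have "norm ((T * R) *\<^sub>R e) = T * R" using T R norm_e by simp
        then have "T * R - 2 * R \<le> norm (q - p)" "norm (q - p) \<le> T * R + 2 * R"
          using near norm_triangle_ineq3[of "q - p" "(T * R) *\<^sub>R e"] by linarith+
        ultimately show ?thesis by (simp add: A_def T_def R_def[symmetric] algebra_simps)
      qed
      have sub: "(\<integral>\<^sup>+q. indicator W q * ennreal ((u p - u q)\<^sup>2) \<partial>lborel) \<le>
          (\<integral>\<^sup>+h. indicator (A x y) h * ennreal ((u p - u (p + h))\<^sup>2) \<partial>lborel)" if p: "norm (x - p) \<le> R" for p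
      proof -
        have "(\<integral>\<^sup>+q. indicator W q * ennreal ((u p - u q)\<^sup>2) \<partial>lborel) =
            (\<integral>\<^sup>+h. indicator W (h + p) * ennreal ((u p - u (h + p))\<^sup>2) \<partial>lborel)"
          unfolding W_def by (rule nn_integral_lborel_shift[symmetric]) measurable
        also have "\<dots> \<le> (\<integral>\<^sup>+h. indicator (A x y) h * ennreal ((u p - u (p + h))\<^sup>2) \<partial>lborel)"
          using inA[OF _ p, of "_ + p"] by (intro nn_integral_mono) (auto simp: add.commute split: split_indicator)
        finally show ?thesis .
      qed
      have "ennreal ((u x - u y)\<^sup>2) * ennreal (v * R ^ DIM('a)) \<le>
        2 * (\<integral>\<^sup>+q. indicator W q * ennreal ((u x - u q)\<^sup>2) \<partial>lborel) +
        2 * (\<integral>\<^sup>+q. indicator W q * ennreal ((u y - u q)\<^sup>2) \<partial>lborel)"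
        using averaging[of u W "u x" "u y"] R by (simp add: emeasure_ball v_def W_def)
      also have "\<dots> \<le> 2 * (\<integral>\<^sup>+h. indicator (A x y) h * ennreal ((u x - u (x + h))\<^sup>2) \<partial>lborel) +
          2 * (\<integral>\<^sup>+h. indicator (A x y) h * ennreal ((u y - u (y + h))\<^sup>2) \<partial>lborel)"
        using xyR R by (intro add_mono mult_left_mono sub) auto
      also have "\<dots> = 2 * ((\<integral>\<^sup>+h. indicator (A x y) h * ennreal ((u x - u (x + h))\<^sup>2) \<partial>lborel) +
          (\<integral>\<^sup>+h. indicator (A x y) h * ennreal ((u y - u (y + h))\<^sup>2) \<partial>lborel))" (is "_ = 2 * ?I")
        by (simp add: distrib_left)
      finally have avg: "ennreal ((u x - u y)\<^sup>2) * ennreal (v * R ^ DIM('a)) \<le> 2 * ?I" .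
      have kern: "trace_kernel \<Omega> s x y * R ^ DIM('a) \<le> w x * w y"
        unfolding R_def \<rho>_def w_def by (rule trace_kernel_le) (use s s' in auto)
      have "ennreal ((u x - u y)\<^sup>2 * trace_kernel \<Omega> s x y) \<le>
         ennreal ((w x * w y / R ^ (2 * DIM('a)) / v) * ((u x - u y)\<^sup>2 * (v * R ^ DIM('a))))"
      proof (rule ennreal_leI)
        have "trace_kernel \<Omega> s x y \<le> w x * w y / R ^ DIM('a)" using kern R by (simp add: field_simps)
        then have "(u x - u y)\<^sup>2 * trace_kernel \<Omega> s x y \<le> (u x - u y)\<^sup>2 * (w x * w y / R ^ DIM('a))"
          by (intro mult_left_mono) auto
        also have "\<dots> = (w x * w y / R ^ (2 * DIM('a)) / v) * ((u x - u y)\<^sup>2 * (v * R ^ DIM('a)))"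
        proof -
          have *: "a * (b / X) = (b / (X * X) / v) * (a * (v * X))" if "0 < X" for a b X :: real
            using v that by simp
          have sq: "R ^ (2 * DIM('a)) = R ^ DIM('a) * R ^ DIM('a)" by (simp only: mult_2 power_add)
          show ?thesis unfolding sq by (rule *) (use R in simp)
        qed
        finally show "(u x - u y)\<^sup>2 * trace_kernel \<Omega> s x y \<le> (w x * w y / R ^ (2 * DIM('a)) / v) * ((u x - u y)\<^sup>2 * (v * R ^ DIM('a)))" .
      qed
      also have "\<dots> = ennreal (w x * w y / R ^ (2 * DIM('a)) / v) * (ennreal ((u x - u y)\<^sup>2) * ennreal (v * R ^ DIM('a)))"
      proof -
        have *: "ennreal (c * (a * b)) = ennreal c * (ennreal a * ennreal b)" if "0 \<le> c" "0 \<le> a" "0 \<le> b" for a b c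
          using that by (simp add: ennreal_mult)
        show ?thesis by (rule *) (use v R w in auto)
      qed
      also have "\<dots> \<le> ennreal (w x * w y / R ^ (2 * DIM('a)) / v) * (2 * ?I)"
        by (intro mult_left_mono avg) simp
      also have "\<dots> = ennreal (2 / v) * (ennreal (w x * w y / R ^ (2 * DIM('a))) * ?I)"
      proof -
        have "ennreal (w x * w y / R ^ (2 * DIM('a)) / v) * 2 = ennreal (w x * w y / R ^ (2 * DIM('a)) / v) * ennreal 2" by simp
        also have "\<dots> = ennreal (2 / v * (w x * w y / R ^ (2 * DIM('a))))"
          using v R w by (subst ennreal_mult[symmetric]) (auto simp: mult_ac)
        also have "\<dots> = ennreal (2 / v) * ennreal (w x * w y / R ^ (2 * DIM('a)))"
          using v R w by (intro ennreal_mult) auto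
        finally show ?thesis by (simp only: mult.assoc[symmetric])
      qed
      finally show ?thesis unfolding P_def R_def A_comm[of y x] \<rho>_comm[of y x]
        by (simp add: distrib_left mult_ac A_comm \<rho>_comm)
    qed
    define q where "q x h = indicator {h \<in> vcone. 4 * L * bdist \<Omega> x \<le> norm h \<and> norm h \<le> \<delta>} h *
         ennreal ((u x - u (x + h))\<^sup>2)" for x h
    have [measurable]: "case_prod q \<in> borel_measurable (borel \<Otimes>\<^sub>M borel)"
      unfolding q_def indicator_def by measurable
    have Pint: "(\<integral>\<^sup>+y. indicator N x * (indicator N y * P x y) \<partial>lborel) \<le>
       ennreal (B * layer_const) * (indicator N x * (ennreal (w x) * ray_energy \<delta> s u x))" for x
    proof (cases "x \<in> N")
      case x: True
      define j where "j y h = ennreal (w x) * (ennreal (B * norm h powr (- 2 * real DIM('a))) * q x h) *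
         (indicator N y * (indicator {y. norm (x - y) < norm h} y * ennreal (w y)))" for y h
      have [measurable]: "case_prod j \<in> borel_measurable (borel \<Otimes>\<^sub>M borel)"
        unfolding j_def indicator_def by measurable
      have "(\<integral>\<^sup>+y. indicator N x * (indicator N y * P x y) \<partial>lborel) \<le> (\<integral>\<^sup>+y. \<integral>\<^sup>+h. j y h \<partial>lborel \<partial>lborel)"
      proof (intro nn_integral_mono)
        fix y
        have "indicator N x * (indicator N y * P x y) = (\<integral>\<^sup>+h. indicator N y * (ennreal (w x * w y / \<rho> x y ^ (2 * DIM('a))) *
          (indicator (A x y) h * ennreal ((u x - u (x + h))\<^sup>2))) \<partial>lborel)"
          using x unfolding P_def A_def indicator_def
          by (simp add: nn_integral_cmult)
        also have "\<dots> \<le> (\<integral>\<^sup>+h. j y h \<partial>lborel)"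
        proof (intro nn_integral_mono)
          fix h
          show "indicator N y * (ennreal (w x * w y / \<rho> x y ^ (2 * DIM('a))) *
            (indicator (A x y) h * ennreal ((u x - u (x + h))\<^sup>2))) \<le> j y h"
          proof (cases "y \<in> N \<and> h \<in> A x y \<and> h \<noteq> 0")
            case True
            then have h: "h \<in> vcone" "(8 * L + 4) * \<rho> x y \<le> norm h" "norm h \<le> (8 * L + 8) * \<rho> x y" "0 < norm h" by (auto simp: A_def)
            have \<rho>p: "0 < \<rho> x y"
              using h(3,4) \<rho>0[of x y] by (cases "\<rho> x y = 0") (auto simp: less_le)
            have a1: "norm (x - y) < norm h"
            proof -
              have "norm (x - y) \<le> \<rho> x y" by (simp add: \<rho>_def)
              also have "\<dots> < (8 * L + 4) * \<rho> x y" using \<rho>p L_ge by simp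
              finally show ?thesis using h(2) by simp
            qed
            have a2: "4 * L * bdist \<Omega> x \<le> norm h"
            proof -
              have "4 * L * bdist \<Omega> x \<le> (8 * L + 4) * \<rho> x y"
                using L_ge by (intro mult_mono) (auto simp: \<rho>_def)
              then show ?thesis using h(2) by simp
            qed
            have a3: "norm h \<le> \<delta>"
            proof -
              have "norm (x - y) \<le> norm (x - z) + norm (z - y)" using norm_triangle_ineq[of "x - z" "z - y"] by simp
              moreover have "norm (x - z) < r1" "norm (z - y) < r1"
                using x True by (auto simp: N_def dist_norm norm_minus_commute)
              moreover have "bdist \<Omega> x < r1" "bdist \<Omega> y < r1" using x True by (auto simp: N_def intro!: bdist_near_center)
              ultimately have "\<rho> x y \<le> 4 * r1" unfolding \<rho>_def by linarith
              then have "(8 * L + 8) * \<rho> x y \<le> (8 * L + 8) * (4 * r1)" using L_ge by (intro mult_left_mono) auto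
              then show ?thesis using h(3) by (simp add: \<delta>_def algebra_simps)
            qed
            have "1 / \<rho> x y ^ (2 * DIM('a)) \<le> B * norm h powr (- 2 * real DIM('a))"
            proof -
              have "norm h ^ (2 * DIM('a)) \<le> ((8 * L + 8) * \<rho> x y) ^ (2 * DIM('a))" using h by (intro power_mono) auto
              also have "\<dots> = B * \<rho> x y ^ (2 * DIM('a))" by (simp add: B_def power_mult_distrib)
              finally have "1 / \<rho> x y ^ (2 * DIM('a)) \<le> B / norm h ^ (2 * DIM('a))"
                using h(4) \<rho>p by (simp add: field_simps)
              also have "\<dots> = B * norm h powr (- (2 * real DIM('a)))"
                using h(4) by (subst powr_minus) (simp add: divide_inverse flip: powr_realpow)
              finally show ?thesis by simp
            qed
            then have "w x * w y * (1 / \<rho> x y ^ (2 * DIM('a))) \<le> w x * w y * (B * norm h powr (- 2 * real DIM('a)))"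
              using w by (intro mult_left_mono mult_nonneg_nonneg) auto
            then have "ennreal (w x * w y / \<rho> x y ^ (2 * DIM('a))) \<le> ennreal (w x) * ennreal (w y) * ennreal (B * norm h powr (- 2 * real DIM('a)))"
              using w B by (simp add: ennreal_mult[symmetric] ennreal_leI)
            then have "ennreal (w x * w y / \<rho> x y ^ (2 * DIM('a))) * ennreal ((u x - u (x + h))\<^sup>2) \<le>
               ennreal (w x) * ennreal (w y) * ennreal (B * norm h powr (- 2 * real DIM('a))) * ennreal ((u x - u (x + h))\<^sup>2)"
              by (rule mult_right_mono) simp
            then show ?thesis using True a1 a2 a3 h(1) by (simp add: j_def q_def mult_ac)
          next
            case False
            then show ?thesis by (auto simp: indicator_def)
          qed
        qed
        finally show "indicator N x * (indicator N y * P x y) \<le> (\<integral>\<^sup>+h. j y h \<partial>lborel)" .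
      qed
      also have "\<dots> = (\<integral>\<^sup>+h. \<integral>\<^sup>+y. j y h \<partial>lborel \<partial>lborel)"
        by (rule lborel_swap) measurable
      also have "\<dots> \<le> (\<integral>\<^sup>+h. ennreal (B * layer_const) * (ennreal (w x) * (indicator {h \<in> vcone. 4 * L * bdist \<Omega> x \<le> norm h \<and> norm h \<le> \<delta>} h *
         ennreal (ray_kernel s h * (u x - u (x + h))\<^sup>2))) \<partial>lborel)"
      proof (intro nn_integral_mono)
        fix h
        show "(\<integral>\<^sup>+y. j y h \<partial>lborel) \<le> ennreal (B * layer_const) * (ennreal (w x) * (indicator {h \<in> vcone. 4 * L * bdist \<Omega> x \<le> norm h \<and> norm h \<le> \<delta>} h *
         ennreal (ray_kernel s h * (u x - u (x + h))\<^sup>2)))"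
        proof (cases "h = 0")
          case True
          then show ?thesis by (simp add: j_def)
        next
          case False
          then have hp: "0 < norm h" by simp
          have "(\<integral>\<^sup>+y. j y h \<partial>lborel) = ennreal (w x) * (ennreal (B * norm h powr (- 2 * real DIM('a))) * q x h) *
            (\<integral>\<^sup>+y. indicator N y * (indicator {y. norm (x - y) < norm h} y * ennreal (w y)) \<partial>lborel)"
            unfolding j_def by (rule nn_integral_cmult) measurable
          also have "(\<integral>\<^sup>+y. indicator N y * (indicator {y. norm (x - y) < norm h} y * ennreal (w y)) \<partial>lborel) \<le>
            (\<integral>\<^sup>+y. indicator (ball x (norm h) \<inter> ball z (r / 2)) y * ennreal (layer_weight \<Omega> s y) \<partial>lborel)"
            using \<delta> by (intro nn_integral_mono) (auto simp: N_def w_def dist_norm split: split_indicator)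
          also have "\<dots> \<le> ennreal (layer_const * norm h powr (real DIM('a) - s))"
            by (rule bdist_layer) (use s s' hp in auto)
          finally have "(\<integral>\<^sup>+y. j y h \<partial>lborel) \<le> ennreal (w x) * (ennreal (B * norm h powr (- 2 * real DIM('a))) * q x h) *
             ennreal (layer_const * norm h powr (real DIM('a) - s))" by (simp add: mult_left_mono)
          also have "\<dots> = ennreal ((B * norm h powr (- 2 * real DIM('a))) * (layer_const * norm h powr (real DIM('a) - s))) * (ennreal (w x) * q x h)"
            using B layer_const_pos by (subst ennreal_mult) (auto simp: mult_ac)
          also have "(B * norm h powr (- 2 * real DIM('a))) * (layer_const * norm h powr (real DIM('a) - s)) = B * layer_const * ray_kernel s h"
          proof -
            have "- 2 * real DIM('a) + (real DIM('a) - s) = - (real DIM('a) + s)" by simp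
            then have "norm h powr (- 2 * real DIM('a)) * norm h powr (real DIM('a) - s) = ray_kernel s h"
              by (simp only: powr_add[symmetric])
            then show ?thesis by (simp only: mult_ac)
          qed
          also have "ennreal (B * layer_const * ray_kernel s h) * (ennreal (w x) * q x h) = ennreal (B * layer_const) * (ennreal (w x) * (indicator {h \<in> vcone. 4 * L * bdist \<Omega> x \<le> norm h \<and> norm h \<le> \<delta>} h *
             ennreal (ray_kernel s h * (u x - u (x + h))\<^sup>2)))"
            using B layer_const_pos by (simp add: ennreal_mult q_def mult_ac)
          finally show ?thesis .
        qed
      qed
      also have "\<dots> = ennreal (B * layer_const) * (indicator N x * (ennreal (w x) * ray_energy \<delta> s u x))"
        using x by (simp add: nn_integral_cmult)
      finally show ?thesis .
    qed simp
    have "(\<integral>\<^sup>+x. \<integral>\<^sup>+y. indicator N x * (indicator N y * P x y) \<partial>lborel \<partial>lborel) \<le>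
      (\<integral>\<^sup>+x. ennreal (B * layer_const) * (indicator N x * (ennreal (w x) * ray_energy \<delta> s u x)) \<partial>lborel)"
      by (intro nn_integral_mono Pint)
    also have "\<dots> = ennreal (B * layer_const) * (\<integral>\<^sup>+x. indicator N x * (ennreal (w x) * ray_energy \<delta> s u x) \<partial>lborel)"
      by (rule nn_integral_cmult) (unfold indicator_def, measurable)
    also have "\<dots> \<le> ennreal (B * layer_const) * (ennreal C * cross_energy \<Omega> s u)"
      unfolding N_def w_def by (intro mult_left_mono C s) auto
    finally have Pxy: "(\<integral>\<^sup>+x. \<integral>\<^sup>+y. indicator N x * (indicator N y * P x y) \<partial>lborel \<partial>lborel) \<le> ennreal (B * layer_const) * (ennreal C * cross_energy \<Omega> s u)" .
    have "(\<integral>\<^sup>+x. \<integral>\<^sup>+y. indicator N x * (indicator N y * P y x) \<partial>lborel \<partial>lborel) = (\<integral>\<^sup>+y. \<integral>\<^sup>+x. indicator N x * (indicator N y * P y x) \<partial>lborel \<partial>lborel)"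
      by (rule lborel_swap) measurable
    also have "\<dots> = (\<integral>\<^sup>+x. \<integral>\<^sup>+y. indicator N x * (indicator N y * P x y) \<partial>lborel \<partial>lborel)"
      by (simp add: mult_ac)
    finally have Pyx: "(\<integral>\<^sup>+x. \<integral>\<^sup>+y. indicator N x * (indicator N y * P y x) \<partial>lborel \<partial>lborel) \<le> ennreal (B * layer_const) * (ennreal C * cross_energy \<Omega> s u)"
      using Pxy by simp
    have "(\<integral>\<^sup>+x. \<integral>\<^sup>+y. indicator N x * (indicator N y * ennreal ((u x - u y)\<^sup>2 * trace_kernel \<Omega> s x y)) \<partial>lborel \<partial>lborel) \<le>
      (\<integral>\<^sup>+x. \<integral>\<^sup>+y. ennreal (2 / v) * (indicator N x * (indicator N y * P x y) + indicator N x * (indicator N y * P y x)) \<partial>lborel \<partial>lborel)"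
      using pt by (intro nn_integral_mono) (auto simp: indicator_def)
    also have "\<dots> = ennreal (2 / v) * ((\<integral>\<^sup>+x. \<integral>\<^sup>+y. indicator N x * (indicator N y * P x y) \<partial>lborel \<partial>lborel) +
       (\<integral>\<^sup>+x. \<integral>\<^sup>+y. indicator N x * (indicator N y * P y x) \<partial>lborel \<partial>lborel))"
      by (simp add: nn_integral_cmult nn_integral_add)
    also have "\<dots> \<le> ennreal (2 / v) * (2 * (ennreal (B * layer_const) * (ennreal C * cross_energy \<Omega> s u)))"
      unfolding mult_2 using Pxy Pyx by (intro mult_left_mono add_mono) auto
    also have "\<dots> = ennreal (2 / v * (2 * (B * layer_const * C))) * cross_energy \<Omega> s u"
    proof -
      have "ennreal (2 / v * (2 * (B * layer_const * C))) = ennreal (2 / v) * ennreal (2 * (B * layer_const * C))"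
        using v B layer_const_pos C(1) by (intro ennreal_mult) auto
      also have "ennreal (2 * (B * layer_const * C)) = 2 * ennreal (B * layer_const * C)"
        using B layer_const_pos C(1) by (subst ennreal_mult) auto
      also have "ennreal (B * layer_const * C) = ennreal (B * layer_const) * ennreal C"
        using B layer_const_pos C(1) by (intro ennreal_mult) auto
      finally show ?thesis by (simp only: mult.assoc)
    qed
    finally show "exterior_energy \<Omega> s (ball z r1 - \<Omega>) u \<le> ennreal (2 / v * (2 * (B * layer_const * C))) * cross_energy \<Omega> s u"
      unfolding N_def .
  qed
qed

text \<open>
  Here \<open>u x\<close> is compared with the values of \<open>u\<close> on a ball \<open>x + W\<close> inside \<open>\<Omega>\<close> of fixed size.
\<close>

lemma local_single_trace:
  assumes s0: "0 < s0" and r1: "0 < r1" "r1 + 32 * (L + 1) * r1 < r / 2"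
  obtains C where "0 < C" "\<And>s u. s0 \<le> s \<Longrightarrow> s < 1 \<Longrightarrow> u \<in> borel_measurable borel \<Longrightarrow>
    (\<integral>\<^sup>+x. indicator (ball z r1 - \<Omega>) x * ennreal ((u x)\<^sup>2 * (layer_weight \<Omega> s x)) \<partial>lborel)
    \<le> ennreal C * (cross_energy \<Omega> s u + sq_integral \<Omega> u)"
proof -
  define \<delta> where "\<delta> = 32 * (L + 1) * r1"
  have \<delta>: "r1 + \<delta> < r / 2" "0 \<le> \<delta>" "0 < \<delta>" using r1 L_ge by (auto simp: \<delta>_def)
  obtain C where C: "0 < C" "\<And>s u. s0 \<le> s \<Longrightarrow> s < 1 \<Longrightarrow> u \<in> borel_measurable borel \<Longrightarrow>
    (\<integral>\<^sup>+x. indicator (ball z r1 - \<Omega>) x * (ennreal (layer_weight \<Omega> s x) *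
      ray_energy \<delta> s u x) \<partial>lborel)
    \<le> ennreal C * cross_energy \<Omega> s u"
    using cone_trace_estimate[OF s0 \<delta>(1,2)] by blast
  define t where "t = \<delta> / 2"
  define \<epsilon> where "\<epsilon> = t / (4 * L + 3)"
  have t: "0 < t" using \<delta> by (simp add: t_def)
  have \<epsilon>: "0 < \<epsilon>" "\<epsilon> \<le> t / 2"
    using t L_ge divide_left_mono[of 2 "4 * L + 3" t] by (auto simp: \<epsilon>_def)
  define W where "W = ball (t *\<^sub>R e) \<epsilon>"
  define v where "v = unit_ball_vol (real DIM('a)) * \<epsilon> ^ DIM('a)"
  have v: "0 < v" using \<epsilon> by (simp add: v_def unit_ball_vol_pos)
  have W: "emeasure lborel W = ennreal v" using \<epsilon> by (simp add: W_def v_def emeasure_ball)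
  have inW: "h \<in> vcone" "\<delta> / 4 \<le> norm h" "norm h \<le> \<delta>" if "h \<in> W" for h
  proof -
    have near: "norm (h - t *\<^sub>R e) < \<epsilon>" using that unfolding W_def by (simp only: mem_ball dist_norm norm_minus_commute)
    then show "h \<in> vcone" by (intro vcone_near_axis[of h t]) (simp add: \<epsilon>_def)
    have "norm (t *\<^sub>R e) = t" using t norm_e by simp
    then have "t - \<epsilon> \<le> norm h" "norm h \<le> t + \<epsilon>" using near norm_triangle_ineq3[of h "t *\<^sub>R e"] by linarith+
    then show "\<delta> / 4 \<le> norm h" "norm h \<le> \<delta>" using \<epsilon> t by (auto simp: t_def)
  qed
  define D where "D = (max 1 \<delta>) powr (real DIM('a) + 1)"
  have D: "0 < D" by (simp add: D_def)
  define M where "M = layer_const * (max 1 r1) powr (real DIM('a))"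
  have M: "0 < M" using layer_const_pos by (simp add: M_def)
  show thesis
  proof (rule that)
    show "0 < 2 / v * (D * C + M)" using v D C(1) M by (simp add: add_pos_pos)
    fix s and u :: "'a \<Rightarrow> real"
    assume s: "s0 \<le> s" "s < 1" and [measurable]: "u \<in> borel_measurable borel"
    have s': "0 < s" using s s0 by simp
    define w where "w x = layer_weight \<Omega> s x" for x
    have w: "0 \<le> w x" for x using s by (simp add: w_def)
    have [measurable]: "w \<in> borel_measurable borel" unfolding w_def by measurable
    define U where "U = sq_integral \<Omega> u"
    define I where "I x = ray_energy \<delta> s u x" for x
    have [measurable]: "I \<in> borel_measurable borel" unfolding I_def indicator_def by measurable
    have pt: "ennreal ((u x)\<^sup>2) * ennreal v \<le> 2 * (ennreal D * I x + U)" if x: "x \<in> ball z r1" for x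
    proof -
      have "bdist \<Omega> x < r1" using bdist_near_center[OF x] .
      then have "4 * L * bdist \<Omega> x \<le> 4 * L * r1" using L_ge by (intro mult_left_mono) auto
      also have "\<dots> \<le> \<delta> / 4" using r1 L_ge by (simp add: \<delta>_def algebra_simps)
      finally have bd: "4 * L * bdist \<Omega> x \<le> \<delta> / 4" .
      have "ennreal ((u x)\<^sup>2) * ennreal v = (\<integral>\<^sup>+h. indicator W h * ennreal ((u x)\<^sup>2) \<partial>lborel)"
        unfolding W[symmetric] W_def by (subst nn_integral_multc) (simp_all add: mult.commute)
      also have "\<dots> \<le> (\<integral>\<^sup>+h. 2 * (ennreal D * (indicator {h \<in> vcone. 4 * L * bdist \<Omega> x \<le> norm h \<and> norm h \<le> \<delta>} h *
         ennreal (ray_kernel s h * (u x - u (x + h))\<^sup>2)) + indicator \<Omega> (h + x) * ennreal ((u (h + x))\<^sup>2)) \<partial>lborel)"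
      proof (intro nn_integral_mono)
        fix h
        show "indicator W h * ennreal ((u x)\<^sup>2) \<le> 2 * (ennreal D * (indicator {h \<in> vcone. 4 * L * bdist \<Omega> x \<le> norm h \<and> norm h \<le> \<delta>} h *
         ennreal (ray_kernel s h * (u x - u (x + h))\<^sup>2)) + indicator \<Omega> (h + x) * ennreal ((u (h + x))\<^sup>2))"
        proof (cases "h \<in> W")
          case True
          note h = inW[OF True]
          have hp: "0 < norm h" "h \<noteq> 0" using h(2) \<delta>(3) by auto
          have m: "4 * L * bdist \<Omega> x \<le> norm h" using bd h by simp
          then have "x + 1 *\<^sub>R h \<in> \<Omega>"
            using h hp by (intro cone_shift(1)[OF x _ _ _ _ \<delta>(1)] vcone_inner_pos) auto
          then have xh: "h + x \<in> \<Omega>" by (simp add: add.commute)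
          have "1 \<le> D * ray_kernel s h"
          proof -
            have "norm h powr (real DIM('a) + s) \<le> max 1 \<delta> powr (real DIM('a) + s)"
              using h s' by (intro powr_mono2) auto
            also have "\<dots> \<le> D" unfolding D_def using s by (intro powr_mono) auto
            finally show ?thesis using hp unfolding powr_minus by (simp add: field_simps)
          qed
          then have "1 * (u x - u (x + h))\<^sup>2 \<le> D * ray_kernel s h * (u x - u (x + h))\<^sup>2"
            by (intro mult_right_mono) auto
          moreover have "(u x)\<^sup>2 \<le> 2 * ((u x - u (x + h))\<^sup>2 + (u (x + h))\<^sup>2)"
          proof -
            have "0 \<le> (u x - 2 * u (x + h))\<^sup>2" by simp
            then show ?thesis by (simp add: power2_eq_square algebra_simps)
          qed
          ultimately have "(u x)\<^sup>2 \<le> 2 * (D * (ray_kernel s h * (u x - u (x + h))\<^sup>2) + (u (h + x))\<^sup>2)"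
            by (simp add: add.commute mult.assoc)
          then have "ennreal ((u x)\<^sup>2) \<le> ennreal (2 * (D * (ray_kernel s h * (u x - u (x + h))\<^sup>2) + (u (h + x))\<^sup>2))"
            by (rule ennreal_leI)
          also have "\<dots> = 2 * (ennreal D * ennreal (ray_kernel s h * (u x - u (x + h))\<^sup>2) + ennreal ((u (h + x))\<^sup>2))"
          proof -
            have *: "ennreal (2 * (D * a + b)) = 2 * (ennreal D * ennreal a + ennreal b)" if "0 \<le> a" "0 \<le> b" for a b
              using that D by (simp add: ennreal_mult ennreal_plus)
            show ?thesis by (rule *) auto
          qed
          finally show ?thesis using True xh h m by simp
        qed simp
      qed
      also have "\<dots> = 2 * (ennreal D * I x + (\<integral>\<^sup>+h. indicator \<Omega> (h + x) * ennreal ((u (h + x))\<^sup>2) \<partial>lborel))"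
        unfolding I_def by (simp add: nn_integral_cmult nn_integral_add)
      also have "(\<integral>\<^sup>+h. indicator \<Omega> (h + x) * ennreal ((u (h + x))\<^sup>2) \<partial>lborel) = U"
        unfolding U_def by (rule nn_integral_lborel_shift) measurable
      finally show ?thesis .
    qed
    have wint: "(\<integral>\<^sup>+x. indicator (ball z r1) x * ennreal (w x) \<partial>lborel) \<le> ennreal M"
    proof -
      have "(\<integral>\<^sup>+x. indicator (ball z r1) x * ennreal (w x) \<partial>lborel) \<le>
         (\<integral>\<^sup>+x. indicator (ball z r1 \<inter> ball z (r / 2)) x * ennreal (layer_weight \<Omega> s x) \<partial>lborel)"
        using \<delta> by (intro nn_integral_mono) (auto simp: w_def split: split_indicator)
      also have "\<dots> \<le> ennreal (layer_const * r1 powr (real DIM('a) - s))"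
        by (rule bdist_layer) (use s s' r1 in auto)
      also have "\<dots> \<le> ennreal M"
      proof -
        have d: "1 \<le> real DIM('a)" using DIM_positive[where 'a='a] by linarith
        have "r1 powr (real DIM('a) - s) \<le> max 1 r1 powr (real DIM('a) - s)" using r1 s d by (intro powr_mono2) linarith+
        also have "\<dots> \<le> max 1 r1 powr (real DIM('a))" using s' by (intro powr_mono) auto
        finally show ?thesis unfolding M_def using layer_const_pos by (intro ennreal_leI mult_left_mono) auto
      qed
      finally show ?thesis .
    qed
    have "(\<integral>\<^sup>+x. indicator (ball z r1 - \<Omega>) x * ennreal ((u x)\<^sup>2 * w x) \<partial>lborel) \<le>
      (\<integral>\<^sup>+x. ennreal (2 / v) * (ennreal D * (indicator (ball z r1 - \<Omega>) x * (ennreal (w x) * I x)) + U * (indicator (ball z r1) x * ennreal (w x))) \<partial>lborel)"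
    proof (intro nn_integral_mono)
      fix x
      show "indicator (ball z r1 - \<Omega>) x * ennreal ((u x)\<^sup>2 * w x) \<le>
        ennreal (2 / v) * (ennreal D * (indicator (ball z r1 - \<Omega>) x * (ennreal (w x) * I x)) + U * (indicator (ball z r1) x * ennreal (w x)))"
      proof (cases "x \<in> ball z r1 - \<Omega>")
        case True
        have "ennreal ((u x)\<^sup>2 * w x) = ennreal (w x / v) * (ennreal ((u x)\<^sup>2) * ennreal v)"
          using v w by (simp add: ennreal_mult[symmetric])
        also have "\<dots> \<le> ennreal (w x / v) * (2 * (ennreal D * I x + U))"
          using True by (intro mult_left_mono pt) auto
        also have "\<dots> = ennreal (2 / v) * (ennreal (w x) * (ennreal D * I x + U))"
        proof -
          have "ennreal (w x / v) * 2 = ennreal (w x / v) * ennreal 2" by simp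
          also have "\<dots> = ennreal (2 / v * w x)" using v w by (subst ennreal_mult[symmetric]) auto
          also have "\<dots> = ennreal (2 / v) * ennreal (w x)" using v w by (intro ennreal_mult) auto
          finally show ?thesis by (simp only: mult.assoc[symmetric])
        qed
        finally show ?thesis using True by (simp add: distrib_left mult_ac)
      qed simp
    qed
    also have "\<dots> = ennreal (2 / v) * (ennreal D * (\<integral>\<^sup>+x. indicator (ball z r1 - \<Omega>) x * (ennreal (w x) * I x) \<partial>lborel) +
       U * (\<integral>\<^sup>+x. indicator (ball z r1) x * ennreal (w x) \<partial>lborel))"
      by (simp add: nn_integral_cmult nn_integral_add)
    also have "\<dots> \<le> ennreal (2 / v) * (ennreal D * (ennreal C * cross_energy \<Omega> s u) + U * ennreal M)"
    proof (intro mult_left_mono add_mono wint)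
      show "(\<integral>\<^sup>+x. indicator (ball z r1 - \<Omega>) x * (ennreal (w x) * I x) \<partial>lborel) \<le> ennreal C * cross_energy \<Omega> s u"
        unfolding w_def I_def by (intro C s) auto
    qed auto
    also have "\<dots> \<le> ennreal (2 / v) * (ennreal (D * C + M) * (cross_energy \<Omega> s u + U))"
    proof (intro mult_left_mono)
      have "ennreal D * (ennreal C * cross_energy \<Omega> s u) \<le> ennreal (D * C + M) * cross_energy \<Omega> s u"
        using D C(1) M by (simp add: mult.assoc[symmetric] ennreal_mult[symmetric] mult_right_mono ennreal_leI del: ennreal_plus)
      moreover have "U * ennreal M \<le> ennreal (D * C + M) * U"
        using D C(1) M by (subst mult.commute) (intro mult_right_mono ennreal_leI, auto)
      ultimately show "ennreal D * (ennreal C * cross_energy \<Omega> s u) + U * ennreal M \<le> ennreal (D * C + M) * (cross_energy \<Omega> s u + U)"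
        unfolding distrib_left by (rule add_mono)
    qed simp
    also have "\<dots> = ennreal (2 / v * (D * C + M)) * (cross_energy \<Omega> s u + U)"
    proof -
      have "ennreal (2 / v * (D * C + M)) = ennreal (2 / v) * ennreal (D * C + M)"
        using v D C(1) M by (intro ennreal_mult) auto
      then show ?thesis by (simp only: mult.assoc)
    qed
    finally show "(\<integral>\<^sup>+x. indicator (ball z r1 - \<Omega>) x * ennreal ((u x)\<^sup>2 * (layer_weight \<Omega> s x)) \<partial>lborel)
      \<le> ennreal (2 / v * (D * C + M)) * (cross_energy \<Omega> s u + sq_integral \<Omega> u)"
      unfolding w_def U_def .
  qed
qed

end

section \<open>The robust Poincare inequality\<close>

lemma C11_function_lipschitz_on_ball:
  fixes \<phi> :: "'a::euclidean_space \<Rightarrow> real"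
  assumes "C11_function \<phi>"
  obtains B where "0 \<le> B" "\<And>x y. x \<in> ball p R \<Longrightarrow> y \<in> ball p R \<Longrightarrow> \<bar>\<phi> x - \<phi> y\<bar> \<le> B * norm (x - y)"
proof -
  obtain D K where D: "\<And>x. GDERIV \<phi> x :> D x" and K: "K-lipschitz_on UNIV D"
    using assms unfolding C11_function_def by blast
  have K0: "0 \<le> K" using K by (rule lipschitz_on_nonneg)
  define B where "B = norm (D p) + K * \<bar>R\<bar>"
  have B: "0 \<le> B" using K0 by (simp add: B_def)
  show thesis
  proof (rule that[OF B])
    fix x y assume xy: "x \<in> ball p R" "y \<in> ball p R"
    have "norm (\<phi> x - \<phi> y) \<le> B * norm (x - y)"
    proof (rule differentiable_bound[of "ball p R" \<phi> "\<lambda>x h. h \<bullet> D x"])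
      fix x assume x: "x \<in> ball p R"
      show "(\<phi> has_derivative (\<lambda>h. h \<bullet> D x)) (at x within ball p R)"
        using D[of x] unfolding gderiv_def by (rule has_derivative_at_withinI)
      have "norm (D x - D p) \<le> K * norm (x - p)"
        using lipschitz_onD[OF K, of x p] by (simp add: dist_norm)
      also have "\<dots> \<le> K * \<bar>R\<bar>" using x K0 by (intro mult_left_mono) (auto simp: dist_norm norm_minus_commute)
      finally have "norm (D x) \<le> B" unfolding B_def using norm_triangle_sub[of "D x" "D p"] by linarith
      then have "norm h * norm (D x) \<le> norm h * B" for h :: 'a
        by (intro mult_left_mono) auto
      then have "norm (h \<bullet> D x) \<le> B * norm h" for h
        using Cauchy_Schwarz_ineq2[of h "D x"] by (metis order_trans real_norm_def mult.commute)
      then show "onorm (\<lambda>h. h \<bullet> D x) \<le> B" using B by (intro onorm_bound) auto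
    qed (use xy in auto)
    then show "\<bar>\<phi> x - \<phi> y\<bar> \<le> B * norm (x - y)" by simp
  qed
qed

lemma C11_function_continuous:
  assumes "C11_function \<phi>"
  shows "continuous_on UNIV \<phi>"
  using assms unfolding C11_function_def gderiv_def
  by (meson continuous_at_imp_continuous_on has_derivative_continuous)

text \<open>
  The height is \<open>x \<bullet> e - \<phi> (x - (x \<bullet> e) *\<^sub>R e)\<close>. Its Lipschitz bound near \<open>z\<close> comes
  from the bound of the gradient of \<open>\<phi>\<close> on a ball.
\<close>

lemma C11_domain_chart:
  fixes \<Omega> :: "'a::euclidean_space set"
  assumes "C11_domain \<Omega>" and z: "z \<in> frontier \<Omega>"
  obtains e r L \<psi> where "lipschitz_chart \<Omega> z e r L \<psi>"
proof -
  obtain r e \<phi> where r: "0 < r" and e: "norm e = 1" and \<phi>: "C11_function \<phi>"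
    and graph: "\<Omega> \<inter> ball z r = {x \<in> ball z r. \<phi> (x - (x \<bullet> e) *\<^sub>R e) < x \<bullet> e}"
    using assms unfolding C11_domain_def by blast
  define P where "P x = x - (x \<bullet> e) *\<^sub>R e" for x
  have P_diff: "P x - P y = (x - y) - ((x - y) \<bullet> e) *\<^sub>R e" for x y
    by (simp add: P_def algebra_simps)
  have P_lip: "norm (P x - P y) \<le> 2 * norm (x - y)" for x y
  proof -
    have "norm (P x - P y) \<le> norm (x - y) + norm (((x - y) \<bullet> e) *\<^sub>R e)"
      unfolding P_diff by (rule norm_triangle_ineq4)
    also have "norm (((x - y) \<bullet> e) *\<^sub>R e) \<le> norm (x - y)"
      using Cauchy_Schwarz_ineq2[of "x - y" e] e by simp
    finally show ?thesis by simp
  qed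
  obtain B where B: "0 \<le> B" "\<And>x y. x \<in> ball (P z) (2 * r) \<Longrightarrow> y \<in> ball (P z) (2 * r) \<Longrightarrow> \<bar>\<phi> x - \<phi> y\<bar> \<le> B * norm (x - y)"
    using C11_function_lipschitz_on_ball[OF \<phi>] by blast
  have "lipschitz_chart \<Omega> z e r (1 + 2 * B) (\<lambda>x. x \<bullet> e - \<phi> (P x))"
  proof
    show "open \<Omega>" using assms unfolding C11_domain_def by simp
    show "norm e = 1" "0 < r" "z \<in> frontier \<Omega>" by fact+
    show "1 \<le> 1 + 2 * B" using B by simp
    have "continuous_on UNIV (\<lambda>x. \<phi> (P x))"
      unfolding P_def by (intro continuous_on_compose2[OF C11_function_continuous[OF \<phi>]] continuous_intros) auto
    then show "(\<lambda>x. x \<bullet> e - \<phi> (P x)) \<in> borel_measurable borel"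
      by (intro borel_measurable_continuous_onI continuous_intros)
    have ee: "e \<bullet> e = 1" using e by (simp add: dot_square_norm)
    show "(x + t *\<^sub>R e) \<bullet> e - \<phi> (P (x + t *\<^sub>R e)) = x \<bullet> e - \<phi> (P x) + t" for x t
    proof -
      have "P (x + t *\<^sub>R e) = P x" by (simp add: P_def inner_add_left ee algebra_simps)
      then show ?thesis by (simp add: inner_add_left ee)
    qed
    show "x \<in> \<Omega> \<longleftrightarrow> 0 < x \<bullet> e - \<phi> (P x)" if "x \<in> ball z r" for x
    proof -
      have "x \<in> \<Omega> \<longleftrightarrow> x \<in> \<Omega> \<inter> ball z r" using that by simp
      then show ?thesis unfolding graph using that by (simp add: P_def)
    qed
    show "\<bar>(x \<bullet> e - \<phi> (P x)) - (y \<bullet> e - \<phi> (P y))\<bar> \<le> (1 + 2 * B) * norm (x - y)"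
      if xy: "x \<in> ball z r" "y \<in> ball z r" for x y
    proof -
      have "P x \<in> ball (P z) (2 * r)" if "x \<in> ball z r" for x
        using P_lip[of z x] that by (simp add: dist_norm)
      then have "\<bar>\<phi> (P x) - \<phi> (P y)\<bar> \<le> B * norm (P x - P y)" using xy by (intro B) auto
      also have "\<dots> \<le> B * (2 * norm (x - y))" using B P_lip by (intro mult_left_mono) auto
      finally have "\<bar>\<phi> (P x) - \<phi> (P y)\<bar> \<le> 2 * B * norm (x - y)" by simp
      moreover have "\<bar>x \<bullet> e - y \<bullet> e\<bar> \<le> norm (x - y)"
        using Cauchy_Schwarz_ineq2[of "x - y" e] e by (simp add: inner_diff_left)
      ultimately show ?thesis by (simp add: distrib_right)
    qed
  qed
  then show thesis by (rule that)
qed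

text \<open>
  The constant is chosen before \<open>s\<close> and \<open>u\<close>, so that every inequality built from such pairs remains
  uniform as \<open>s\<close> tends to \<open>1\<close>.
\<close>

definition poincare_pair :: "'a::euclidean_space set \<Rightarrow> 'a set \<Rightarrow> 'a set \<Rightarrow> bool" where
  "poincare_pair \<Omega> S T \<longleftrightarrow> (\<exists>C\<ge>0. \<forall>s u. 0 < s \<and> s < 1 \<and> u \<in> borel_measurable borel \<longrightarrow>
    (pair_oscillation S T u) \<le> ennreal C * cross_energy \<Omega> s u)"

lemma poincare_pair_mono:
  assumes "poincare_pair \<Omega> S T" "S' \<subseteq> S" "T' \<subseteq> T"
  shows "poincare_pair \<Omega> S' T'"
proof -
  have "pair_oscillation S' T' u \<le>
    pair_oscillation S T u" for u :: "'a \<Rightarrow> real"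
    using assms by (intro nn_integral_mono) (auto simp: indicator_def)
  then show ?thesis using assms(1) unfolding poincare_pair_def by (meson order_trans)
qed

lemma poincare_pair_sym:
  assumes "poincare_pair \<Omega> S T" and [measurable]: "S \<in> sets borel" "T \<in> sets borel"
  shows "poincare_pair \<Omega> T S"
proof -
  have eq: "pair_oscillation T S u =
    pair_oscillation S T u"
    if [measurable]: "u \<in> borel_measurable borel" for u :: "'a \<Rightarrow> real"
  proof -
    have "pair_oscillation T S u =
       (\<integral>\<^sup>+y. \<integral>\<^sup>+x. indicator T x * (indicator S y * ennreal ((u x - u y)\<^sup>2)) \<partial>lborel \<partial>lborel)"
      by (rule lborel_swap) measurable
    moreover have "indicator T x * (indicator S y * ennreal ((u x - u y)\<^sup>2)) = indicator S y * (indicator T x * ennreal ((u y - u x)\<^sup>2))" for x y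
      by (simp add: power2_commute[of "u x"] mult.left_commute)
    ultimately show ?thesis by simp
  qed
  obtain C where C: "0 \<le> C" "\<And>s u. 0 < s \<and> s < 1 \<and> u \<in> borel_measurable borel \<Longrightarrow>
    (pair_oscillation S T u) \<le> ennreal C * cross_energy \<Omega> s u"
    using assms(1) unfolding poincare_pair_def by blast
  then show ?thesis unfolding poincare_pair_def by (intro exI[of _ C]) (simp add: eq)
qed

lemma poincare_pair_union:
  assumes "poincare_pair \<Omega> S T" "poincare_pair \<Omega> S T'" and [measurable]: "S \<in> sets borel" "T \<in> sets borel" "T' \<in> sets borel"
  shows "poincare_pair \<Omega> S (T \<union> T')"
proof -
  obtain C where C: "0 \<le> C" "\<And>s u. 0 < s \<and> s < 1 \<and> u \<in> borel_measurable borel \<Longrightarrow>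
    (pair_oscillation S T u) \<le> ennreal C * cross_energy \<Omega> s u"
    using assms(1) unfolding poincare_pair_def by blast
  obtain C' where C': "0 \<le> C'" "\<And>s u. 0 < s \<and> s < 1 \<and> u \<in> borel_measurable borel \<Longrightarrow>
    (pair_oscillation S T' u) \<le> ennreal C' * cross_energy \<Omega> s u"
    using assms(2) unfolding poincare_pair_def by blast
  show ?thesis unfolding poincare_pair_def
  proof (intro exI[of _ "C + C'"] conjI allI impI)
    show "0 \<le> C + C'" using C C' by simp
    fix s :: real and u :: "'a \<Rightarrow> real" assume su: "0 < s \<and> s < 1 \<and> u \<in> borel_measurable borel"
    then have [measurable]: "u \<in> borel_measurable borel" by simp
    have "pair_oscillation S (T \<union> T') u \<le>
       (\<integral>\<^sup>+x. \<integral>\<^sup>+y. indicator S x * (indicator T y * ennreal ((u x - u y)\<^sup>2)) + indicator S x * (indicator T' y * ennreal ((u x - u y)\<^sup>2)) \<partial>lborel \<partial>lborel)"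
      by (intro nn_integral_mono) (auto simp: indicator_def)
    also have "\<dots> = pair_oscillation S T u +
       pair_oscillation S T' u"
      by (simp add: nn_integral_add)
    also have "\<dots> \<le> ennreal C * cross_energy \<Omega> s u + ennreal C' * cross_energy \<Omega> s u"
      by (intro add_mono C C' su)
    also have "\<dots> = ennreal (C + C') * cross_energy \<Omega> s u" using C(1) C'(1) by (simp add: distrib_right)
    finally show "pair_oscillation S (T \<union> T') u \<le> ennreal (C + C') * cross_energy \<Omega> s u" .
  qed
qed

lemma poincare_pair_empty: "poincare_pair \<Omega> S {}"
  unfolding poincare_pair_def by (intro exI[of _ 0]) simp

lemma poincare_pair_UN:
  assumes "finite I" "S \<in> sets borel" "\<And>i. i \<in> I \<Longrightarrow> T i \<in> sets borel" "\<And>i. i \<in> I \<Longrightarrow> poincare_pair \<Omega> S (T i)"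
  shows "poincare_pair \<Omega> S (\<Union>i\<in>I. T i)"
  using assms
proof (induction I rule: finite_induct)
  case (insert i I)
  have "poincare_pair \<Omega> S (T i \<union> (\<Union>i\<in>I. T i))"
    using insert by (intro poincare_pair_union sets.finite_UN) auto
  then show ?case by simp
qed (simp add: poincare_pair_empty)

text \<open>
  A difference between \<open>S\<close> and \<open>T\<close> is averaged over intermediate points in \<open>W\<close>.
\<close>

lemma poincare_pair_trans:
  fixes \<Omega> :: "'a::euclidean_space set"
  assumes "poincare_pair \<Omega> S W" "poincare_pair \<Omega> W T"
    and [measurable]: "S \<in> sets borel" "W \<in> sets borel" "T \<in> sets borel"
    and bnd: "bounded S" "bounded W" "bounded T" and W: "emeasure lborel W \<noteq> 0"
  shows "poincare_pair \<Omega> S T"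
proof -
  obtain C where C: "0 \<le> C" "\<And>s u. 0 < s \<and> s < 1 \<and> u \<in> borel_measurable borel \<Longrightarrow>
    (pair_oscillation S W u) \<le> ennreal C * cross_energy \<Omega> s u"
    using assms(1) unfolding poincare_pair_def by blast
  obtain C' where C': "0 \<le> C'" "\<And>s u. 0 < s \<and> s < 1 \<and> u \<in> borel_measurable borel \<Longrightarrow>
    (pair_oscillation T W u) \<le> ennreal C' * cross_energy \<Omega> s u"
    using poincare_pair_sym[OF assms(2)] unfolding poincare_pair_def by auto
  have fin: "emeasure lborel A = ennreal (measure lborel A)" if "bounded A" for A :: "'a set"
    using emeasure_bounded_finite[OF that] by (simp add: emeasure_eq_ennreal_measure)
  define m where "m = measure lborel W"
  have m: "0 < m" using W fin[OF bnd(2)] measure_nonneg[of lborel W] by (auto simp: m_def less_le)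
  define B where "B = 2 / m * (measure lborel T * C + measure lborel S * C')"
  show ?thesis unfolding poincare_pair_def
  proof (intro exI[of _ B] conjI allI impI)
    show "0 \<le> B" using m C(1) C'(1) by (simp add: B_def)
    fix s :: real and u :: "'a \<Rightarrow> real" assume su: "0 < s \<and> s < 1 \<and> u \<in> borel_measurable borel"
    then have [measurable]: "u \<in> borel_measurable borel" by simp
    define I where "I a = (\<integral>\<^sup>+w. indicator W w * ennreal ((u a - u w)\<^sup>2) \<partial>lborel)" for a
    have [measurable]: "I \<in> borel_measurable borel" unfolding I_def by measurable
    have "pair_oscillation S T u \<le>
       (\<integral>\<^sup>+x. \<integral>\<^sup>+y. ennreal (2 / m) * (indicator S x * I x * indicator T y + indicator S x * (indicator T y * I y)) \<partial>lborel \<partial>lborel)"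
    proof (intro nn_integral_mono)
      fix x y
      have "ennreal ((u x - u y)\<^sup>2) = ennreal (1 / m) * (ennreal ((u x - u y)\<^sup>2) * ennreal m)"
        using m by (simp add: ennreal_mult[symmetric])
      also have "\<dots> \<le> ennreal (1 / m) * (2 * I x + 2 * I y)"
        using averaging[of u W "u x" "u y"] fin[OF bnd(2)] by (intro mult_left_mono) (auto simp: I_def m_def)
      also have "\<dots> = ennreal (2 / m) * (I x + I y)"
      proof -
        have "ennreal (2 / m) = ennreal (1 / m) * 2" using m by (subst ennreal_numeral[symmetric], subst ennreal_mult[symmetric]) auto
        then show ?thesis by (simp add: distrib_left mult.assoc)
      qed
      finally show "indicator S x * (indicator T y * ennreal ((u x - u y)\<^sup>2)) \<le>
        ennreal (2 / m) * (indicator S x * I x * indicator T y + indicator S x * (indicator T y * I y))"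
        by (auto simp: indicator_def)
    qed
    also have "\<dots> = ennreal (2 / m) * ((\<integral>\<^sup>+x. indicator S x * I x \<partial>lborel) * emeasure lborel T + emeasure lborel S * (\<integral>\<^sup>+y. indicator T y * I y \<partial>lborel))"
      by (simp add: nn_integral_cmult nn_integral_add nn_integral_multc)
    also have "\<dots> = ennreal (2 / m) * (pair_oscillation S W u * emeasure lborel T +
         emeasure lborel S * pair_oscillation T W u)"
      unfolding I_def by (simp add: nn_integral_cmult)
    also have "\<dots> \<le> ennreal (2 / m) * ((ennreal C * cross_energy \<Omega> s u) * ennreal (measure lborel T) + ennreal (measure lborel S) * (ennreal C' * cross_energy \<Omega> s u))"
      unfolding fin[OF bnd(1)] fin[OF bnd(3)] by (intro mult_left_mono add_mono mult_right_mono C C' su) auto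
    also have "\<dots> = ennreal B * cross_energy \<Omega> s u"
    proof -
      have "ennreal B = ennreal (2 / m) * ennreal (measure lborel T * C + measure lborel S * C')"
        unfolding B_def using m C(1) C'(1) by (intro ennreal_mult) auto
      also have "ennreal (measure lborel T * C + measure lborel S * C') = ennreal C * ennreal (measure lborel T) + ennreal (measure lborel S) * ennreal C'"
        using C(1) C'(1) by (simp add: ennreal_mult mult.commute)
      finally show ?thesis by (simp add: distrib_left distrib_right mult_ac)
    qed
    finally show "pair_oscillation S T u \<le> ennreal B * cross_energy \<Omega> s u" .
  qed
qed

text \<open>
  This is \<open>segment_poincare\<close> with a constant radius, an upper bound for the distances between the two sets.
\<close>

lemma poincare_pair_segments:
  fixes \<Omega> :: "'a::euclidean_space set"
  assumes [measurable]: "\<Omega> \<in> sets borel" "S \<in> sets borel" "T \<in> sets borel"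
    and seg: "\<And>x y. x \<in> S \<Longrightarrow> y \<in> T \<Longrightarrow> closed_segment x y \<subseteq> \<Omega>"
    and dist: "\<And>x y. x \<in> S \<Longrightarrow> y \<in> T \<Longrightarrow> norm (x - y) < D"
  shows "poincare_pair \<Omega> S T"
proof -
  define D' where "D' = max 1 D"
  define B where "B = 8 * D' powr (real DIM('a) + 2)"
  show ?thesis unfolding poincare_pair_def
  proof (intro exI[of _ B] conjI allI impI)
    show "0 \<le> B" by (simp add: B_def)
    fix s :: real and u :: "'a \<Rightarrow> real" assume su: "0 < s \<and> s < 1 \<and> u \<in> borel_measurable borel"
    then have [measurable]: "u \<in> borel_measurable borel" by simp
    define p where "p = real DIM('a) + 2 * s"
    define a where "a x h = (if x \<in> S \<and> x + h \<in> T then D' powr (- p) else 0)" for x h :: 'a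
    have [measurable]: "case_prod a \<in> borel_measurable (borel \<Otimes>\<^sub>M borel)" unfolding a_def by measurable
    have a_bound: "(\<integral>\<^sup>+x. \<integral>\<^sup>+h. ennreal (a x h * (u x - u (x + h))\<^sup>2) \<partial>lborel \<partial>lborel) \<le> 8 * cross_energy \<Omega> s u"
    proof (rule segment_poincare[where R="\<lambda>_. D'"])
      fix x h and \<theta> :: real assume "0 < a x h" and \<theta>: "\<theta> \<in> {0..1}"
      then have x: "x \<in> S" "x + h \<in> T" and ax: "a x h = D' powr (- p)" by (auto simp: a_def split: if_splits)
      have "x + \<theta> *\<^sub>R h = (1 - \<theta>) *\<^sub>R x + \<theta> *\<^sub>R (x + h)" by (simp add: algebra_simps)
      then have "x + \<theta> *\<^sub>R h \<in> closed_segment x (x + h)" using \<theta> by (auto simp: in_segment)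
      then show "x + \<theta> *\<^sub>R h \<in> \<Omega> \<and> norm h < D' \<and> a x h \<le> D' powr (- (real DIM('a) + 2 * s))"
        using seg[OF x] dist[OF x] ax by (auto simp: D'_def p_def)
    qed (use su in auto)
    have "pair_oscillation S T u =
      (\<integral>\<^sup>+x. \<integral>\<^sup>+h. indicator S x * (indicator T (h + x) * ennreal ((u x - u (h + x))\<^sup>2)) \<partial>lborel \<partial>lborel)"
      by (intro nn_integral_cong nn_integral_lborel_shift[symmetric]) measurable
    also have "\<dots> = (\<integral>\<^sup>+x. \<integral>\<^sup>+h. ennreal (D' powr p) * ennreal (a x h * (u x - u (x + h))\<^sup>2) \<partial>lborel \<partial>lborel)"
    proof (intro nn_integral_cong)
      fix x h
      have "D' powr p * D' powr (- p) = 1" by (simp add: powr_add[symmetric] D'_def)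
      then have "D' powr p * (D' powr (- p) * c) = c" for c by (simp add: mult.assoc[symmetric])
      then show "indicator S x * (indicator T (h + x) * ennreal ((u x - u (h + x))\<^sup>2)) = ennreal (D' powr p) * ennreal (a x h * (u x - u (x + h))\<^sup>2)"
        by (auto simp: a_def ennreal_mult[symmetric] add.commute indicator_def)
    qed
    also have "\<dots> = ennreal (D' powr p) * (\<integral>\<^sup>+x. \<integral>\<^sup>+h. ennreal (a x h * (u x - u (x + h))\<^sup>2) \<partial>lborel \<partial>lborel)"
      by (simp add: nn_integral_cmult)
    also have "\<dots> \<le> ennreal (D' powr (real DIM('a) + 2)) * (8 * cross_energy \<Omega> s u)"
    proof (intro mult_mono a_bound ennreal_leI)
      show "D' powr p \<le> D' powr (real DIM('a) + 2)" using su by (intro powr_mono) (auto simp: p_def D'_def)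
    qed auto
    also have "\<dots> = ennreal B * cross_energy \<Omega> s u" by (simp add: B_def ennreal_mult mult_ac)
    finally show "pair_oscillation S T u \<le> ennreal B * cross_energy \<Omega> s u" .
  qed
qed

text \<open>
  Every point of \<open>\<Omega>\<close> near \<open>z\<close> sees the ball \<open>W\<close> above \<open>z\<close> along directions of the cone, in which \<open>\<psi>\<close> increases.
\<close>

lemma (in lipschitz_chart) poincare_pair_boundary:
  obtains \<rho> where "0 < \<rho>" "poincare_pair \<Omega> (ball z \<rho> \<inter> \<Omega>) (ball z \<rho> \<inter> \<Omega>)"
proof -
  define t where "t = r / 8"
  define \<kappa> where "\<kappa> = t / (4 * L + 3)"
  define \<rho> where "\<rho> = \<kappa> / 2"
  have t: "0 < t" using r_pos by (simp add: t_def)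
  have \<rho>: "0 < \<rho>" using t L_ge by (simp add: \<rho>_def \<kappa>_def)
  have "\<kappa> \<le> t / 1" unfolding \<kappa>_def using t L_ge by (intro divide_left_mono) auto
  then have \<rho>t: "2 * \<rho> \<le> t" "t / (4 * L + 3) = 2 * \<rho>" by (auto simp: \<rho>_def \<kappa>_def[symmetric])
  define W where "W = ball (z + t *\<^sub>R e) \<rho>"
  have te: "norm (t *\<^sub>R e) = t" using t norm_e by simp
  have far: "norm (w - x) \<le> 2 * t" "w - x \<in> vcone" if "x \<in> ball z \<rho>" "w \<in> W" for x w
  proof -
    have "norm (w - (z + t *\<^sub>R e)) < \<rho>" using that(2) unfolding W_def by (simp only: mem_ball dist_norm norm_minus_commute)
    moreover have "norm (z - x) < \<rho>" using that(1) by (simp add: dist_norm)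
    moreover have eq: "w - x - t *\<^sub>R e = (w - (z + t *\<^sub>R e)) + (z - x)" by simp
    ultimately have near: "norm (w - x - t *\<^sub>R e) \<le> 2 * \<rho>"
      using norm_triangle_ineq[of "w - (z + t *\<^sub>R e)" "z - x"] unfolding eq by linarith
    then show "w - x \<in> vcone" by (intro vcone_near_axis[of _ t]) (simp add: \<rho>t)
    show "norm (w - x) \<le> 2 * t" using near te \<rho>t norm_triangle_sub[of "w - x" "t *\<^sub>R e"] by linarith
  qed
  have "poincare_pair \<Omega> (ball z \<rho> \<inter> \<Omega>) W"
  proof (rule poincare_pair_segments[where D="3 * t"])
    fix x w assume x: "x \<in> ball z \<rho> \<inter> \<Omega>" and w: "w \<in> W"
    note f = far[of x w]
    show "norm (x - w) < 3 * t" using f x w t by (simp add: norm_minus_commute)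
    have xz: "norm (x - z) < \<rho>" using x by (simp add: dist_norm norm_minus_commute)
    show "closed_segment x w \<subseteq> \<Omega>"
    proof
      fix q assume "q \<in> closed_segment x w"
      then obtain \<theta> where \<theta>: "0 \<le> \<theta>" "\<theta> \<le> 1" and q: "q = (1 - \<theta>) *\<^sub>R x + \<theta> *\<^sub>R w" by (auto simp: in_segment)
      have q': "q = x + \<theta> *\<^sub>R (w - x)" by (simp add: q algebra_simps)
      show "q \<in> \<Omega>"
      proof (cases "\<theta> = 0")
        case True
        then show ?thesis using x q' by simp
      next
        case False
        have "\<theta> *\<^sub>R (w - x) \<in> vcone" using False \<theta> f x w by (intro vcone_scale) auto
        moreover have n: "norm (\<theta> *\<^sub>R (w - x)) \<le> 2 * t"
          using \<theta> f x w mult_left_le_one_le[of "norm (w - x)" \<theta>] by (simp del: norm_minus_cancel)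
        moreover have "3 * t < r" using r_pos by (simp add: t_def)
        ultimately have "\<psi> x + norm (\<theta> *\<^sub>R (w - x)) / 2 \<le> \<psi> q"
          unfolding q' using xz \<rho>t t \<rho> by (intro psi_cone_increase) linarith+
        moreover have "0 < \<psi> x" using psi_graph[of x] x \<rho>t t \<rho> by (auto simp: t_def)
        ultimately have "0 < \<psi> q" using norm_ge_zero[of "\<theta> *\<^sub>R (w - x)"] by linarith
        moreover have "norm (q - z) < r"
          using n xz \<rho>t \<rho> t \<open>3 * t < r\<close> norm_triangle_ineq[of "x - z" "\<theta> *\<^sub>R (w - x)"] unfolding q' by (simp add: algebra_simps)
        ultimately show ?thesis using psi_graph[of q] by (simp add: dist_norm norm_minus_commute)
      qed
    qed
  qed (auto simp: W_def)
  then have "poincare_pair \<Omega> (ball z \<rho> \<inter> \<Omega>) (ball z \<rho> \<inter> \<Omega>)"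
    by (rule poincare_pair_trans[OF _ poincare_pair_sym]) (use \<open>poincare_pair \<Omega> (ball z \<rho> \<inter> \<Omega>) W\<close> \<rho> unit_ball_vol_pos[of "real DIM('a)", THEN less_imp_neq] in \<open>auto simp: W_def emeasure_ball bounded_Int\<close>)
  then show thesis using that \<rho> by blast
qed

lemma poincare_pair_local:
  fixes \<Omega> :: "'a::euclidean_space set"
  assumes "C11_domain \<Omega>" "z \<in> closure \<Omega>"
  shows "\<exists>U. open U \<and> z \<in> U \<and> poincare_pair \<Omega> (U \<inter> \<Omega>) (U \<inter> \<Omega>)"
proof (cases "z \<in> \<Omega>")
  case True
  have o: "open \<Omega>" using assms unfolding C11_domain_def by simp
  then obtain \<rho> where \<rho>: "0 < \<rho>" "ball z \<rho> \<subseteq> \<Omega>" using True openE by blast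
  have "poincare_pair \<Omega> (ball z \<rho>) (ball z \<rho>)"
  proof (rule poincare_pair_segments[where D="2 * \<rho>"])
    fix x y assume xy: "x \<in> ball z \<rho>" "y \<in> ball z \<rho>"
    show "closed_segment x y \<subseteq> \<Omega>" using closed_segment_subset[OF xy] \<rho> by auto
    show "norm (x - y) < 2 * \<rho>" using xy dist_triangle[of x y z] by (simp add: dist_norm norm_minus_commute)
  qed (use o in auto)
  then have "poincare_pair \<Omega> (ball z \<rho> \<inter> \<Omega>) (ball z \<rho> \<inter> \<Omega>)" by (rule poincare_pair_mono) auto
  then show ?thesis using \<rho> by (intro exI[of _ "ball z \<rho>"]) auto
next
  case False
  then have "z \<in> frontier \<Omega>" using assms by (auto simp: frontier_def interior_open C11_domain_def)
  then obtain e r L \<psi> where "lipschitz_chart \<Omega> z e r L \<psi>" using C11_domain_chart assms(1) by blast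
  then interpret lipschitz_chart \<Omega> z e r L \<psi> .
  obtain \<rho> where "0 < \<rho>" "poincare_pair \<Omega> (ball z \<rho> \<inter> \<Omega>) (ball z \<rho> \<inter> \<Omega>)"
    by (rule poincare_pair_boundary)
  then show ?thesis by (intro exI[of _ "ball z \<rho>"]) auto
qed

lemma open_pos_measure:
  fixes U :: "'a::euclidean_space set"
  assumes "open U" "U \<noteq> {}"
  shows "emeasure lborel U \<noteq> 0"
proof -
  obtain x \<rho> where "0 < \<rho>" "ball x \<rho> \<subseteq> U" using assms by (meson all_not_in_conv openE)
  then have "emeasure lborel (ball x \<rho>) \<le> emeasure lborel U" using assms by (intro emeasure_mono) auto
  then show ?thesis using \<open>0 < \<rho>\<close> unit_ball_vol_pos[of "real DIM('a)", THEN less_imp_neq] by (auto simp: emeasure_ball)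
qed

text \<open>
  Being connected by neighbourhoods that form a Poincare pair is an equivalence relation on \<open>\<Omega>\<close> with open
  classes, so by connectedness there is a single class. A finite cover of the closure by neighbourhoods on
  which the inequality holds then reduces the claim to finitely many pairs.
\<close>

lemma poincare_pair_domain:
  fixes \<Omega> :: "'a::euclidean_space set"
  assumes C11: "C11_domain \<Omega>" and bnd: "bounded \<Omega>"
  shows "poincare_pair \<Omega> \<Omega> \<Omega>"
proof -
  have o: "open \<Omega>" and con: "connected \<Omega>" using C11 unfolding C11_domain_def by auto
  have chain: "poincare_pair \<Omega> (A \<inter> \<Omega>) (B \<inter> \<Omega>)"
    if "poincare_pair \<Omega> (A \<inter> \<Omega>) (V \<inter> \<Omega>)" "poincare_pair \<Omega> (V' \<inter> \<Omega>) (B \<inter> \<Omega>)"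
      "open A" "open B" "open V" "open V'" "V \<inter> V' \<inter> \<Omega> \<noteq> {}" for A B V V'
  proof (rule poincare_pair_trans[of _ _ "V \<inter> V' \<inter> \<Omega>"])
    show "poincare_pair \<Omega> (A \<inter> \<Omega>) (V \<inter> V' \<inter> \<Omega>)" using that(1) by (rule poincare_pair_mono) auto
    show "poincare_pair \<Omega> (V \<inter> V' \<inter> \<Omega>) (B \<inter> \<Omega>)" using that(2) by (rule poincare_pair_mono) auto
    show "emeasure lborel (V \<inter> V' \<inter> \<Omega>) \<noteq> 0" using that o by (intro open_pos_measure open_Int)
  qed (use that o bnd in \<open>auto intro: bounded_Int\<close>)
  define R where "R x y \<longleftrightarrow> (\<exists>A B. open A \<and> open B \<and> x \<in> A \<and> y \<in> B \<and> poincare_pair \<Omega> (A \<inter> \<Omega>) (B \<inter> \<Omega>))" for x y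
  have R: "R x y" if "x \<in> \<Omega>" "y \<in> \<Omega>" for x y
  proof (rule connected_equivalence_relation[OF con that(1,2), of R])
    show "R y x" if "R x y" "x \<in> \<Omega>" "y \<in> \<Omega>" for x y
    proof -
      obtain A B where AB: "open A" "open B" "x \<in> A" "y \<in> B" "poincare_pair \<Omega> (A \<inter> \<Omega>) (B \<inter> \<Omega>)"
        using \<open>R x y\<close> unfolding R_def by blast
      then have "poincare_pair \<Omega> (B \<inter> \<Omega>) (A \<inter> \<Omega>)" using o by (intro poincare_pair_sym[OF AB(5)]) auto
      then show ?thesis using AB unfolding R_def by blast
    qed
    show "R x z" if "R x y" "R y z" "x \<in> \<Omega>" "y \<in> \<Omega>" "z \<in> \<Omega>" for x y z
    proof -
      obtain A B where AB: "open A" "open B" "x \<in> A" "y \<in> B" "poincare_pair \<Omega> (A \<inter> \<Omega>) (B \<inter> \<Omega>)"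
        using \<open>R x y\<close> unfolding R_def by blast
      obtain A' B' where AB': "open A'" "open B'" "y \<in> A'" "z \<in> B'" "poincare_pair \<Omega> (A' \<inter> \<Omega>) (B' \<inter> \<Omega>)"
        using \<open>R y z\<close> unfolding R_def by blast
      have "poincare_pair \<Omega> (A \<inter> \<Omega>) (B' \<inter> \<Omega>)"
        by (rule chain[OF AB(5) AB'(5)]) (use AB AB' that in auto)
      then show ?thesis using AB AB' unfolding R_def by blast
    qed
    show "\<exists>T. openin (top_of_set \<Omega>) T \<and> a \<in> T \<and> (\<forall>x\<in>T. R a x)" if a: "a \<in> \<Omega>" for a
    proof -
      obtain U where U: "open U" "a \<in> U" "poincare_pair \<Omega> (U \<inter> \<Omega>) (U \<inter> \<Omega>)"
        using poincare_pair_local[OF C11, of a] a closure_subset by blast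
      then show ?thesis using a by (intro exI[of _ "\<Omega> \<inter> U"]) (auto simp: R_def openin_open_Int)
    qed
  qed
  have "compact (closure \<Omega>)" using bnd by (simp add: compact_closure)
  moreover obtain U where U: "\<And>z. z \<in> closure \<Omega> \<Longrightarrow> open (U z) \<and> z \<in> U z \<and> poincare_pair \<Omega> (U z \<inter> \<Omega>) (U z \<inter> \<Omega>)"
    using poincare_pair_local[OF C11] by metis
  moreover have "closure \<Omega> \<subseteq> (\<Union>z\<in>closure \<Omega>. U z)" using U by blast
  ultimately obtain Z where Z: "Z \<subseteq> closure \<Omega>" "finite Z" "closure \<Omega> \<subseteq> (\<Union>z\<in>Z. U z)"
    by (metis compactE_image)
  have UU: "poincare_pair \<Omega> (U a \<inter> \<Omega>) (U b \<inter> \<Omega>)" if "a \<in> Z" "b \<in> Z" for a b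
  proof (cases "U a \<inter> \<Omega> = {} \<or> U b \<inter> \<Omega> = {}")
    case True
    moreover have "poincare_pair \<Omega> S {}" "poincare_pair \<Omega> {} S" for S
      unfolding poincare_pair_def by (intro exI[of _ 0]; simp)+
    ultimately show ?thesis by (elim disjE) simp_all
  next
    case False
    then obtain p q where p: "p \<in> U a" "p \<in> \<Omega>" and q: "q \<in> U b" "q \<in> \<Omega>" by blast
    obtain A B where AB: "open A" "open B" "p \<in> A" "q \<in> B" "poincare_pair \<Omega> (A \<inter> \<Omega>) (B \<inter> \<Omega>)"
      using R[OF p(2) q(2)] unfolding R_def by blast
    have Ua: "open (U a)" "poincare_pair \<Omega> (U a \<inter> \<Omega>) (U a \<inter> \<Omega>)" and Ub: "open (U b)" "poincare_pair \<Omega> (U b \<inter> \<Omega>) (U b \<inter> \<Omega>)"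
      using U that Z by auto
    have "poincare_pair \<Omega> (U a \<inter> \<Omega>) (B \<inter> \<Omega>)"
      by (rule chain[OF Ua(2) AB(5)]) (use Ua AB p in auto)
    then show ?thesis by (rule chain[OF _ Ub(2)]) (use Ua Ub AB q in auto)
  qed
  have b: "U z \<inter> \<Omega> \<in> sets borel" if "z \<in> Z" for z using U Z that o by auto
  have eq: "\<Omega> = (\<Union>z\<in>Z. U z \<inter> \<Omega>)" using Z closure_subset by blast
  have "poincare_pair \<Omega> (U a \<inter> \<Omega>) \<Omega>" if "a \<in> Z" for a
  proof -
    have "poincare_pair \<Omega> (U a \<inter> \<Omega>) (\<Union>z\<in>Z. U z \<inter> \<Omega>)"
      by (rule poincare_pair_UN) (use Z that b UU in auto)
    then show ?thesis using eq by simp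
  qed
  then have "poincare_pair \<Omega> \<Omega> (U a \<inter> \<Omega>)" if "a \<in> Z" for a
    by (rule poincare_pair_sym) (use that b o in auto)
  then have "poincare_pair \<Omega> \<Omega> (\<Union>z\<in>Z. U z \<inter> \<Omega>)"
    by (intro poincare_pair_UN) (use Z b o in auto)
  then show ?thesis using eq by simp
qed

text \<open>
  On a set of finite measure \<open>\<bar>t\<bar> \<le> \<bar>c\<bar> + 1 + (c - t)\<^sup>2\<close> turns square integrability into integrability.
\<close>

lemma integrable_if_sq_distance_finite:
  fixes u :: "'a::euclidean_space \<Rightarrow> real"
  assumes [measurable]: "u \<in> borel_measurable borel" "\<Omega> \<in> sets borel" and bnd: "bounded \<Omega>"
    and fin: "(\<integral>\<^sup>+y. indicator \<Omega> y * ennreal ((c - u y)\<^sup>2) \<partial>lborel) \<noteq> \<infinity>"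
  shows "integrable lborel (\<lambda>y. indicator \<Omega> y * (c - u y)\<^sup>2)" "integrable lborel (\<lambda>y. indicator \<Omega> y * u y)"
proof -
  have eq: "(\<integral>\<^sup>+y. indicator \<Omega> y * ennreal ((c - u y)\<^sup>2) \<partial>lborel) = (\<integral>\<^sup>+y. ennreal (indicator \<Omega> y * (c - u y)\<^sup>2) \<partial>lborel)"
    by (intro nn_integral_cong) (auto simp: indicator_def)
  show I2: "integrable lborel (\<lambda>y. indicator \<Omega> y * (c - u y)\<^sup>2)"
    using fin unfolding eq by (intro integrableI_nonneg) (auto simp: less_top)
  have I1: "integrable lborel (\<lambda>y. indicator \<Omega> y * (\<bar>c\<bar> + 1))"
    using emeasure_bounded_finite[OF bnd] by (intro integrable_mult_left integrable_real_indicator) auto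
  show "integrable lborel (\<lambda>y. indicator \<Omega> y * u y)"
  proof (rule Bochner_Integration.integrable_bound[OF Bochner_Integration.integrable_add[OF I1 I2]])
    have "\<bar>t\<bar> \<le> \<bar>c\<bar> + 1 + (c - t)\<^sup>2" for t
    proof -
      have "0 \<le> (\<bar>c - t\<bar> - 1)\<^sup>2" by simp
      then have "2 * \<bar>c - t\<bar> \<le> 1 + (c - t)\<^sup>2" by (simp add: power2_diff)
      moreover have "a \<le> 1 + X" if "2 * a \<le> 1 + X" "0 \<le> X" for a X :: real using that by linarith
      ultimately have "\<bar>c - t\<bar> \<le> 1 + (c - t)\<^sup>2" by (meson zero_le_power2)
      then show ?thesis by linarith
    qed
    then show "AE x in lborel. norm (indicator \<Omega> x * u x) \<le> norm (indicator \<Omega> x * (\<bar>c\<bar> + 1) + indicator \<Omega> x * (c - u x)\<^sup>2)"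
      by (auto simp: indicator_def abs_of_nonneg add_nonneg_nonneg)
  qed measurable
qed

text \<open>
  Expanding the square, the mixed term integrates to zero and \<open>(u y)\<^sup>2\<close> is dropped.
\<close>

lemma mean_zero_sq_le:
  fixes u :: "'a::euclidean_space \<Rightarrow> real"
  assumes [measurable]: "u \<in> borel_measurable borel" "\<Omega> \<in> sets borel" and bnd: "bounded \<Omega>"
    and mean: "(LINT x:\<Omega>|lborel. u x) = 0"
  shows "ennreal (c\<^sup>2) * emeasure lborel \<Omega> \<le> (\<integral>\<^sup>+y. indicator \<Omega> y * ennreal ((c - u y)\<^sup>2) \<partial>lborel)"
proof (cases "(\<integral>\<^sup>+y. indicator \<Omega> y * ennreal ((c - u y)\<^sup>2) \<partial>lborel) = \<infinity>")
  case False
  note I2 = integrable_if_sq_distance_finite(1)[OF assms(1-3) False]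
    and Iu = integrable_if_sq_distance_finite(2)[OF assms(1-3) False]
  have fin: "emeasure lborel \<Omega> < \<infinity>" using emeasure_bounded_finite[OF bnd] by simp
  have eq: "(\<integral>\<^sup>+y. indicator \<Omega> y * ennreal ((c - u y)\<^sup>2) \<partial>lborel) = (\<integral>\<^sup>+y. ennreal (indicator \<Omega> y * (c - u y)\<^sup>2) \<partial>lborel)"
    by (intro nn_integral_cong) (auto simp: indicator_def)
  have I1: "integrable lborel (\<lambda>y. indicator \<Omega> y * c\<^sup>2)"
    using fin by (intro integrable_mult_left integrable_real_indicator) auto
  have "(\<integral>y. indicator \<Omega> y * c\<^sup>2 - 2 * c * (indicator \<Omega> y * u y) \<partial>lborel) \<le> (\<integral>y. indicator \<Omega> y * (c - u y)\<^sup>2 \<partial>lborel)"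
    by (intro integral_mono I2 Bochner_Integration.integrable_diff I1 integrable_mult_right Iu) (auto simp: indicator_def power2_diff)
  also have "(\<integral>y. indicator \<Omega> y * c\<^sup>2 - 2 * c * (indicator \<Omega> y * u y) \<partial>lborel) = measure lborel \<Omega> * c\<^sup>2 - 2 * c * (\<integral>y. indicator \<Omega> y * u y \<partial>lborel)"
    using I1 Iu fin by simp
  also have "(\<integral>y. indicator \<Omega> y * u y \<partial>lborel) = 0" using mean by (simp add: set_lebesgue_integral_def)
  finally have "ennreal (c\<^sup>2 * measure lborel \<Omega>) \<le> ennreal (\<integral>y. indicator \<Omega> y * (c - u y)\<^sup>2 \<partial>lborel)"
    by (intro ennreal_leI) (simp add: mult.commute)
  also have "\<dots> = (\<integral>\<^sup>+y. indicator \<Omega> y * ennreal ((c - u y)\<^sup>2) \<partial>lborel)"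
    unfolding eq by (rule nn_integral_eq_integral[OF I2, symmetric]) auto
  finally show ?thesis using fin by (simp add: ennreal_mult emeasure_eq_ennreal_measure less_top)
qed simp

lemma poincare_mean_zero:
  fixes \<Omega> :: "'a::euclidean_space set"
  assumes C11: "C11_domain \<Omega>" and bnd: "bounded \<Omega>"
  obtains C where "0 < C" "\<And>s u. 0 < s \<Longrightarrow> s < 1 \<Longrightarrow> u \<in> borel_measurable borel \<Longrightarrow> (LINT x:\<Omega>|lborel. u x) = 0 \<Longrightarrow>
    (sq_integral \<Omega> u) \<le> ennreal C * cross_energy \<Omega> s u"
proof (cases "\<Omega> = {}")
  case True
  then show thesis by (intro that[of 1]) auto
next
  case False
  have o: "open \<Omega>" using C11 unfolding C11_domain_def by auto
  then have [measurable]: "\<Omega> \<in> sets borel" by simp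
  define m where "m = measure lborel \<Omega>"
  have fin: "emeasure lborel \<Omega> = ennreal m"
    using emeasure_bounded_finite[OF bnd] by (simp add: emeasure_eq_ennreal_measure m_def)
  then have m: "0 < m" using open_pos_measure[OF o False] by (auto simp: m_def zero_less_measure_iff)
  obtain C where C: "0 \<le> C" "\<And>s u. 0 < s \<and> s < 1 \<and> u \<in> borel_measurable borel \<Longrightarrow>
    (pair_oscillation \<Omega> \<Omega> u) \<le> ennreal C * cross_energy \<Omega> s u"
    using poincare_pair_domain[OF C11 bnd] unfolding poincare_pair_def by blast
  show thesis
  proof (rule that[of "(C + 1) / m"])
    show "0 < (C + 1) / m" using C m by simp
    fix s :: real and u :: "'a \<Rightarrow> real"
    assume s: "0 < s" "s < 1" and [measurable]: "u \<in> borel_measurable borel" and mean: "(LINT x:\<Omega>|lborel. u x) = 0"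
    have "sq_integral \<Omega> u = (\<integral>\<^sup>+x. ennreal (1 / m) * (indicator \<Omega> x * (ennreal ((u x)\<^sup>2) * emeasure lborel \<Omega>)) \<partial>lborel)"
      using m by (intro nn_integral_cong) (auto simp: fin ennreal_mult[symmetric] indicator_def)
    also have "\<dots> \<le> (\<integral>\<^sup>+x. ennreal (1 / m) * (indicator \<Omega> x * (\<integral>\<^sup>+y. indicator \<Omega> y * ennreal ((u x - u y)\<^sup>2) \<partial>lborel)) \<partial>lborel)"
      by (intro nn_integral_mono mult_left_mono mean_zero_sq_le bnd mean) auto
    also have "\<dots> = ennreal (1 / m) * pair_oscillation \<Omega> \<Omega> u"
      by (simp add: nn_integral_cmult)
    also have "\<dots> \<le> ennreal (1 / m) * (ennreal C * cross_energy \<Omega> s u)"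
      by (intro mult_left_mono C) (use s in auto)
    also have "\<dots> \<le> ennreal (1 / m) * (ennreal (C + 1) * cross_energy \<Omega> s u)"
      by (intro mult_left_mono mult_right_mono ennreal_leI) auto
    also have "\<dots> = ennreal ((C + 1) / m) * cross_energy \<Omega> s u"
      using m C(1) by (simp only: mult.assoc[symmetric]) (subst ennreal_mult[symmetric], auto)
    finally show "sq_integral \<Omega> u \<le> ennreal ((C + 1) / m) * cross_energy \<Omega> s u" .
  qed
qed

section \<open>The robust trace inequality\<close>

text \<open>
  On the shell where \<open>1 + norm x\<close> lies between \<open>2 ^ k\<close> and \<open>2 ^ (k + 1)\<close> the integrand is at most
  \<open>2 powr (- k * (d + a))\<close>, and the shells lie in balls of volume proportional to \<open>2 ^ (k * d)\<close>.
\<close>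

lemma nn_integral_decay_finite:
  assumes a: "0 < a"
  shows "(\<integral>\<^sup>+x. ennreal ((1 + norm (x::'a::euclidean_space)) powr (- (real DIM('a) + a))) \<partial>lborel) < \<infinity>"
proof -
  define d where "d = real DIM('a)"
  define c where "c k = 2 powr (- (real k * (d + a)))" for k :: nat
  have pt: "ennreal ((1 + norm x) powr (- (d + a))) \<le> (\<Sum>k. ennreal (c k) * indicator (ball 0 (2 ^ (k + 1))) x)" for x :: 'a
  proof -
    define k where "k = nat \<lfloor>log 2 (1 + norm x)\<rfloor>"
    have l0: "0 \<le> log 2 (1 + norm x)"
      using log_mono[of 2 1 "1 + norm x"] by simp
    have k: "real k \<le> log 2 (1 + norm x)" "log 2 (1 + norm x) < real k + 1"
      unfolding k_def using l0 by linarith+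
    have p1: "0 < 1 + norm x" by (simp add: add_pos_nonneg)
    have 1: "2 powr real k \<le> 1 + norm x" using k(1) p1 by (simp add: le_log_iff)
    have 2: "1 + norm x < 2 powr (real k + 1)" using k(2) p1 by (simp add: log_less_iff)
    have "(1 + norm x) powr (- (d + a)) \<le> (2 powr real k) powr (- (d + a))"
      using 1 a p1 by (intro powr_mono2') (auto simp: d_def)
    also have "\<dots> = c k" by (simp add: c_def powr_powr algebra_simps)
    finally have "ennreal ((1 + norm x) powr (- (d + a))) \<le> ennreal (c k)" by (rule ennreal_leI)
    moreover have "2 powr (real k + 1) = 2 ^ (k + 1)" by (simp add: powr_add powr_realpow)
    then have "x \<in> ball 0 (2 ^ (k + 1))" using 2 by simp
    ultimately have "ennreal ((1 + norm x) powr (- (d + a))) \<le> (\<Sum>k\<in>{k}. ennreal (c k) * indicator (ball 0 (2 ^ (k + 1))) x)" by simp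
    also have "\<dots> \<le> (\<Sum>k. ennreal (c k) * indicator (ball 0 (2 ^ (k + 1))) x)" by (intro sum_le_suminf) auto
    finally show ?thesis .
  qed
  have "(\<integral>\<^sup>+x. ennreal ((1 + norm (x::'a)) powr (- (d + a))) \<partial>lborel) \<le> (\<integral>\<^sup>+x. (\<Sum>k. ennreal (c k) * indicator (ball (0::'a) (2 ^ (k + 1))) x) \<partial>lborel)"
    by (intro nn_integral_mono pt)
  also have "\<dots> = (\<Sum>k. \<integral>\<^sup>+x. ennreal (c k) * indicator (ball (0::'a) (2 ^ (k + 1))) x \<partial>lborel)"
    by (rule nn_integral_suminf) measurable
  also have "\<dots> = (\<Sum>k. ennreal (2 ^ DIM('a) * unit_ball_vol d * (2 powr (- a)) ^ k))"
  proof (intro suminf_cong)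
    fix k
    have "(\<integral>\<^sup>+x. ennreal (c k) * indicator (ball (0::'a) (2 ^ (k + 1))) x \<partial>lborel) = ennreal (c k) * ennreal (unit_ball_vol d * (2 ^ (k + 1)) ^ DIM('a))"
      by (subst nn_integral_cmult_indicator) (auto simp: emeasure_ball d_def)
    also have "\<dots> = ennreal (c k * (unit_ball_vol d * (2 ^ (k + 1)) ^ DIM('a)))"
      by (subst ennreal_mult) (auto simp: c_def d_def)
    also have "c k * (unit_ball_vol d * (2 ^ (k + 1)) ^ DIM('a)) = 2 ^ DIM('a) * unit_ball_vol d * (2 powr (- a)) ^ k"
    proof -
      have "(2 powr (- a)) ^ k = 2 powr (- a * real k)"
      proof -
        have "(2 powr (- a)) ^ k = (2 powr (- a)) powr real k" by (rule powr_realpow[symmetric]) simp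
        then show ?thesis by (simp only: powr_powr)
      qed
      moreover have "((2::real) ^ k) ^ DIM('a) = 2 powr (real k * d)"
      proof -
        have "((2::real) ^ k) ^ DIM('a) = 2 ^ (k * DIM('a))" by (rule power_mult[symmetric])
        also have "\<dots> = 2 powr real (k * DIM('a))" by (rule powr_realpow[symmetric]) simp
        finally show ?thesis by (simp add: d_def)
      qed
      moreover have "c k * 2 powr (real k * d) = 2 powr (- a * real k)"
        by (simp add: c_def powr_add[symmetric] algebra_simps)
      ultimately show ?thesis by (simp add: power_mult_distrib mult_ac)
    qed
    finally show "(\<integral>\<^sup>+x. ennreal (c k) * indicator (ball (0::'a) (2 ^ (k + 1))) x \<partial>lborel) = ennreal (2 ^ DIM('a) * unit_ball_vol d * (2 powr (- a)) ^ k)" .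
  qed
  also have "\<dots> < \<infinity>"
  proof -
    have "2 powr (- a) < (1::real)" using a powr_less_mono[of "-a" 0 2] by simp
    then have "summable (\<lambda>k. 2 ^ DIM('a) * unit_ball_vol d * (2 powr (- a)) ^ k)"
      by (intro summable_mult summable_geometric) auto
    then have "(\<Sum>k. ennreal (2 ^ DIM('a) * unit_ball_vol d * (2 powr (- a)) ^ k)) \<noteq> top"
      by (intro ennreal_suminf_neq_top) (auto simp: d_def)
    then show ?thesis by (simp add: less_top)
  qed
  finally show ?thesis unfolding d_def .
qed

lemma powr_divide_minus:
  fixes a b p :: real
  assumes "0 \<le> a" "0 < b"
  shows "(a / b) powr (- p) = b powr p * a powr (- p)"
  using assms by (simp add: powr_divide powr_minus[of b] field_simps)

lemma tau_nonneg: "s < 1 \<Longrightarrow> 0 \<le> tau \<Omega> s x"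
  unfolding tau_def by simp

lemma tau_measurable [measurable]: "tau \<Omega> s \<in> borel_measurable borel"
  unfolding tau_def by measurable

lemma tau_eq: "tau \<Omega> s x = (1 - s) * (bdist \<Omega> x powr (- s) * (1 + bdist \<Omega> x) powr (- (real DIM('a) + s)))"
  for \<Omega> :: "'a::euclidean_space set"
  unfolding tau_def powr_minus by (simp add: divide_inverse)

lemma tau_le_layer:
  assumes "0 < s" "s < 1"
  shows "tau \<Omega> s x \<le> layer_weight \<Omega> s x"
proof -
  have "(1 + bdist \<Omega> x) powr (- (real DIM('a) + s)) \<le> 1"
    using assms powr_mono[of "- (real DIM('a) + s)" 0 "1 + bdist \<Omega> x"] by (simp add: add_nonneg_eq_0_iff)
  then show ?thesis unfolding tau_eq using assms mult_left_mono[of _ 1 "bdist \<Omega> x powr (- s)"] by (intro mult_left_mono) auto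
qed

text \<open>
  The base of the power in the kernel exceeds a fixed multiple of \<open>(1 + bdist \<Omega> x) * (1 + bdist \<Omega> y)\<close>, since
  the product expands to \<open>1\<close> plus summands of that base.
\<close>

lemma trace_kernel_le_tau:
  fixes \<Omega> :: "'a::euclidean_space set"
  assumes \<delta>: "0 < \<delta>" and far: "\<delta> \<le> norm (x - y) + bdist \<Omega> x + bdist \<Omega> y" and s: "s < 1"
  shows "trace_kernel \<Omega> s x y \<le> (1 + 1 / \<delta>) ^ DIM('a) * (tau \<Omega> s x * tau \<Omega> s y)"
proof (cases "bdist \<Omega> x = 0 \<or> bdist \<Omega> y = 0")
  case True
  then show ?thesis by (auto simp: trace_kernel_def tau_def)
next
  case False
  then have b: "0 < bdist \<Omega> x" "0 < bdist \<Omega> y" by (auto simp: less_le)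
  define R where "R = norm (x - y) + bdist \<Omega> x * bdist \<Omega> y + bdist \<Omega> x + bdist \<Omega> y"
  have R: "0 < R" unfolding R_def using b by (simp add: add_nonneg_pos)
  have "\<delta> \<le> R" using far b mult_pos_pos[OF b] unfolding R_def by linarith
  then have "1 \<le> R / \<delta>" using \<delta> by simp
  moreover have "(1 + bdist \<Omega> x) * (1 + bdist \<Omega> y) \<le> 1 + R" unfolding R_def by (simp add: algebra_simps)
  ultimately have "(1 + bdist \<Omega> x) * (1 + bdist \<Omega> y) \<le> R * (1 + 1 / \<delta>)" by (simp add: distrib_left)
  then have le: "((1 + bdist \<Omega> x) * (1 + bdist \<Omega> y)) ^ DIM('a) \<le> (R * (1 + 1 / \<delta>)) ^ DIM('a)" using b by (intro power_mono) auto
  have pw: "1 / R ^ DIM('a) \<le> (1 + 1 / \<delta>) ^ DIM('a) / ((1 + bdist \<Omega> x) ^ DIM('a) * (1 + bdist \<Omega> y) ^ DIM('a))"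
  proof -
    have *: "1 / a \<le> k / p" if "p \<le> a * k" "0 < a" "0 < p" for a k p :: real
      using that by (simp add: field_simps)
    show ?thesis
    proof (rule *)
      show "(1 + bdist \<Omega> x) ^ DIM('a) * (1 + bdist \<Omega> y) ^ DIM('a) \<le> R ^ DIM('a) * (1 + 1 / \<delta>) ^ DIM('a)"
        using le by (simp only: power_mult_distrib)
    qed (use b R in auto)
  qed
  define A where "A = bdist \<Omega> x powr s * (1 + bdist \<Omega> x) powr s * bdist \<Omega> y powr s * (1 + bdist \<Omega> y) powr s"
  have A: "0 < A" using b by (simp add: A_def)
  have "trace_kernel \<Omega> s x y = (1 - s)\<^sup>2 / A * (1 / R ^ DIM('a))"
    unfolding trace_kernel_def A_def R_def by simp
  also have "\<dots> \<le> (1 - s)\<^sup>2 / A * ((1 + 1 / \<delta>) ^ DIM('a) / ((1 + bdist \<Omega> x) ^ DIM('a) * (1 + bdist \<Omega> y) ^ DIM('a)))"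
    using A by (intro mult_left_mono pw) auto
  also have "\<dots> = (1 + 1 / \<delta>) ^ DIM('a) * (tau \<Omega> s x * tau \<Omega> s y)"
    unfolding tau_def A_def using b by (simp add: powr_add powr_realpow power2_eq_square mult_ac)
  finally show ?thesis .
qed

text \<open>
  The three local estimates in the ball of radius \<open>\<rho>\<close> around a boundary point, with one constant for all
  \<open>s\<close> in \<open>[s0, 1)\<close>: the mass of the layer weight and the two terms of the trace norm.
\<close>

definition local_trace :: "'a::euclidean_space set \<Rightarrow> real \<Rightarrow> 'a \<Rightarrow> real \<Rightarrow> real \<Rightarrow> bool" where
  "local_trace \<Omega> s0 z \<rho> C \<longleftrightarrow> (\<forall>s u. s0 \<le> s \<and> s < 1 \<and> u \<in> borel_measurable borel \<longrightarrow>
    (\<integral>\<^sup>+x. indicator (ball z \<rho> - \<Omega>) x * ennreal (layer_weight \<Omega> s x) \<partial>lborel) \<le> ennreal C \<and>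
    (\<integral>\<^sup>+x. indicator (ball z \<rho> - \<Omega>) x * ennreal ((u x)\<^sup>2 * (layer_weight \<Omega> s x)) \<partial>lborel)
      \<le> ennreal C * (cross_energy \<Omega> s u + sq_integral \<Omega> u) \<and>
    (exterior_energy \<Omega> s (ball z \<rho> - \<Omega>) u)
      \<le> ennreal C * (cross_energy \<Omega> s u + sq_integral \<Omega> u))"

lemma local_trace_exists:
  fixes \<Omega> :: "'a::euclidean_space set"
  assumes "C11_domain \<Omega>" "z \<in> frontier \<Omega>" and s0: "0 < s0"
  shows "\<exists>\<rho> C. 0 < \<rho> \<and> 0 \<le> C \<and> local_trace \<Omega> s0 z \<rho> C"
proof -
  obtain e r L \<psi> where "lipschitz_chart \<Omega> z e r L \<psi>" using C11_domain_chart[OF assms(1,2)] by blast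
  then interpret lipschitz_chart \<Omega> z e r L \<psi> .
  \<comment> \<open>Rays of length up to \<open>32 * (L + 1) * \<rho>\<close> have to stay in the half of the chart where the height bounds the distance.\<close>
  define \<rho> where "\<rho> = r / (100 * (L + 1))"
  have \<rho>: "0 < \<rho>" using r_pos L_ge by (simp add: \<rho>_def)
  have r: "r = 100 * (L + 1) * \<rho>" using L_ge by (simp add: \<rho>_def)
  have \<rho>2: "\<rho> + 32 * (L + 1) * \<rho> < r / 2"
  proof -
    have "0 < L * \<rho>" using L_ge \<rho> by simp
    then show ?thesis using \<rho> unfolding r by (simp add: algebra_simps)
  qed
  obtain C1 where C1: "0 < C1" "\<And>s u. s0 \<le> s \<Longrightarrow> s < 1 \<Longrightarrow> u \<in> borel_measurable borel \<Longrightarrow>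
    (exterior_energy \<Omega> s (ball z \<rho> - \<Omega>) u) \<le> ennreal C1 * cross_energy \<Omega> s u"
    using local_double_trace[OF s0 \<rho> \<rho>2] by blast
  obtain C2 where C2: "0 < C2" "\<And>s u. s0 \<le> s \<Longrightarrow> s < 1 \<Longrightarrow> u \<in> borel_measurable borel \<Longrightarrow>
    (\<integral>\<^sup>+x. indicator (ball z \<rho> - \<Omega>) x * ennreal ((u x)\<^sup>2 * (layer_weight \<Omega> s x)) \<partial>lborel)
    \<le> ennreal C2 * (cross_energy \<Omega> s u + sq_integral \<Omega> u)"
    using local_single_trace[OF s0 \<rho> \<rho>2] by blast
  define C3 where "C3 = layer_const * max 1 \<rho> powr (real DIM('a))"
  have C3: "(\<integral>\<^sup>+x. indicator (ball z \<rho> - \<Omega>) x * ennreal (layer_weight \<Omega> s x) \<partial>lborel) \<le> ennreal C3"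
    if s: "s0 \<le> s" "s < 1" for s
  proof -
    have s': "0 < s" using s s0 by simp
    have "\<rho> < r / 2"
    proof -
      have "0 \<le> 32 * (L + 1) * \<rho>" using \<rho> L_ge by simp
      then show ?thesis using \<rho>2 by linarith
    qed
    then have "(\<integral>\<^sup>+x. indicator (ball z \<rho> - \<Omega>) x * ennreal (layer_weight \<Omega> s x) \<partial>lborel) \<le>
      (\<integral>\<^sup>+x. indicator (ball z \<rho> \<inter> ball z (r / 2)) x * ennreal (layer_weight \<Omega> s x) \<partial>lborel)"
      by (intro nn_integral_mono) (auto split: split_indicator)
    also have "\<dots> \<le> ennreal (layer_const * \<rho> powr (real DIM('a) - s))"
      by (rule bdist_layer) (use s s' \<rho> in auto)
    also have "\<dots> \<le> ennreal C3"
    proof -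
      have d: "1 \<le> real DIM('a)" using DIM_positive[where 'a='a] by linarith
      have "\<rho> powr (real DIM('a) - s) \<le> max 1 \<rho> powr (real DIM('a) - s)" using \<rho> s d by (intro powr_mono2) linarith+
      also have "\<dots> \<le> max 1 \<rho> powr (real DIM('a))" using s' by (intro powr_mono) auto
      finally show ?thesis unfolding C3_def using layer_const_pos by (intro ennreal_leI mult_left_mono) auto
    qed
    finally show ?thesis .
  qed
  have C30: "0 \<le> C3" using layer_const_pos by (simp add: C3_def)
  define C where "C = C1 + C2 + C3"
  have C: "0 \<le> C" "C1 \<le> C" "C2 \<le> C" "C3 \<le> C" using C1(1) C2(1) C30 by (auto simp: C_def)
  have "local_trace \<Omega> s0 z \<rho> C"
    unfolding local_trace_def
  proof (intro allI impI conjI)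
    fix s :: real and u :: "'a \<Rightarrow> real" assume su: "s0 \<le> s \<and> s < 1 \<and> u \<in> borel_measurable borel"
    show "(\<integral>\<^sup>+x. indicator (ball z \<rho> - \<Omega>) x * ennreal (layer_weight \<Omega> s x) \<partial>lborel) \<le> ennreal C"
      using C3[of s] su C by (auto intro: order_trans ennreal_leI)
    show "(\<integral>\<^sup>+x. indicator (ball z \<rho> - \<Omega>) x * ennreal ((u x)\<^sup>2 * (layer_weight \<Omega> s x)) \<partial>lborel)
      \<le> ennreal C * (cross_energy \<Omega> s u + sq_integral \<Omega> u)"
      by (rule order_trans[OF C2(2)]) (use su C in \<open>auto intro!: mult_right_mono ennreal_leI\<close>)
    show "exterior_energy \<Omega> s (ball z \<rho> - \<Omega>) u
      \<le> ennreal C * (cross_energy \<Omega> s u + sq_integral \<Omega> u)"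
      by (rule order_trans[OF C1(2)]) (use su C in \<open>auto intro!: mult_mono ennreal_leI\<close>)
  qed
  then show ?thesis using \<rho> C by blast
qed

lemma T_sqnorm_eq:
  "T_sqnorm \<Omega> s g = (\<integral>\<^sup>+x. indicator (- \<Omega>) x * ennreal ((g x)\<^sup>2 * tau \<Omega> s x) \<partial>lborel) +
    (\<integral>\<^sup>+x. \<integral>\<^sup>+y. indicator (- \<Omega>) x * (indicator (- \<Omega>) y * ennreal ((g x - g y)\<^sup>2 * trace_kernel \<Omega> s x y)) \<partial>lborel \<partial>lborel)"
  unfolding T_sqnorm_def
  by (intro arg_cong2[where f="(+)"] nn_integral_cong) (auto simp: mult.commute indicator_def cong: if_cong)

text \<open>
  Finitely many charts cover a neighbourhood of the frontier, and a number \<open>\<delta>\<close> is chosen so that every pair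
  of points with distance below \<open>\<delta>\<close>, the first of them \<open>\<delta>\<close>-close to the frontier, lies in one chart. On all other
  pairs \<open>trace_kernel_le_tau\<close> separates the variables and reduces the double integral to the single one. Far away from
  the frontier \<open>\<tau>\<close> itself is bounded by \<open>1 - s\<close> times the Gagliardo kernel, so comparing \<open>u x\<close> with all
  values in \<open>\<Omega>\<close> suffices.
\<close>

proposition trace_estimate:
  fixes \<Omega> :: "'a::euclidean_space set"
  assumes C11: "C11_domain \<Omega>" and bnd: "bounded \<Omega>" and s0: "0 < s0"
  obtains C where "0 < C" "\<And>s u. s0 \<le> s \<Longrightarrow> s < 1 \<Longrightarrow> u \<in> borel_measurable borel \<Longrightarrow>
    T_sqnorm \<Omega> s u \<le> ennreal C * (cross_energy \<Omega> s u + sq_integral \<Omega> u)"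
proof (cases "\<Omega> = {}")
  case True
  then have "T_sqnorm \<Omega> s u = 0" if "0 < s" for s u
    using that by (simp add: T_sqnorm_eq tau_def trace_kernel_def bdist_def infdist_def)
  then show thesis using s0 by (intro that[of 1]) auto
next
  case False
  have o: "open \<Omega>" using C11 unfolding C11_domain_def by auto
  then have [measurable]: "\<Omega> \<in> sets borel" by simp
  have fr: "compact (frontier \<Omega>)" using bnd by (simp add: compact_frontier_bounded)
  have fr0: "frontier \<Omega> \<noteq> {}" using False bnd not_bounded_UNIV by (auto simp: frontier_eq_empty)
  obtain \<rho> C where \<rho>C: "\<And>z. z \<in> frontier \<Omega> \<Longrightarrow> 0 < \<rho> z \<and> 0 \<le> C z \<and> local_trace \<Omega> s0 z (\<rho> z) (C z)"
    using local_trace_exists[OF C11 _ s0] by metis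
  have "frontier \<Omega> \<subseteq> (\<Union>z\<in>frontier \<Omega>. ball z (\<rho> z / 2))" using \<rho>C by force
  then obtain Z where Z: "Z \<subseteq> frontier \<Omega>" "finite Z" "frontier \<Omega> \<subseteq> (\<Union>z\<in>Z. ball z (\<rho> z / 2))"
    using fr by (metis (no_types, lifting) compactE_image open_ball)
  have Z0: "Z \<noteq> {}" using Z fr0 by auto
  define \<delta> where "\<delta> = Min (\<rho> ` Z) / 4"
  have \<delta>: "0 < \<delta>" "\<And>z. z \<in> Z \<Longrightarrow> \<delta> \<le> \<rho> z / 4" using Z Z0 \<rho>C by (auto simp: \<delta>_def)
  have near: "\<exists>z\<in>Z. x \<in> ball z (\<rho> z) \<and> (norm (x - y) < \<delta> \<longrightarrow> y \<in> ball z (\<rho> z))" if x: "bdist \<Omega> x < \<delta>" for x y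
  proof -
    obtain f where f: "f \<in> frontier \<Omega>" "bdist \<Omega> x = dist x f"
      using infdist_attains_inf[of "frontier \<Omega>" x] fr0 by (auto simp: bdist_def)
    then obtain z where z: "z \<in> Z" "dist z f < \<rho> z / 2" using Z(3) by auto
    have zx: "dist z x < \<rho> z / 2 + \<rho> z / 4"
      using dist_triangle[of z x f] z x f \<delta>(2)[of z] by (simp add: dist_commute)
    have zy: "dist z y \<le> dist z x + norm (x - y)" using dist_triangle[of z y x] by (simp add: dist_norm)
    have "dist z x < \<rho> z" using zx z zero_le_dist[of z f] by linarith
    then show ?thesis using z zx zy \<delta>(2)[of z] by (intro bexI[of _ z]) auto
  qed
  define m where "m = measure lborel \<Omega>"
  have fin: "emeasure lborel \<Omega> = ennreal m"
    using emeasure_bounded_finite[OF bnd] by (simp add: emeasure_eq_ennreal_measure m_def)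
  then have m: "0 < m" using open_pos_measure[OF o False] by (auto simp: m_def zero_less_measure_iff)
  obtain B where B: "0 < B" "\<And>x. x \<in> closure \<Omega> \<Longrightarrow> norm x \<le> B"
    using bnd by (meson bounded_closure bounded_pos)
  have bdist_attained: "\<exists>f\<in>frontier \<Omega>. bdist \<Omega> x = norm (x - f)" for x
    using infdist_attains_inf[of "frontier \<Omega>" x] fr0 by (auto simp: bdist_def dist_norm)
  have fr_cl: "frontier \<Omega> \<subseteq> closure \<Omega>" by (auto simp: frontier_def)
  have norm_le: "norm x \<le> bdist \<Omega> x + B" for x
  proof -
    obtain f where f: "f \<in> frontier \<Omega>" "bdist \<Omega> x = norm (x - f)" using bdist_attained by blast
    then show ?thesis using B(2)[of f] fr_cl norm_triangle_sub[of x f] by auto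
  qed
  have dist_le: "norm (x - y) \<le> bdist \<Omega> x + 2 * B" if "y \<in> \<Omega>" for x y
    using norm_triangle_ineq4[of x y] norm_le[of x] B(2)[of y] that closure_subset[of \<Omega>] by auto
  define Cs where "Cs = sum C Z"
  have Cs: "0 \<le> Cs" using Z \<rho>C unfolding Cs_def by (intro sum_nonneg) auto
  define near where "near = {x. bdist \<Omega> x < \<delta>}"
  have [measurable]: "near \<in> sets borel" unfolding near_def by measurable
  define J where "J = (\<integral>\<^sup>+x. ennreal ((1 + norm (x::'a)) powr (- (real DIM('a) + s0))) \<partial>lborel)"
  have J: "J < \<infinity>" unfolding J_def by (rule nn_integral_decay_finite[OF s0])
  define K1 where "K1 = max 1 (1 / \<delta>) * (1 + B) powr (real DIM('a) + 1)"
  have K1: "0 < K1" unfolding K1_def using B(1) by (intro mult_pos_pos) auto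
  define Ct where "Ct = Cs + K1 * enn2real J"
  have Ct: "0 \<le> Ct" using Cs K1 by (simp add: Ct_def)
  define \<kappa> where "\<kappa> = 1 + 2 * B / \<delta>"
  have \<kappa>: "1 \<le> \<kappa>" using B \<delta> by (simp add: \<kappa>_def)
  define C1 where "C1 = Cs + 2 / m * (\<kappa> powr (real DIM('a) + 2) + Ct)"
  have C1: "0 \<le> C1" using Cs m Ct by (simp add: C1_def)
  define K2 where "K2 = (1 + 1 / \<delta>) ^ DIM('a)"
  have K2: "0 < K2" using \<delta> by (simp add: K2_def add_pos_pos)
  define C2 where "C2 = Cs + 4 * K2 * Ct * C1"
  have C2: "0 \<le> C2" using Cs K2 Ct C1 by (simp add: C2_def)
  show thesis
  proof (rule that[of "C1 + C2 + 1"])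
    show "0 < C1 + C2 + 1" using C1 C2 by simp
    fix s and u :: "'a \<Rightarrow> real"
    assume s: "s0 \<le> s" "s < 1" and [measurable]: "u \<in> borel_measurable borel"
    have s': "0 < s" using s s0 by simp
    define U where "U = sq_integral \<Omega> u"
    define E where "E = cross_energy \<Omega> s u"
    have loc: "local_trace \<Omega> s0 z (\<rho> z) (C z)" "0 \<le> C z" if "z \<in> Z" for z using \<rho>C Z that by auto
    have loc1: "(\<integral>\<^sup>+x. indicator (ball z (\<rho> z) - \<Omega>) x * ennreal (layer_weight \<Omega> s x) \<partial>lborel) \<le> ennreal (C z)"
      and loc2: "(\<integral>\<^sup>+x. indicator (ball z (\<rho> z) - \<Omega>) x * ennreal ((u x)\<^sup>2 * (layer_weight \<Omega> s x)) \<partial>lborel) \<le> ennreal (C z) * (E + U)"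
      and loc3: "exterior_energy \<Omega> s (ball z (\<rho> z) - \<Omega>) u \<le> ennreal (C z) * (E + U)"
      if "z \<in> Z" for z
      using loc(1)[OF that, unfolded local_trace_def, rule_format, of s u] s unfolding E_def U_def by auto
    have sumC: "(\<Sum>z\<in>Z. ennreal (C z) * c) = ennreal Cs * c" for c
      unfolding Cs_def using loc by (simp add: sum_distrib_right[symmetric] sum_ennreal)
    have tau_pos: "0 \<le> tau \<Omega> s x" for x using tau_nonneg s by blast
    have near_split: "(\<integral>\<^sup>+x. indicator (- \<Omega>) x * (indicator near x * ennreal (f x * tau \<Omega> s x)) \<partial>lborel) \<le>
       (\<Sum>z\<in>Z. \<integral>\<^sup>+x. indicator (ball z (\<rho> z) - \<Omega>) x * ennreal (f x * (layer_weight \<Omega> s x)) \<partial>lborel)"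
      if [measurable]: "f \<in> borel_measurable borel" and f: "\<And>x. 0 \<le> f x" for f :: "'a \<Rightarrow> real"
    proof -
      have "(\<integral>\<^sup>+x. indicator (- \<Omega>) x * (indicator near x * ennreal (f x * tau \<Omega> s x)) \<partial>lborel) \<le>
        (\<integral>\<^sup>+x. (\<Sum>z\<in>Z. indicator (ball z (\<rho> z) - \<Omega>) x * ennreal (f x * (layer_weight \<Omega> s x))) \<partial>lborel)"
      proof (intro nn_integral_mono)
        fix x
        show "indicator (- \<Omega>) x * (indicator near x * ennreal (f x * tau \<Omega> s x)) \<le>
          (\<Sum>z\<in>Z. indicator (ball z (\<rho> z) - \<Omega>) x * ennreal (f x * (layer_weight \<Omega> s x)))"
        proof (cases "x \<in> near - \<Omega>")
          case True
          then obtain z where z: "z \<in> Z" "x \<in> ball z (\<rho> z)" using near[of x x] by (auto simp: near_def)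
          have "indicator (- \<Omega>) x * (indicator near x * ennreal (f x * tau \<Omega> s x)) \<le> indicator (ball z (\<rho> z) - \<Omega>) x * ennreal (f x * (layer_weight \<Omega> s x))"
            using True z by (auto intro!: ennreal_leI mult_left_mono tau_le_layer s' s f)
          also have "\<dots> \<le> (\<Sum>z\<in>Z. indicator (ball z (\<rho> z) - \<Omega>) x * ennreal (f x * (layer_weight \<Omega> s x)))"
            using z Z by (intro member_le_sum) auto
          finally show ?thesis .
        qed auto
      qed
      also have "\<dots> = (\<Sum>z\<in>Z. \<integral>\<^sup>+x. indicator (ball z (\<rho> z) - \<Omega>) x * ennreal (f x * (layer_weight \<Omega> s x)) \<partial>lborel)"
        by (rule nn_integral_sum) measurable
      finally show ?thesis .
    qed
    have split: "(\<integral>\<^sup>+x. indicator (- \<Omega>) x * f x \<partial>lborel) = (\<integral>\<^sup>+x. indicator (- \<Omega>) x * (indicator near x * f x) \<partial>lborel) +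
       (\<integral>\<^sup>+x. indicator (- \<Omega>) x * (indicator (- near) x * f x) \<partial>lborel)"
      if [measurable]: "f \<in> borel_measurable borel" for f :: "'a \<Rightarrow> ennreal"
      by (subst nn_integral_add[symmetric]) (auto intro!: nn_integral_cong simp: indicator_def)
    have tau_int: "(\<integral>\<^sup>+x. indicator (- \<Omega>) x * ennreal (tau \<Omega> s x) \<partial>lborel) \<le> ennreal Ct"
    proof -
      have "(\<integral>\<^sup>+x. indicator (- \<Omega>) x * (indicator near x * ennreal (1 * tau \<Omega> s x)) \<partial>lborel) \<le>
        (\<Sum>z\<in>Z. \<integral>\<^sup>+x. indicator (ball z (\<rho> z) - \<Omega>) x * ennreal (1 * (layer_weight \<Omega> s x)) \<partial>lborel)"
        by (rule near_split) auto
      also have "\<dots> \<le> (\<Sum>z\<in>Z. ennreal (C z) * 1)"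
        using loc1 by (intro sum_mono) simp
      also have "\<dots> = ennreal Cs" unfolding sumC by simp
      finally have 1: "(\<integral>\<^sup>+x. indicator (- \<Omega>) x * (indicator near x * ennreal (tau \<Omega> s x)) \<partial>lborel) \<le> ennreal Cs" by simp
      have "(\<integral>\<^sup>+x. indicator (- \<Omega>) x * (indicator (- near) x * ennreal (tau \<Omega> s x)) \<partial>lborel) \<le>
        (\<integral>\<^sup>+x. ennreal K1 * ennreal ((1 + norm (x::'a)) powr (- (real DIM('a) + s0))) \<partial>lborel)"
      proof (intro nn_integral_mono)
        fix x
        have "tau \<Omega> s x \<le> K1 * (1 + norm x) powr (- (real DIM('a) + s0))" if far: "\<delta> \<le> bdist \<Omega> x"
        proof -
          have b: "0 < bdist \<Omega> x" using far \<delta> by linarith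
          have "bdist \<Omega> x powr (- s) \<le> \<delta> powr (- s)" using far \<delta> s' by (intro powr_mono2') auto
          also have "\<delta> powr (- s) = (1 / \<delta>) powr s" using \<delta> by (simp add: powr_minus powr_divide inverse_eq_divide)
          also have "(1 / \<delta>) powr s \<le> max 1 (1 / \<delta>) powr s" using \<delta> s' by (intro powr_mono2) auto
          also have "\<dots> \<le> max 1 (1 / \<delta>) powr 1" using s by (intro powr_mono) auto
          finally have a1: "bdist \<Omega> x powr (- s) \<le> max 1 (1 / \<delta>)" by (simp add: max_def split: if_splits)
          have "1 + norm x \<le> (1 + B) * (1 + bdist \<Omega> x)"
          proof -
            have "0 \<le> B * bdist \<Omega> x" using B(1) by simp
            then show ?thesis using norm_le[of x] unfolding distrib_left distrib_right by simp
          qed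
          then have "(1 + norm x) / (1 + B) \<le> 1 + bdist \<Omega> x" using B(1) by (simp add: pos_divide_le_eq mult.commute)
          then have "(1 + bdist \<Omega> x) powr (- (real DIM('a) + s0)) \<le> ((1 + norm x) / (1 + B)) powr (- (real DIM('a) + s0))"
            using B(1) s0 by (intro powr_mono2') (auto simp: add_pos_nonneg)
          also have "\<dots> = (1 + norm x) powr (- (real DIM('a) + s0)) * (1 + B) powr (real DIM('a) + s0)"
            using B(1) by (subst powr_divide_minus) auto
          also have "\<dots> \<le> (1 + norm x) powr (- (real DIM('a) + s0)) * (1 + B) powr (real DIM('a) + 1)"
            using B(1) s by (intro mult_left_mono powr_mono) auto
          finally have a2: "(1 + bdist \<Omega> x) powr (- (real DIM('a) + s0)) \<le> (1 + norm x) powr (- (real DIM('a) + s0)) * (1 + B) powr (real DIM('a) + 1)" .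
          have a3: "(1 + bdist \<Omega> x) powr (- (real DIM('a) + s)) \<le> (1 + bdist \<Omega> x) powr (- (real DIM('a) + s0))"
            using s by (intro powr_mono) auto
          have "tau \<Omega> s x \<le> 1 * (bdist \<Omega> x powr (- s) * (1 + bdist \<Omega> x) powr (- (real DIM('a) + s)))"
            unfolding tau_eq using s' by (intro mult_right_mono) auto
          also have "\<dots> \<le> 1 * (max 1 (1 / \<delta>) * ((1 + norm x) powr (- (real DIM('a) + s0)) * (1 + B) powr (real DIM('a) + 1)))"
            by (intro mult_left_mono mult_mono a1 order_trans[OF a3 a2]) auto
          finally show ?thesis by (simp add: K1_def mult_ac)
        qed
        then show "indicator (- \<Omega>) x * (indicator (- near) x * ennreal (tau \<Omega> s x)) \<le> ennreal K1 * ennreal ((1 + norm x) powr (- (real DIM('a) + s0)))"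
          using K1 by (auto simp: indicator_def near_def ennreal_mult[symmetric] intro!: ennreal_leI)
      qed
      also have "\<dots> = ennreal K1 * J" unfolding J_def by (simp add: nn_integral_cmult)
      also have "\<dots> = ennreal (K1 * enn2real J)" using J K1 by (simp add: ennreal_mult)
      finally have 2: "(\<integral>\<^sup>+x. indicator (- \<Omega>) x * (indicator (- near) x * ennreal (tau \<Omega> s x)) \<partial>lborel) \<le> ennreal (K1 * enn2real J)" .
      have "(\<integral>\<^sup>+x. indicator (- \<Omega>) x * ennreal (tau \<Omega> s x) \<partial>lborel) \<le> ennreal Cs + ennreal (K1 * enn2real J)"
        by (subst split) (auto intro: add_mono 1 2)
      also have "\<dots> = ennreal Ct" unfolding Ct_def using Cs K1 by simp
      finally show ?thesis .
    qed
    have single: "(\<integral>\<^sup>+x. indicator (- \<Omega>) x * ennreal ((u x)\<^sup>2 * tau \<Omega> s x) \<partial>lborel) \<le> ennreal C1 * (E + U)"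
    proof -
      have "(\<integral>\<^sup>+x. indicator (- \<Omega>) x * (indicator near x * ennreal ((u x)\<^sup>2 * tau \<Omega> s x)) \<partial>lborel) \<le>
        (\<Sum>z\<in>Z. \<integral>\<^sup>+x. indicator (ball z (\<rho> z) - \<Omega>) x * ennreal ((u x)\<^sup>2 * (layer_weight \<Omega> s x)) \<partial>lborel)"
        by (rule near_split) auto
      also have "\<dots> \<le> (\<Sum>z\<in>Z. ennreal (C z) * (E + U))"
        by (intro sum_mono loc2)
      finally have 1: "(\<integral>\<^sup>+x. indicator (- \<Omega>) x * (indicator near x * ennreal ((u x)\<^sup>2 * tau \<Omega> s x)) \<partial>lborel) \<le> ennreal Cs * (E + U)"
        unfolding sumC .
      define D where "D x = (\<integral>\<^sup>+y. indicator \<Omega> y * ennreal ((1 - s) * ((u x - u y)\<^sup>2 * gagliardo_kernel s (x - y))) \<partial>lborel)" for x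
      have [measurable]: "D \<in> borel_measurable borel" unfolding D_def by measurable
      have D: "(\<integral>\<^sup>+x. D x \<partial>lborel) = E"
      proof -
        have "E = ennreal (1 - s) * (\<integral>\<^sup>+y. \<integral>\<^sup>+x. indicator \<Omega> x * ennreal ((u x - u y)\<^sup>2 * gagliardo_kernel s (x - y)) \<partial>lborel \<partial>lborel)"
          unfolding E_def cross_energy_def by (subst lborel_swap) auto
        also have "\<dots> = (\<integral>\<^sup>+y. \<integral>\<^sup>+x. ennreal (1 - s) * (indicator \<Omega> x * ennreal ((u x - u y)\<^sup>2 * gagliardo_kernel s (x - y))) \<partial>lborel \<partial>lborel)"
          by (simp add: nn_integral_cmult)
        also have "\<dots> = (\<integral>\<^sup>+x. D x \<partial>lborel)"
          unfolding D_def using s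
          by (intro nn_integral_cong) (auto simp: indicator_def ennreal_mult power2_commute norm_minus_commute)
        finally show ?thesis ..
      qed
      have far: "indicator (- \<Omega>) x * (indicator (- near) x * ennreal ((u x)\<^sup>2 * tau \<Omega> s x)) \<le>
         ennreal (2 / m) * (ennreal (\<kappa> powr (real DIM('a) + 2)) * D x + U * (indicator (- \<Omega>) x * ennreal (tau \<Omega> s x)))" for x
      proof (cases "x \<in> \<Omega> \<or> x \<in> near")
        case True
        then show ?thesis by auto
      next
        case False
        then have b: "\<delta> \<le> bdist \<Omega> x" by (simp add: near_def)
        have bp: "0 < bdist \<Omega> x" using b \<delta> by linarith
        have ker: "tau \<Omega> s x \<le> \<kappa> powr (real DIM('a) + 2) * ((1 - s) * gagliardo_kernel s (x - y))" if y: "y \<in> \<Omega>" for y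
        proof -
          have xy: "0 < norm (x - y)" using y False by auto
          have "2 * B \<le> 2 * B / \<delta> * bdist \<Omega> x" using b \<delta> B(1) by (simp add: field_simps)
          then have "norm (x - y) \<le> \<kappa> * bdist \<Omega> x" using dist_le[OF y, of x] by (simp add: \<kappa>_def algebra_simps)
          then have "norm (x - y) / \<kappa> \<le> bdist \<Omega> x" using \<kappa> by (simp add: field_simps)
          then have "bdist \<Omega> x powr (- (real DIM('a) + 2 * s)) \<le> (norm (x - y) / \<kappa>) powr (- (real DIM('a) + 2 * s))"
            using xy \<kappa> s' by (intro powr_mono2') auto
          also have "\<dots> = \<kappa> powr (real DIM('a) + 2 * s) * gagliardo_kernel s (x - y)"
            using \<kappa> by (intro powr_divide_minus) auto
          also have "\<dots> \<le> \<kappa> powr (real DIM('a) + 2) * gagliardo_kernel s (x - y)"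
            using \<kappa> s by (intro mult_right_mono powr_mono) auto
          finally have a1: "bdist \<Omega> x powr (- (real DIM('a) + 2 * s)) \<le> \<kappa> powr (real DIM('a) + 2) * gagliardo_kernel s (x - y)" .
          have "(1 + bdist \<Omega> x) powr (- (real DIM('a) + s)) \<le> bdist \<Omega> x powr (- (real DIM('a) + s))"
            using bp s' by (intro powr_mono2') auto
          then have "tau \<Omega> s x \<le> (1 - s) * (bdist \<Omega> x powr (- s) * bdist \<Omega> x powr (- (real DIM('a) + s)))"
            unfolding tau_eq using s by (intro mult_left_mono) auto
          also have "bdist \<Omega> x powr (- s) * bdist \<Omega> x powr (- (real DIM('a) + s)) = bdist \<Omega> x powr (- (real DIM('a) + 2 * s))"
          proof -
            have "- s + - (real DIM('a) + s) = - (real DIM('a) + 2 * s)" by simp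
            then show ?thesis by (simp only: powr_add[symmetric])
          qed
          also have "(1 - s) * bdist \<Omega> x powr (- (real DIM('a) + 2 * s)) \<le> (1 - s) * (\<kappa> powr (real DIM('a) + 2) * gagliardo_kernel s (x - y))"
            using s by (intro mult_left_mono a1) auto
          finally show ?thesis by (simp add: mult_ac)
        qed
        have "ennreal ((u x)\<^sup>2) * ennreal m = ennreal ((u x - 0)\<^sup>2) * emeasure lborel \<Omega>" by (simp add: fin)
        also have "\<dots> \<le> 2 * (\<integral>\<^sup>+w. indicator \<Omega> w * ennreal ((u x - u w)\<^sup>2) \<partial>lborel) + 2 * (\<integral>\<^sup>+w. indicator \<Omega> w * ennreal ((0 - u w)\<^sup>2) \<partial>lborel)"
          by (rule averaging) auto
        also have "\<dots> = 2 * ((\<integral>\<^sup>+w. indicator \<Omega> w * ennreal ((u x - u w)\<^sup>2) \<partial>lborel) + U)"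
          by (simp add: U_def distrib_left)
        finally have avg: "ennreal ((u x)\<^sup>2) * ennreal m \<le> 2 * ((\<integral>\<^sup>+w. indicator \<Omega> w * ennreal ((u x - u w)\<^sup>2) \<partial>lborel) + U)" .
        have "ennreal ((u x)\<^sup>2 * tau \<Omega> s x) = ennreal (tau \<Omega> s x / m) * (ennreal ((u x)\<^sup>2) * ennreal m)"
          using m tau_pos by (simp add: ennreal_mult[symmetric])
        also have "\<dots> \<le> ennreal (tau \<Omega> s x / m) * (2 * ((\<integral>\<^sup>+w. indicator \<Omega> w * ennreal ((u x - u w)\<^sup>2) \<partial>lborel) + U))"
          by (intro mult_left_mono avg) simp
        also have "\<dots> = ennreal (2 / m) * (ennreal (tau \<Omega> s x) * ((\<integral>\<^sup>+w. indicator \<Omega> w * ennreal ((u x - u w)\<^sup>2) \<partial>lborel) + U))"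
        proof -
          have "ennreal (tau \<Omega> s x / m) * 2 = ennreal (tau \<Omega> s x / m) * ennreal 2" by simp
          also have "\<dots> = ennreal (2 / m * tau \<Omega> s x)" using m tau_pos by (subst ennreal_mult[symmetric]) (auto simp: mult_ac)
          also have "\<dots> = ennreal (2 / m) * ennreal (tau \<Omega> s x)" using m tau_pos by (intro ennreal_mult) auto
          finally show ?thesis by (simp only: mult.assoc[symmetric])
        qed
        also have "ennreal (tau \<Omega> s x) * ((\<integral>\<^sup>+w. indicator \<Omega> w * ennreal ((u x - u w)\<^sup>2) \<partial>lborel) + U) =
          (\<integral>\<^sup>+w. ennreal (tau \<Omega> s x) * (indicator \<Omega> w * ennreal ((u x - u w)\<^sup>2)) \<partial>lborel) + U * ennreal (tau \<Omega> s x)"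
          by (simp add: distrib_left nn_integral_cmult mult.commute)
        also have "\<dots> \<le> ennreal (\<kappa> powr (real DIM('a) + 2)) * D x + U * ennreal (tau \<Omega> s x)"
        proof (intro add_right_mono)
          have "(\<integral>\<^sup>+w. ennreal (tau \<Omega> s x) * (indicator \<Omega> w * ennreal ((u x - u w)\<^sup>2)) \<partial>lborel) \<le>
            (\<integral>\<^sup>+w. ennreal (\<kappa> powr (real DIM('a) + 2)) * (indicator \<Omega> w * ennreal ((1 - s) * ((u x - u w)\<^sup>2 * gagliardo_kernel s (x - w)))) \<partial>lborel)"
          proof (intro nn_integral_mono)
            fix w
            show "ennreal (tau \<Omega> s x) * (indicator \<Omega> w * ennreal ((u x - u w)\<^sup>2)) \<le>
              ennreal (\<kappa> powr (real DIM('a) + 2)) * (indicator \<Omega> w * ennreal ((1 - s) * ((u x - u w)\<^sup>2 * gagliardo_kernel s (x - w))))"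
            proof (cases "w \<in> \<Omega>")
              case True
              have "tau \<Omega> s x * (u x - u w)\<^sup>2 \<le> \<kappa> powr (real DIM('a) + 2) * ((1 - s) * gagliardo_kernel s (x - w)) * (u x - u w)\<^sup>2"
                by (intro mult_right_mono ker True) auto
              then show ?thesis using True tau_pos s
                by (simp add: ennreal_mult[symmetric] ennreal_leI mult_ac)
            qed simp
          qed
          also have "\<dots> = ennreal (\<kappa> powr (real DIM('a) + 2)) * D x" unfolding D_def by (simp add: nn_integral_cmult)
          finally show "(\<integral>\<^sup>+w. ennreal (tau \<Omega> s x) * (indicator \<Omega> w * ennreal ((u x - u w)\<^sup>2)) \<partial>lborel) \<le> ennreal (\<kappa> powr (real DIM('a) + 2)) * D x" .
        qed
        finally show ?thesis using False by (simp add: mult_left_mono)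
      qed
      have "(\<integral>\<^sup>+x. indicator (- \<Omega>) x * (indicator (- near) x * ennreal ((u x)\<^sup>2 * tau \<Omega> s x)) \<partial>lborel) \<le>
        (\<integral>\<^sup>+x. ennreal (2 / m) * (ennreal (\<kappa> powr (real DIM('a) + 2)) * D x + U * (indicator (- \<Omega>) x * ennreal (tau \<Omega> s x))) \<partial>lborel)"
        by (intro nn_integral_mono far)
      also have "\<dots> = ennreal (2 / m) * (ennreal (\<kappa> powr (real DIM('a) + 2)) * E + U * (\<integral>\<^sup>+x. indicator (- \<Omega>) x * ennreal (tau \<Omega> s x) \<partial>lborel))"
        unfolding D[symmetric] by (simp add: nn_integral_cmult nn_integral_add)
      also have "\<dots> \<le> ennreal (2 / m) * (ennreal (\<kappa> powr (real DIM('a) + 2)) * E + U * ennreal Ct)"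
        by (intro mult_left_mono add_left_mono tau_int) auto
      also have "\<dots> \<le> ennreal (2 / m) * (ennreal (\<kappa> powr (real DIM('a) + 2) + Ct) * (E + U))"
      proof (intro mult_left_mono)
        have "ennreal (\<kappa> powr (real DIM('a) + 2)) * E \<le> ennreal (\<kappa> powr (real DIM('a) + 2) + Ct) * E"
          using Ct by (intro mult_right_mono ennreal_leI) auto
        moreover have "U * ennreal Ct \<le> ennreal (\<kappa> powr (real DIM('a) + 2) + Ct) * U"
          by (subst mult.commute) (intro mult_right_mono ennreal_leI, auto)
        ultimately show "ennreal (\<kappa> powr (real DIM('a) + 2)) * E + U * ennreal Ct \<le> ennreal (\<kappa> powr (real DIM('a) + 2) + Ct) * (E + U)"
          unfolding distrib_left by (rule add_mono)
      qed simp
      also have "\<dots> = ennreal (2 / m * (\<kappa> powr (real DIM('a) + 2) + Ct)) * (E + U)"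
      proof -
        have "ennreal (2 / m * (\<kappa> powr (real DIM('a) + 2) + Ct)) = ennreal (2 / m) * ennreal (\<kappa> powr (real DIM('a) + 2) + Ct)"
          using m Ct by (intro ennreal_mult) auto
        then show ?thesis by (simp only: mult.assoc)
      qed
      finally have 2: "(\<integral>\<^sup>+x. indicator (- \<Omega>) x * (indicator (- near) x * ennreal ((u x)\<^sup>2 * tau \<Omega> s x)) \<partial>lborel) \<le>
         ennreal (2 / m * (\<kappa> powr (real DIM('a) + 2) + Ct)) * (E + U)" .
      have "(\<integral>\<^sup>+x. indicator (- \<Omega>) x * ennreal ((u x)\<^sup>2 * tau \<Omega> s x) \<partial>lborel) \<le>
        ennreal Cs * (E + U) + ennreal (2 / m * (\<kappa> powr (real DIM('a) + 2) + Ct)) * (E + U)"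
        by (subst split) (measurable, intro add_mono 1 2)
      also have "\<dots> = (ennreal Cs + ennreal (2 / m * (\<kappa> powr (real DIM('a) + 2) + Ct))) * (E + U)" by (simp only: distrib_right)
      also have "ennreal Cs + ennreal (2 / m * (\<kappa> powr (real DIM('a) + 2) + Ct)) = ennreal C1"
        unfolding C1_def using Cs m Ct by (intro ennreal_plus[symmetric]) auto
      finally show ?thesis .
    qed
    have double: "exterior_energy \<Omega> s (- \<Omega>) u
       \<le> ennreal C2 * (E + U)"
    proof -
      define t where "t x = indicator (- \<Omega>) x * ennreal (tau \<Omega> s x)" for x
      define q where "q x = indicator (- \<Omega>) x * ennreal ((u x)\<^sup>2 * tau \<Omega> s x)" for x
      have [measurable]: "t \<in> borel_measurable borel" "q \<in> borel_measurable borel" unfolding t_def q_def by measurable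
      have pt: "indicator (- \<Omega>) x * (indicator (- \<Omega>) y * ennreal ((u x - u y)\<^sup>2 * trace_kernel \<Omega> s x y)) \<le>
        (\<Sum>z\<in>Z. indicator (ball z (\<rho> z) - \<Omega>) x * (indicator (ball z (\<rho> z) - \<Omega>) y * ennreal ((u x - u y)\<^sup>2 * trace_kernel \<Omega> s x y))) +
        ennreal (2 * K2) * (q x * t y + t x * q y)" for x y
      proof (cases "x \<in> \<Omega> \<or> y \<in> \<Omega>")
        case True
        then show ?thesis by auto
      next
        case out: False
        show ?thesis
        proof (cases "bdist \<Omega> x < \<delta> \<and> norm (x - y) < \<delta>")
          case True
          then obtain z where z: "z \<in> Z" "x \<in> ball z (\<rho> z)" "y \<in> ball z (\<rho> z)" using near[of x y] by auto
          have "indicator (- \<Omega>) x * (indicator (- \<Omega>) y * ennreal ((u x - u y)\<^sup>2 * trace_kernel \<Omega> s x y)) =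
            indicator (ball z (\<rho> z) - \<Omega>) x * (indicator (ball z (\<rho> z) - \<Omega>) y * ennreal ((u x - u y)\<^sup>2 * trace_kernel \<Omega> s x y))"
            using z out by simp
          also have "\<dots> \<le> (\<Sum>z\<in>Z. indicator (ball z (\<rho> z) - \<Omega>) x * (indicator (ball z (\<rho> z) - \<Omega>) y * ennreal ((u x - u y)\<^sup>2 * trace_kernel \<Omega> s x y)))"
            using z Z by (intro member_le_sum[of z Z "\<lambda>z. indicator (ball z (\<rho> z) - \<Omega>) x * (indicator (ball z (\<rho> z) - \<Omega>) y * ennreal ((u x - u y)\<^sup>2 * trace_kernel \<Omega> s x y))"]) auto
          finally show ?thesis by (rule order_trans) simp
        next
          case False
          have "\<delta> \<le> norm (x - y) + bdist \<Omega> x + bdist \<Omega> y"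
            using False bdist_nonneg[of \<Omega> x] bdist_nonneg[of \<Omega> y] norm_ge_zero[of "x - y"] by linarith
          then have k: "trace_kernel \<Omega> s x y \<le> K2 * (tau \<Omega> s x * tau \<Omega> s y)"
            unfolding K2_def by (intro trace_kernel_le_tau \<delta> s)
          have sq: "(u x - u y)\<^sup>2 \<le> 2 * (u x)\<^sup>2 + 2 * (u y)\<^sup>2"
          proof -
            have "0 \<le> (u x + u y)\<^sup>2" by simp
            then show ?thesis by (simp add: power2_eq_square algebra_simps)
          qed
          have "(u x - u y)\<^sup>2 * trace_kernel \<Omega> s x y \<le> (2 * (u x)\<^sup>2 + 2 * (u y)\<^sup>2) * (K2 * (tau \<Omega> s x * tau \<Omega> s y))"
            by (intro mult_mono sq k) (auto intro: trace_kernel_nonneg)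
          also have "\<dots> = 2 * K2 * (((u x)\<^sup>2 * tau \<Omega> s x) * tau \<Omega> s y + tau \<Omega> s x * ((u y)\<^sup>2 * tau \<Omega> s y))"
            by (simp add: algebra_simps)
          finally have "ennreal ((u x - u y)\<^sup>2 * trace_kernel \<Omega> s x y) \<le> ennreal (2 * K2 * (((u x)\<^sup>2 * tau \<Omega> s x) * tau \<Omega> s y + tau \<Omega> s x * ((u y)\<^sup>2 * tau \<Omega> s y)))"
            by (rule ennreal_leI)
          also have "\<dots> = ennreal (2 * K2) * (ennreal ((u x)\<^sup>2 * tau \<Omega> s x) * ennreal (tau \<Omega> s y) + ennreal (tau \<Omega> s x) * ennreal ((u y)\<^sup>2 * tau \<Omega> s y))"
          proof -
            have *: "ennreal (c * (a1 * a2 + b1 * b2)) = ennreal c * (ennreal a1 * ennreal a2 + ennreal b1 * ennreal b2)"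
              if "0 \<le> c" "0 \<le> a1" "0 \<le> a2" "0 \<le> b1" "0 \<le> b2" for c a1 a2 b1 b2
              using that by (simp add: ennreal_mult ennreal_plus)
            show ?thesis by (rule *) (use K2 tau_pos in auto)
          qed
          finally show ?thesis using out by (simp add: q_def t_def add_increasing)
        qed
      qed
      have "exterior_energy \<Omega> s (- \<Omega>) u \<le>
        (\<integral>\<^sup>+x. \<integral>\<^sup>+y. (\<Sum>z\<in>Z. indicator (ball z (\<rho> z) - \<Omega>) x * (indicator (ball z (\<rho> z) - \<Omega>) y * ennreal ((u x - u y)\<^sup>2 * trace_kernel \<Omega> s x y))) +
        ennreal (2 * K2) * (q x * t y + t x * q y) \<partial>lborel \<partial>lborel)"
        by (intro nn_integral_mono pt)
      also have "\<dots> = (\<Sum>z\<in>Z. exterior_energy \<Omega> s (ball z (\<rho> z) - \<Omega>) u) +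
        ennreal (2 * K2) * ((\<integral>\<^sup>+x. q x \<partial>lborel) * (\<integral>\<^sup>+y. t y \<partial>lborel) + (\<integral>\<^sup>+x. t x \<partial>lborel) * (\<integral>\<^sup>+y. q y \<partial>lborel))"
        by (simp add: nn_integral_add nn_integral_sum nn_integral_cmult nn_integral_multc)
      also have "\<dots> \<le> (\<Sum>z\<in>Z. ennreal (C z) * (E + U)) + ennreal (2 * K2) * ((ennreal C1 * (E + U)) * ennreal Ct + ennreal Ct * (ennreal C1 * (E + U)))"
      proof (intro add_mono sum_mono mult_left_mono mult_mono)
        show "(\<integral>\<^sup>+x. q x \<partial>lborel) \<le> ennreal C1 * (E + U)" unfolding q_def by (rule single)
        then show "(\<integral>\<^sup>+x. q x \<partial>lborel) \<le> ennreal C1 * (E + U)" .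
        show "(\<integral>\<^sup>+x. t x \<partial>lborel) \<le> ennreal Ct" unfolding t_def by (rule tau_int)
        then show "(\<integral>\<^sup>+x. t x \<partial>lborel) \<le> ennreal Ct" .
        show "exterior_energy \<Omega> s (ball z (\<rho> z) - \<Omega>) u \<le> ennreal (C z) * (E + U)"
          if "z \<in> Z" for z
          using that by (rule loc3)
      qed auto
      also have "\<dots> = (ennreal Cs + ennreal (2 * K2) * (ennreal C1 * ennreal Ct + ennreal C1 * ennreal Ct)) * (E + U)"
        unfolding sumC by (simp only: distrib_left distrib_right mult_ac)
      also have "ennreal Cs + ennreal (2 * K2) * (ennreal C1 * ennreal Ct + ennreal C1 * ennreal Ct) = ennreal C2"
      proof -
        have *: "ennreal (a + 2 * k * (c * t + c * t)) = ennreal a + ennreal (2 * k) * (ennreal c * ennreal t + ennreal c * ennreal t)"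
          if "0 \<le> a" "0 \<le> k" "0 \<le> c" "0 \<le> t" for a k c t
        proof -
          have "ennreal (a + 2 * k * (c * t + c * t)) = ennreal a + ennreal (2 * k) * ennreal (c * t + c * t)"
            using that by (subst ennreal_mult[symmetric]) (auto simp: ennreal_plus[symmetric] simp del: ennreal_plus)
          then show ?thesis using that by (simp only: ennreal_plus[OF mult_nonneg_nonneg mult_nonneg_nonneg] ennreal_mult)
        qed
        have "C2 = Cs + 2 * K2 * (C1 * Ct + C1 * Ct)" unfolding C2_def by (simp add: algebra_simps)
        then show ?thesis using *[of Cs K2 C1 Ct] Cs K2 C1 Ct by simp
      qed
      finally show ?thesis .
    qed
    have "T_sqnorm \<Omega> s u \<le> ennreal C1 * (E + U) + ennreal C2 * (E + U)"
      unfolding T_sqnorm_eq by (intro add_mono single double)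
    also have "\<dots> = ennreal (C1 + C2) * (E + U)" using C1 C2 by (simp add: distrib_right)
    also have "\<dots> \<le> ennreal (C1 + C2 + 1) * (E + U)" by (intro mult_right_mono ennreal_leI) auto
    finally show "T_sqnorm \<Omega> s u \<le> ennreal (C1 + C2 + 1) * (cross_energy \<Omega> s u + sq_integral \<Omega> u)"
      unfolding E_def U_def .
  qed
qed

section \<open>Minimisation of quadratic functionals and dual norms\<close>

text \<open>
  This covers the degenerate case \<open>c = 0\<close>, which occurs since the forms below are only semidefinite.
\<close>

lemma nonneg_quadratic_discriminant:
  fixes a b c :: real
  assumes "\<And>t. 0 \<le> a + 2 * b * t + c * t\<^sup>2" "0 \<le> c"
  shows "b\<^sup>2 \<le> a * c"
proof (cases "c = 0")
  case True
  have "b = 0"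
  proof (rule ccontr)
    assume "b \<noteq> 0"
    then show False using assms(1)[of "- (a + 1) / (2 * b)"] True by simp
  qed
  then show ?thesis using True by simp
next
  case False
  then have "0 < c" using assms(2) by simp
  have "0 \<le> (a + 2 * b * (- b / c) + c * (- b / c)\<^sup>2) * c" using assms(1)[of "- b / c"] \<open>0 < c\<close> by simp
  also have "\<dots> = a * c - b\<^sup>2" using \<open>0 < c\<close> by (simp add: power2_eq_square field_simps)
  finally show ?thesis by simp
qed

lemma tendsto_zero_if_sq_le:
  fixes f g :: "nat \<Rightarrow> real"
  assumes "\<And>n. (f n)\<^sup>2 \<le> g n" "g \<longlonglongrightarrow> 0"
  shows "f \<longlonglongrightarrow> 0"
proof -
  have "(\<lambda>n. (f n)\<^sup>2) \<longlonglongrightarrow> 0"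
    by (rule tendsto_sandwich[of "\<lambda>_. 0" _ sequentially g]) (use assms in auto)
  then show ?thesis by simp
qed

text \<open>
  The space is a set of functions with a semidefinite form, so the theorem is proved directly: the functional
  \<open>B u u - 2 * l u\<close> is bounded below, and by the parallelogram law two near minimisers are close. A near
  minimiser with error \<open>\<epsilon>\<close> satisfies the equation up to \<open>sqrt (\<epsilon> * B v v)\<close>, which passes to the limit. Completeness
  is only required for sequences that converge at a geometric rate.
\<close>

lemma riesz_representation_functions:
  fixes X :: "('a \<Rightarrow> real) set" and B :: "('a \<Rightarrow> real) \<Rightarrow> ('a \<Rightarrow> real) \<Rightarrow> real" and l :: "('a \<Rightarrow> real) \<Rightarrow> real"
  assumes X_zero: "(\<lambda>x. 0) \<in> X" and X_add: "\<And>u v. u \<in> X \<Longrightarrow> v \<in> X \<Longrightarrow> (\<lambda>x. u x + v x) \<in> X"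
    and X_scale: "\<And>c u. u \<in> X \<Longrightarrow> (\<lambda>x. c * u x) \<in> X"
    and B_sym: "\<And>u v. u \<in> X \<Longrightarrow> v \<in> X \<Longrightarrow> B u v = B v u"
    and B_add: "\<And>u v w. u \<in> X \<Longrightarrow> v \<in> X \<Longrightarrow> w \<in> X \<Longrightarrow> B (\<lambda>x. u x + v x) w = B u w + B v w"
    and B_scale: "\<And>c u w. u \<in> X \<Longrightarrow> w \<in> X \<Longrightarrow> B (\<lambda>x. c * u x) w = c * B u w"
    and B_pos: "\<And>u. u \<in> X \<Longrightarrow> 0 \<le> B u u"
    and l_add: "\<And>u v. u \<in> X \<Longrightarrow> v \<in> X \<Longrightarrow> l (\<lambda>x. u x + v x) = l u + l v"
    and l_scale: "\<And>c u. u \<in> X \<Longrightarrow> l (\<lambda>x. c * u x) = c * l u"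
    and l_bound: "\<And>u. u \<in> X \<Longrightarrow> \<bar>l u\<bar> \<le> K * sqrt (B u u)"
    and complete: "\<And>U. (\<And>n. U n \<in> X) \<Longrightarrow>
      (\<And>m n. n \<le> m \<Longrightarrow> B (\<lambda>x. U m x - U n x) (\<lambda>x. U m x - U n x) \<le> (1 / 16) ^ n) \<Longrightarrow>
      \<exists>u\<in>X. (\<lambda>n. B (\<lambda>x. U n x - u x) (\<lambda>x. U n x - u x)) \<longlonglongrightarrow> 0"
  shows "\<exists>u\<in>X. \<forall>v\<in>X. B u v = l v"
proof -
  have B_add': "B w (\<lambda>x. u x + v x) = B w u + B w v" if "u \<in> X" "v \<in> X" "w \<in> X" for u v w
    using that by (simp add: B_sym[of w] B_add X_add)
  have B_scale': "B w (\<lambda>x. c * u x) = c * B w u" if "u \<in> X" "w \<in> X" for c u w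
    using that by (simp add: B_sym[of w] B_scale X_scale)
  have lin: "(\<lambda>x. u x + t * v x) \<in> X" if "u \<in> X" "v \<in> X" for u v t
    using X_add[OF that(1) X_scale[OF that(2)]] .
  have diff: "(\<lambda>x. u x - v x) \<in> X" if "u \<in> X" "v \<in> X" for u v
    using lin[OF that, of "-1"] by simp
  have B_diff: "B (\<lambda>x. u x - v x) w = B u w - B v w" if "u \<in> X" "v \<in> X" "w \<in> X" for u v w
    using B_add[OF that(1) X_scale[OF that(2), of "-1"] that(3)] B_scale[OF that(2,3), of "-1"] by simp
  have B_expand: "B (\<lambda>x. u x + t * v x) (\<lambda>x. u x + t * v x) = B u u + 2 * B u v * t + B v v * t\<^sup>2"
    if "u \<in> X" "v \<in> X" for u v t
    using that by (simp add: B_add B_add' B_scale B_scale' X_scale lin B_sym[of v u] power2_eq_square algebra_simps)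
  have CS: "(B u v)\<^sup>2 \<le> B u u * B v v" if "u \<in> X" "v \<in> X" for u v
    using that by (intro nonneg_quadratic_discriminant) (auto simp: B_expand[symmetric] intro: B_pos lin)
  define J where "J u = B u u - 2 * l u" for u
  have J_expand: "J (\<lambda>x. u x + t * v x) = J u + 2 * (B u v - l v) * t + B v v * t\<^sup>2" if "u \<in> X" "v \<in> X" for u v t
    using that unfolding J_def by (simp add: B_expand l_add l_scale X_scale algebra_simps)
  have J_bdd: "- K\<^sup>2 \<le> J u" if "u \<in> X" for u
  proof -
    have "0 \<le> (sqrt (B u u) - K)\<^sup>2" by simp
    also have "\<dots> = B u u - 2 * (K * sqrt (B u u)) + K\<^sup>2"
      using B_pos[OF that] by (simp add: power2_diff)
    also have "\<dots> \<le> B u u - 2 * l u + K\<^sup>2" using l_bound[OF that] by linarith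
    finally show ?thesis by (simp add: J_def)
  qed
  define m where "m = (INF u\<in>X. J u)"
  have bb: "bdd_below (J ` X)" using J_bdd by (intro bdd_belowI[of _ "- K\<^sup>2"]) auto
  have m_le: "m \<le> J u" if "u \<in> X" for u unfolding m_def by (rule cINF_lower[OF bb that])
  \<comment> \<open>The errors are chosen so that \<open>4 * \<epsilon> n\<close> is the rate that completeness asks for.\<close>
  define \<epsilon> :: "nat \<Rightarrow> real" where "\<epsilon> n = (1 / 16) ^ n / 4" for n
  have "\<exists>u\<in>X. J u < m + \<epsilon> n" for n
  proof -
    have "m < m + \<epsilon> n" by (simp add: \<epsilon>_def)
    then show ?thesis unfolding m_def using cINF_less_iff[OF _ bb] X_zero by blast
  qed
  then obtain U where U: "\<And>n. U n \<in> X" "\<And>n. J (U n) < m + \<epsilon> n" by metis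
  have cauchy: "B (\<lambda>x. U a x - U b x) (\<lambda>x. U a x - U b x) \<le> (1 / 16) ^ b" if "b \<le> a" for a b
  proof -
    let ?d = "\<lambda>x. U a x + (-1) * U b x"
    have d: "?d \<in> X" by (intro lin U)
    define p where "p = B (U a) (U b)"
    define w where "w = (\<lambda>x. U a x + 1 * U b x)"
    have w: "w \<in> X" unfolding w_def by (intro lin U)
    have "m \<le> J (\<lambda>x. (1 / 2) * w x)" by (intro m_le X_scale w)
    also have "\<dots> = (1 / 4) * B w w - l w"
      unfolding J_def B_scale[OF w X_scale[OF w]] B_scale'[OF w w] l_scale[OF w] by simp
    also have "B w w = B (U a) (U a) + 2 * p + B (U b) (U b)"
      using B_expand[OF U(1) U(1), of a 1 b] by (simp add: w_def p_def)
    also have "l w = l (U a) + l (U b)" using l_add[OF U(1) U(1), of a b] by (simp add: w_def)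
    finally have "m \<le> (1 / 4) * (B (U a) (U a) + 2 * p + B (U b) (U b)) - (l (U a) + l (U b))" .
    moreover have "4 * m' \<le> S - 4 * q" if "m' \<le> (1 / 4) * S - q" for m' S q :: real
      using that by simp
    ultimately have "4 * m \<le> B (U a) (U a) + 2 * p + B (U b) (U b) - 4 * (l (U a) + l (U b))" by blast
    moreover have "B ?d ?d = B (U a) (U a) - 2 * p + B (U b) (U b)"
      using B_expand[OF U(1) U(1), of a "-1" b] by (simp add: p_def)
    moreover have "J (U a) < m + \<epsilon> a" "J (U b) < m + \<epsilon> b" using U by auto
    moreover have "\<epsilon> a \<le> \<epsilon> b" unfolding \<epsilon>_def using that by (intro divide_right_mono power_decreasing) auto
    moreover have "D \<le> 4 * eb" if "4 * m' \<le> Ba + 2 * q + Bb - 4 * (la + lb)" "D = Ba - 2 * q + Bb"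
      "Ba - 2 * la < m' + ea" "Bb - 2 * lb < m' + eb" "ea \<le> eb" for D Ba Bb la lb ea eb m' q :: real
      using that unfolding distrib_left by linarith
    ultimately have "B ?d ?d \<le> 4 * \<epsilon> b" unfolding J_def by blast
    then show ?thesis by (simp add: \<epsilon>_def)
  qed
  obtain u where u: "u \<in> X" "(\<lambda>n. B (\<lambda>x. U n x - u x) (\<lambda>x. U n x - u x)) \<longlonglongrightarrow> 0"
    using complete[of U] U(1) cauchy by blast
  have "B u v = l v" if v: "v \<in> X" for v
  proof -
    have 1: "(\<lambda>n. B (U n) v - l v) \<longlonglongrightarrow> 0"
    proof -
      have sq: "(B (U n) v - l v)\<^sup>2 \<le> \<epsilon> n * B v v" for n
      proof (rule nonneg_quadratic_discriminant)
        fix t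
        have "m \<le> J (\<lambda>x. U n x + t * v x)" by (intro m_le lin U v)
        then show "0 \<le> \<epsilon> n + 2 * (B (U n) v - l v) * t + B v v * t\<^sup>2"
          using U(2)[of n] by (simp add: J_expand[OF U(1) v])
      qed (rule B_pos[OF v])
      have "(\<lambda>n. \<epsilon> n * B v v) \<longlonglongrightarrow> 0 / 4 * B v v"
        unfolding \<epsilon>_def by (intro tendsto_intros LIMSEQ_power_zero) auto
      then show ?thesis by (intro tendsto_zero_if_sq_le[OF sq]) simp
    qed
    have 2: "(\<lambda>n. B (U n) v - B u v) \<longlonglongrightarrow> 0"
    proof -
      have sq: "(B (U n) v - B u v)\<^sup>2 \<le> B (\<lambda>x. U n x - u x) (\<lambda>x. U n x - u x) * B v v" for n
        using CS[OF diff[OF U(1) u(1)] v, of n] by (simp add: B_diff[OF U(1) u(1) v])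
      have "(\<lambda>n. B (\<lambda>x. U n x - u x) (\<lambda>x. U n x - u x) * B v v) \<longlonglongrightarrow> 0 * B v v"
        by (intro tendsto_intros u)
      then show ?thesis by (intro tendsto_zero_if_sq_le[OF sq]) simp
    qed
    have "(\<lambda>n. (B (U n) v - l v) - (B (U n) v - B u v)) \<longlonglongrightarrow> 0 - 0"
      by (intro tendsto_diff 1 2)
    then have "(\<lambda>n::nat. B u v - l v) \<longlonglongrightarrow> 0" by simp
    then show ?thesis by (simp add: LIMSEQ_const_iff)
  qed
  then show ?thesis using u(1) by blast
qed

lemma op_norm_bound:
  assumes F: "F \<in> dual_space X N" and X_scale: "\<And>c u. u \<in> X \<Longrightarrow> (\<lambda>x. c * u x) \<in> X"
    and N_scale: "\<And>c u. u \<in> X \<Longrightarrow> N (\<lambda>x. c * u x) = \<bar>c\<bar> * N u" and N_pos: "\<And>u. 0 \<le> N u" and u: "u \<in> X"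
  shows "\<bar>F u\<bar> \<le> op_norm X N F * N u" "0 \<le> op_norm X N F"
proof -
  obtain K where K: "\<And>u. u \<in> X \<Longrightarrow> \<bar>F u\<bar> \<le> K * N u" using F unfolding dual_space_def by blast
  have bdd: "bdd_above ((\<lambda>u. \<bar>F u\<bar>) ` {u \<in> X. N u \<le> 1})"
  proof (rule bdd_aboveI[of _ "\<bar>K\<bar>"])
    fix y assume "y \<in> (\<lambda>u. \<bar>F u\<bar>) ` {u \<in> X. N u \<le> 1}"
    then obtain u where u: "u \<in> X" "N u \<le> 1" "y = \<bar>F u\<bar>" by auto
    have "y \<le> K * N u" using K u by simp
    also have "\<dots> \<le> \<bar>K\<bar> * 1" using u N_pos by (intro mult_mono) auto
    finally show "y \<le> \<bar>K\<bar>" by simp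
  qed
  have sup: "\<bar>F v\<bar> \<le> op_norm X N F" if "v \<in> X" "N v \<le> 1" for v
    unfolding op_norm_def using that by (intro cSUP_upper bdd) auto
  show "0 \<le> op_norm X N F"
  proof -
    have "N (\<lambda>x. 0 * u x) \<le> 1" using N_scale[OF u, of 0] by simp
    then show ?thesis using sup[OF X_scale[OF u, of 0]] by linarith
  qed
  show "\<bar>F u\<bar> \<le> op_norm X N F * N u"
  proof (cases "N u = 0")
    case True
    then show ?thesis using K[OF u] by simp
  next
    case False
    then have pos: "0 < N u" using N_pos[of u] by simp
    define w where "w = (\<lambda>x. (1 / N u) * u x)"
    have "\<bar>F w\<bar> \<le> op_norm X N F"
      using pos N_scale[OF u, of "1 / N u"] unfolding w_def by (intro sup X_scale u) auto
    moreover have "F w = (1 / N u) * F u"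
      using F u unfolding dual_space_def w_def by blast
    then have "F u = F w * N u" using pos by simp
    ultimately show ?thesis using pos by (simp add: abs_mult mult_right_mono)
  qed
qed

section \<open>The energy space\<close>

text \<open>
  As \<open>Gamma (1 - s) = Gamma (2 - s) / (1 - s)\<close>, the quotient of \<open>kappa d s\<close> and \<open>1 - s\<close> extends to a positive
  continuous function on \<open>[s0, 1]\<close>.
\<close>

lemma kappa_lower_bound:
  assumes "0 < d" "0 < s0"
  obtains c where "0 < c" "\<And>s. s0 \<le> s \<Longrightarrow> s < 1 \<Longrightarrow> c * (1 - s) \<le> kappa d s"
proof (cases "s0 \<le> 1")
  case False
  then show thesis using that[of 1] by auto
next
  case True
  define f where "f s = 2 powr (2 * s) * s * Gamma ((real d + 2 * s) / 2) / (pi powr (real d / 2) * Gamma (2 - s))" for s :: real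
  have nn: "x \<notin> \<int>\<^sub>\<le>\<^sub>0" if "0 < x" for x :: real
    using that by (auto elim!: nonpos_Ints_cases)
  have f_pos: "0 < f s" if "s \<in> {s0..1}" for s
    using that assms unfolding f_def by (intro divide_pos_pos mult_pos_pos Gamma_real_pos) auto
  have Gamma_cont: "continuous_on {0<..} (Gamma :: real \<Rightarrow> real)"
    by (intro continuous_on_Gamma) (auto dest: nn)
  have "continuous_on {s0..1} (\<lambda>s. Gamma ((real d + 2 * s) / 2))"
    by (rule continuous_on_compose2[OF Gamma_cont]) (use assms in \<open>auto intro!: continuous_intros add_pos_pos\<close>)
  moreover have "continuous_on {s0..1} (\<lambda>s. Gamma (2 - s))"
    by (rule continuous_on_compose2[OF Gamma_cont]) (auto intro!: continuous_intros)
  moreover have "pi powr (real d / 2) * Gamma (2 - s) \<noteq> 0" if "s \<in> {s0..1}" for s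
  proof -
    have "0 < Gamma (2 - s)" using that by (intro Gamma_real_pos) auto
    then show ?thesis by simp
  qed
  ultimately have "continuous_on {s0..1} f"
    unfolding f_def
    by (intro continuous_on_divide continuous_on_mult continuous_on_powr continuous_on_const continuous_on_id) auto
  then obtain s1 where s1: "s1 \<in> {s0..1}" "\<And>s. s \<in> {s0..1} \<Longrightarrow> f s1 \<le> f s"
    using continuous_attains_inf[of "{s0..1}" f] True by auto
  show thesis
  proof (rule that[OF f_pos[OF s1(1)]])
    fix s assume s: "s0 \<le> s" "s < 1"
    have "Gamma (2 - s) = (1 - s) * Gamma (1 - s)"
      using Gamma_plus1[of "1 - s"] nn[of "1 - s"] s by (simp add: algebra_simps)
    moreover have "0 < Gamma (1 - s)" using s by (intro Gamma_real_pos) auto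
    ultimately have "kappa d s = f s * (1 - s)"
      using s unfolding kappa_def f_def by simp
    then show "f s1 * (1 - s) \<le> kappa d s" using s1(2)[of s] s by (simp add: mult_right_mono)
  qed
qed

lemma kappa_pos: "0 < d \<Longrightarrow> 0 < s \<Longrightarrow> s < 1 \<Longrightarrow> 0 < kappa d s"
  unfolding kappa_def by (intro divide_pos_pos mult_pos_pos Gamma_real_pos) auto

lemma interaction_set_iff: "(x, y) \<in> interaction_set \<Omega> \<longleftrightarrow> x \<in> \<Omega> \<or> y \<in> \<Omega>"
  by (auto simp: interaction_set_def)

lemma interaction_set_borel [measurable]:
  fixes \<Omega> :: "'a::euclidean_space set"
  assumes [measurable]: "\<Omega> \<in> sets borel"
  shows "interaction_set \<Omega> \<in> sets borel"
proof -
  have "(- \<Omega>) \<times> (- \<Omega>) \<in> sets (borel \<Otimes>\<^sub>M borel)" by measurable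
  then show ?thesis unfolding interaction_set_def borel_prod by (intro sets.Diff) auto
qed

lemma V_energy_iterated:
  fixes u :: "'a::euclidean_space \<Rightarrow> real"
  assumes [measurable]: "u \<in> borel_measurable borel" "\<Omega> \<in> sets borel"
  shows "V_energy \<Omega> s u = ennreal (kappa DIM('a) s / 2) * (\<integral>\<^sup>+x. \<integral>\<^sup>+y. indicator (interaction_set \<Omega>) (x, y) *
     ennreal ((u x - u y)\<^sup>2 * gagliardo_kernel s (x - y)) \<partial>lborel \<partial>lborel)"
proof -
  let ?f = "\<lambda>(x, y). indicator (interaction_set \<Omega>) (x, y) * ennreal ((u x - u y)\<^sup>2 * gagliardo_kernel s (x - y))"
  have [measurable]: "interaction_set \<Omega> \<in> sets (borel \<Otimes>\<^sub>M borel)" unfolding borel_prod by measurable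
  have m: "?f \<in> borel_measurable (lborel \<Otimes>\<^sub>M lborel)" by measurable
  have "(\<integral>\<^sup>+(x, y)\<in>interaction_set \<Omega>. ennreal ((u x - u y)\<^sup>2 / norm (x - y) powr (real DIM('a) + 2 * s)) \<partial>lborel) =
     (\<integral>\<^sup>+z. ?f z \<partial>lborel)"
  proof -
    have e: "a / t powr q = a * t powr (- q)" for a t q :: real by (simp add: powr_minus divide_inverse)
    show ?thesis by (intro nn_integral_cong) (simp add: e mult.commute split: prod.splits)
  qed
  also have "\<dots> = (\<integral>\<^sup>+x. \<integral>\<^sup>+y. ?f (x, y) \<partial>lborel \<partial>lborel)"
    unfolding lborel_prod[symmetric] using lborel.nn_integral_fst[OF m] by simp
  finally show ?thesis unfolding V_energy_def by simp
qed

lemma cross_energy_le_V_energy: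
  fixes \<Omega> :: "'a::euclidean_space set"
  assumes [measurable]: "u \<in> borel_measurable borel" "\<Omega> \<in> sets borel"
    and c: "0 < c" "c * (1 - s) \<le> kappa DIM('a) s" and s: "s < 1"
  shows "cross_energy \<Omega> s u \<le> ennreal (2 / c) * V_energy \<Omega> s u"
proof -
  define Q where "Q = (\<integral>\<^sup>+x. \<integral>\<^sup>+y. indicator (interaction_set \<Omega>) (x, y) *
     ennreal ((u x - u y)\<^sup>2 * gagliardo_kernel s (x - y)) \<partial>lborel \<partial>lborel)"
  have k: "0 \<le> kappa DIM('a) s" using c s by (meson diff_ge_0_iff_ge less_imp_le mult_nonneg_nonneg order_trans)
  have "cross_energy \<Omega> s u \<le> ennreal (1 - s) * Q"
    unfolding cross_energy_def Q_def
    by (intro mult_left_mono nn_integral_mono) (auto simp: indicator_def interaction_set_iff)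
  also have "\<dots> \<le> ennreal (2 / c * (kappa DIM('a) s / 2)) * Q"
    using c by (intro mult_right_mono ennreal_leI) (auto simp: field_simps)
  also have "\<dots> = ennreal (2 / c) * V_energy \<Omega> s u"
  proof -
    have "ennreal (2 / c * (kappa DIM('a) s / 2)) = ennreal (2 / c) * ennreal (kappa DIM('a) s / 2)"
      using c k by (intro ennreal_mult) auto
    then show ?thesis by (simp only: V_energy_iterated[OF assms(1,2)] Q_def mult.assoc)
  qed
  finally show ?thesis .
qed

lemma V_energy_scale:
  fixes u :: "'a::euclidean_space \<Rightarrow> real"
  assumes [measurable]: "u \<in> borel_measurable borel" "\<Omega> \<in> sets borel"
  shows "V_energy \<Omega> s (\<lambda>x. c * u x) = ennreal (c\<^sup>2) * V_energy \<Omega> s u"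
proof -
  have [measurable]: "interaction_set \<Omega> \<in> sets (borel \<Otimes>\<^sub>M borel)" unfolding borel_prod by measurable
  have "indicator (interaction_set \<Omega>) (x, y) * ennreal ((c * u x - c * u y)\<^sup>2 * gagliardo_kernel s (x - y)) =
    ennreal (c\<^sup>2) * (indicator (interaction_set \<Omega>) (x, y) * ennreal ((u x - u y)\<^sup>2 * gagliardo_kernel s (x - y)))" for x y
  proof -
    have "(c * u x - c * u y)\<^sup>2 = c\<^sup>2 * (u x - u y)\<^sup>2" by (simp add: power_mult_distrib[symmetric] right_diff_distrib)
    then show ?thesis by (simp add: ennreal_mult mult_ac)
  qed
  then show ?thesis
    by (simp add: V_energy_iterated nn_integral_cmult mult.left_commute)
qed

lemma V_energy_add_le:
  fixes u :: "'a::euclidean_space \<Rightarrow> real"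
  assumes [measurable]: "u \<in> borel_measurable borel" "v \<in> borel_measurable borel" "\<Omega> \<in> sets borel"
  shows "V_energy \<Omega> s (\<lambda>x. u x + v x) \<le> 2 * (V_energy \<Omega> s u + V_energy \<Omega> s v)"
proof -
  have [measurable]: "interaction_set \<Omega> \<in> sets (borel \<Otimes>\<^sub>M borel)" unfolding borel_prod by measurable
  define I where "I w x y = indicator (interaction_set \<Omega>) (x, y) *
     ennreal ((w x - w y)\<^sup>2 * gagliardo_kernel s (x - y))" for w :: "'a \<Rightarrow> real" and x y
  have [measurable]: "case_prod (I w) \<in> borel_measurable (borel \<Otimes>\<^sub>M borel)" if [measurable]: "w \<in> borel_measurable borel" for w
    unfolding I_def by measurable
  have pt: "I (\<lambda>x. u x + v x) x y \<le> 2 * (I u x y + I v x y)" for x y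
  proof -
    have "((u x + v x) - (u y + v y))\<^sup>2 \<le> 2 * ((u x - u y)\<^sup>2 + (v x - v y)\<^sup>2)"
    proof -
      have "0 \<le> ((u x - u y) - (v x - v y))\<^sup>2" by simp
      then show ?thesis by (simp add: power2_eq_square algebra_simps)
    qed
    then have "((u x + v x) - (u y + v y))\<^sup>2 * gagliardo_kernel s (x - y) \<le>
       2 * ((u x - u y)\<^sup>2 + (v x - v y)\<^sup>2) * gagliardo_kernel s (x - y)"
      by (rule mult_right_mono) simp
    also have "\<dots> = 2 * ((u x - u y)\<^sup>2 * gagliardo_kernel s (x - y) + (v x - v y)\<^sup>2 * gagliardo_kernel s (x - y))"
      by (simp add: algebra_simps)
    finally have "ennreal (((u x + v x) - (u y + v y))\<^sup>2 * gagliardo_kernel s (x - y)) \<le>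
       ennreal (2 * ((u x - u y)\<^sup>2 * gagliardo_kernel s (x - y) + (v x - v y)\<^sup>2 * gagliardo_kernel s (x - y)))"
      by (rule ennreal_leI)
    also have "\<dots> = 2 * (ennreal ((u x - u y)\<^sup>2 * gagliardo_kernel s (x - y)) + ennreal ((v x - v y)\<^sup>2 * gagliardo_kernel s (x - y)))"
    proof -
      have *: "ennreal (2 * (a + b)) = 2 * (ennreal a + ennreal b)" if "0 \<le> a" "0 \<le> b" for a b
        using that by (simp add: ennreal_mult)
      show ?thesis by (rule *) auto
    qed
    finally show ?thesis unfolding I_def by (simp add: indicator_def)
  qed
  have V_I: "V_energy \<Omega> s w = ennreal (kappa DIM('a) s / 2) * (\<integral>\<^sup>+x. \<integral>\<^sup>+y. I w x y \<partial>lborel \<partial>lborel)"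
    if "w \<in> borel_measurable borel" for w
    unfolding I_def by (rule V_energy_iterated[OF that assms(3)])
  have "V_energy \<Omega> s (\<lambda>x. u x + v x) \<le> ennreal (kappa DIM('a) s / 2) * (\<integral>\<^sup>+x. \<integral>\<^sup>+y. 2 * (I u x y + I v x y) \<partial>lborel \<partial>lborel)"
    by (subst V_I, simp) (intro mult_left_mono nn_integral_mono pt zero_le)
  also have "\<dots> = 2 * (V_energy \<Omega> s u + V_energy \<Omega> s v)"
    by (simp add: V_I nn_integral_cmult nn_integral_add distrib_left mult.left_commute)
  finally show ?thesis .
qed

lemma V_energy_shift: "V_energy \<Omega> s (\<lambda>x. u x - c) = V_energy \<Omega> s u"
  unfolding V_energy_def by simp

text \<open>
  The increments decay like \<open>2 powr (- n / 2)\<close>.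
\<close>

lemma dyadic_increments_convergent:
  fixes a :: "nat \<Rightarrow> real"
  assumes "\<And>n. 2 ^ n * (a (Suc n) - a n)\<^sup>2 \<le> M"
  shows "convergent a"
proof -
  have "(a (Suc 0) - a 0)\<^sup>2 \<le> M" using assms[of 0] by simp
  then have M: "0 \<le> M" by (rule order_trans[OF zero_le_power2])
  have inc: "\<bar>a (Suc n) - a n\<bar> \<le> sqrt M * sqrt (1 / 2) ^ n" for n
  proof -
    have "(a (Suc n) - a n)\<^sup>2 \<le> M * (1 / 2) ^ n"
      using assms[of n] by (simp add: power_one_over field_simps)
    also have "\<dots> = (sqrt M * sqrt (1 / 2) ^ n)\<^sup>2"
    proof -
      have "(sqrt (1 / 2) ^ n)\<^sup>2 = (1 / 2) ^ n"
        by (simp add: power_mult[symmetric] mult.commute[of n]) (simp add: power_mult)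
      then show ?thesis using M by (simp add: power_mult_distrib)
    qed
    finally show ?thesis using M abs_le_square_iff[of "a (Suc n) - a n" "sqrt M * sqrt (1 / 2) ^ n"] by simp
  qed
  have sm: "summable (\<lambda>n. sqrt M * sqrt (1 / 2) ^ n)"
    by (intro summable_mult summable_geometric) (simp add: real_sqrt_lt_1_iff)
  have "summable (\<lambda>n. a (Suc n) - a n)"
    by (rule summable_comparison_test'[OF sm, of 0]) (use inc in auto)
  then have "convergent (\<lambda>n. \<Sum>k<n. a (Suc k) - a k)" by (simp add: summable_iff_convergent)
  then have "convergent (\<lambda>n. a n - a 0)" by (simp add: sum_lessThan_telescope)
  then show ?thesis by (simp add: convergent_diff_const_right_iff)
qed

text \<open>
  Finite energy bounds the double integral of \<open>(u x - u y)\<^sup>2\<close> over \<open>\<Omega>\<close> through \<open>poincare_pair_domain\<close>, so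
  \<open>u x - u\<close> is square integrable over \<open>\<Omega>\<close> for at least one \<open>x\<close>. This is what makes the mean value additive.
\<close>

lemma V_space_integrable:
  fixes \<Omega> :: "'a::euclidean_space set"
  assumes C11: "C11_domain \<Omega>" and bnd: "bounded \<Omega>" and s: "0 < s" "s < 1" and u: "u \<in> V_space \<Omega> s"
  shows "integrable lborel (\<lambda>x. indicator \<Omega> x * u x)"
proof (cases "\<Omega> = {}")
  case False
  have o: "open \<Omega>" using C11 unfolding C11_domain_def by simp
  then have [measurable]: "\<Omega> \<in> sets borel" by simp
  have [measurable]: "u \<in> borel_measurable borel" and fin: "V_energy \<Omega> s u < \<infinity>"
    using u by (auto simp: V_space_def)
  obtain c where c: "0 < c" "\<And>t. s \<le> t \<Longrightarrow> t < 1 \<Longrightarrow> c * (1 - t) \<le> kappa DIM('a) t"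
    using kappa_lower_bound[OF DIM_positive s(1)] by metis
  have "cross_energy \<Omega> s u \<le> ennreal (2 / c) * V_energy \<Omega> s u"
    using c s by (intro cross_energy_le_V_energy) auto
  also have "\<dots> < \<infinity>" using fin by (simp add: ennreal_mult_less_top)
  finally have cf: "cross_energy \<Omega> s u < \<infinity>" .
  obtain C where C: "0 \<le> C" "\<And>s u. 0 < s \<and> s < 1 \<and> u \<in> borel_measurable borel \<Longrightarrow>
    (pair_oscillation \<Omega> \<Omega> u) \<le> ennreal C * cross_energy \<Omega> s u"
    using poincare_pair_domain[OF C11 bnd] unfolding poincare_pair_def by blast
  have "pair_oscillation \<Omega> \<Omega> u \<le> ennreal C * cross_energy \<Omega> s u"
    by (rule C(2)) (use s in auto)
  also have "\<dots> < \<infinity>" using cf by (simp add: ennreal_mult_less_top)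
  finally have "AE x in lborel. (\<integral>\<^sup>+y. indicator \<Omega> x * (indicator \<Omega> y * ennreal ((u x - u y)\<^sup>2)) \<partial>lborel) \<noteq> \<infinity>"
    by (intro nn_integral_PInf_AE) auto
  moreover have "\<not> (AE x in lborel. x \<notin> \<Omega>)"
    using open_pos_measure[OF o False] AE_iff_null_sets[of \<Omega> lborel] by auto
  ultimately obtain x where x: "x \<in> \<Omega>" "(\<integral>\<^sup>+y. indicator \<Omega> x * (indicator \<Omega> y * ennreal ((u x - u y)\<^sup>2)) \<partial>lborel) \<noteq> \<infinity>"
    by (metis (mono_tags, lifting) AE_mp AE_I2)
  then show ?thesis by (intro integrable_if_sq_distance_finite(2)[of u \<Omega> "u x"] bnd) auto
qed simp

lemma V_perp_closed:
  fixes \<Omega> :: "'a::euclidean_space set"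
  assumes C11: "C11_domain \<Omega>" and bnd: "bounded \<Omega>" and s: "0 < s" "s < 1"
  shows "(\<lambda>x. 0) \<in> V_perp \<Omega> s"
    and "u \<in> V_perp \<Omega> s \<Longrightarrow> v \<in> V_perp \<Omega> s \<Longrightarrow> (\<lambda>x. u x + v x) \<in> V_perp \<Omega> s"
    and "u \<in> V_perp \<Omega> s \<Longrightarrow> (\<lambda>x. c * u x) \<in> V_perp \<Omega> s"
proof -
  have o: "open \<Omega>" using C11 unfolding C11_domain_def by simp
  then have [measurable]: "\<Omega> \<in> sets borel" by simp
  show "(\<lambda>x. 0) \<in> V_perp \<Omega> s"
    by (simp add: V_perp_def V_space_def V_energy_def set_lebesgue_integral_def)
  show "(\<lambda>x. u x + v x) \<in> V_perp \<Omega> s" if u: "u \<in> V_perp \<Omega> s" and v: "v \<in> V_perp \<Omega> s"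
  proof -
    have [measurable]: "u \<in> borel_measurable borel" "v \<in> borel_measurable borel"
      using u v by (auto simp: V_perp_def V_space_def)
    have "V_energy \<Omega> s (\<lambda>x. u x + v x) \<le> 2 * (V_energy \<Omega> s u + V_energy \<Omega> s v)"
      by (rule V_energy_add_le) auto
    also have "\<dots> < \<infinity>" using u v by (simp add: V_perp_def V_space_def ennreal_mult_less_top)
    finally have "(\<lambda>x. u x + v x) \<in> V_space \<Omega> s" by (simp add: V_space_def)
    moreover have "(LINT x:\<Omega>|lborel. u x + v x) = 0"
      using V_space_integrable[OF C11 bnd s, of u] V_space_integrable[OF C11 bnd s, of v] u v
      by (simp add: V_perp_def set_lebesgue_integral_def distrib_left)
    ultimately show ?thesis by (simp add: V_perp_def)
  qed
  show "(\<lambda>x. c * u x) \<in> V_perp \<Omega> s" if u: "u \<in> V_perp \<Omega> s"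
  proof -
    have [measurable]: "u \<in> borel_measurable borel" using u by (auto simp: V_perp_def V_space_def)
    have "(LINT x:\<Omega>|lborel. c * u x) = c * (LINT x:\<Omega>|lborel. u x)" by simp
    then show ?thesis using u
      by (auto simp: V_perp_def V_space_def V_energy_scale ennreal_mult_less_top)
  qed
qed

lemma V_norm_alt: "V_norm \<Omega> s u = sqrt (enn2real (sq_integral \<Omega> u + V_energy \<Omega> s u))"
  unfolding V_norm_def by (simp add: mult.commute)

lemma V_norm_scale:
  fixes u :: "'a::euclidean_space \<Rightarrow> real"
  assumes [measurable]: "u \<in> borel_measurable borel" "\<Omega> \<in> sets borel"
  shows "V_norm \<Omega> s (\<lambda>x. c * u x) = \<bar>c\<bar> * V_norm \<Omega> s u"
proof -
  have "(\<integral>\<^sup>+x. indicator \<Omega> x * ennreal ((c * u x)\<^sup>2) \<partial>lborel) = (\<integral>\<^sup>+x. ennreal (c\<^sup>2) * (indicator \<Omega> x * ennreal ((u x)\<^sup>2)) \<partial>lborel)"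
    by (intro nn_integral_cong) (auto simp: power_mult_distrib ennreal_mult mult_ac)
  also have "\<dots> = ennreal (c\<^sup>2) * sq_integral \<Omega> u"
    by (simp add: nn_integral_cmult)
  finally show ?thesis
    by (simp add: V_norm_alt V_energy_scale distrib_left[symmetric] enn2real_mult real_sqrt_mult)
qed

lemma T_sqnorm_scale:
  fixes g :: "'a::euclidean_space \<Rightarrow> real"
  assumes [measurable]: "g \<in> borel_measurable borel" "\<Omega> \<in> sets borel" and s: "s < 1"
  shows "T_sqnorm \<Omega> s (\<lambda>x. c * g x) = ennreal (c\<^sup>2) * T_sqnorm \<Omega> s g"
proof -
  have e1: "ennreal ((c * g x)\<^sup>2 * tau \<Omega> s x) = ennreal (c\<^sup>2) * ennreal ((g x)\<^sup>2 * tau \<Omega> s x)" for x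
  proof -
    have "(c * g x)\<^sup>2 * tau \<Omega> s x = c\<^sup>2 * ((g x)\<^sup>2 * tau \<Omega> s x)" by (simp add: power_mult_distrib)
    then show ?thesis using tau_nonneg[OF s, of \<Omega> x] by (simp only: ennreal_mult mult_nonneg_nonneg zero_le_power2)
  qed
  have e2: "ennreal ((c * g x - c * g y)\<^sup>2 * trace_kernel \<Omega> s x y) = ennreal (c\<^sup>2) * ennreal ((g x - g y)\<^sup>2 * trace_kernel \<Omega> s x y)" for x y
  proof -
    have "(c * g x - c * g y)\<^sup>2 * trace_kernel \<Omega> s x y = c\<^sup>2 * ((g x - g y)\<^sup>2 * trace_kernel \<Omega> s x y)"
      by (simp add: power_mult_distrib right_diff_distrib[symmetric])
    then show ?thesis by (simp only: ennreal_mult mult_nonneg_nonneg zero_le_power2 trace_kernel_nonneg)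
  qed
  show ?thesis
    unfolding T_sqnorm_eq e1 e2
    by (simp add: mult.left_commute[of _ "ennreal (c\<^sup>2)"] nn_integral_cmult distrib_left)
qed

lemma T_sqnorm_restrict: "T_sqnorm \<Omega> s (restrict_compl \<Omega> v) = T_sqnorm \<Omega> s v"
  unfolding T_sqnorm_eq
  by (intro arg_cong2[where f="(+)"] nn_integral_cong) (auto simp: restrict_compl_def indicator_def)

text \<open>
  For functions with mean zero on \<open>\<Omega>\<close>, the energy alone controls every other quantity in the problem.
\<close>

definition energy_controls :: "'a::euclidean_space set \<Rightarrow> real \<Rightarrow> real \<Rightarrow> ('a \<Rightarrow> real) \<Rightarrow> bool" where
  "energy_controls \<Omega> C s u \<longleftrightarrow>
     (sq_integral \<Omega> u) \<le> ennreal (C * enn2real (V_energy \<Omega> s u)) \<and>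
     cross_energy \<Omega> s u \<le> ennreal (C * enn2real (V_energy \<Omega> s u)) \<and>
     T_sqnorm \<Omega> s u \<le> ennreal (C * enn2real (V_energy \<Omega> s u)) \<and>
     (V_norm \<Omega> s u)\<^sup>2 \<le> C * enn2real (V_energy \<Omega> s u) \<and> enn2real (V_energy \<Omega> s u) \<le> (V_norm \<Omega> s u)\<^sup>2"

lemma uniform_bounds:
  fixes \<Omega> :: "'a::euclidean_space set"
  assumes C11: "C11_domain \<Omega>" and bnd: "bounded \<Omega>" and s0: "0 < s0"
  obtains C where "0 < C" "\<And>s u. s0 \<le> s \<Longrightarrow> s < 1 \<Longrightarrow> u \<in> V_perp \<Omega> s \<Longrightarrow>
      energy_controls \<Omega> C s u"
proof -
  have o: "open \<Omega>" using C11 unfolding C11_domain_def by simp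
  then have [measurable]: "\<Omega> \<in> sets borel" by simp
  obtain c where c: "0 < c" "\<And>s. s0 \<le> s \<Longrightarrow> s < 1 \<Longrightarrow> c * (1 - s) \<le> kappa DIM('a) s"
    using kappa_lower_bound[OF DIM_positive s0] by metis
  obtain P where P: "0 < P" "\<And>s u. 0 < s \<Longrightarrow> s < 1 \<Longrightarrow> u \<in> borel_measurable borel \<Longrightarrow> (LINT x:\<Omega>|lborel. u x) = 0 \<Longrightarrow>
    (sq_integral \<Omega> u) \<le> ennreal P * cross_energy \<Omega> s u"
    using poincare_mean_zero[OF C11 bnd] by blast
  obtain T where T: "0 < T" "\<And>s u. s0 \<le> s \<Longrightarrow> s < 1 \<Longrightarrow> u \<in> borel_measurable borel \<Longrightarrow>
    T_sqnorm \<Omega> s u \<le> ennreal T * (cross_energy \<Omega> s u + sq_integral \<Omega> u)"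
    using trace_estimate[OF C11 bnd s0] by blast
  define a where "a = 2 / c"
  have a: "0 < a" using c by (simp add: a_def)
  define C where "C = a + (P * a + 1) + T * (a + P * a)"
  have C: "0 < C" "a \<le> C" "P * a + 1 \<le> C" "P * a \<le> C" "T * (a + P * a) \<le> C"
    using a P(1) T(1) by (auto simp: C_def add_pos_pos)
  show thesis
  proof (rule that[OF C(1)])
    fix s u assume s: "s0 \<le> s" "s < 1" and u: "u \<in> V_perp \<Omega> s"
    have [measurable]: "u \<in> borel_measurable borel" and fin: "V_energy \<Omega> s u < \<infinity>" and mean: "(LINT x:\<Omega>|lborel. u x) = 0"
      using u by (auto simp: V_perp_def V_space_def)
    have s': "0 < s" using s s0 by simp
    define E where "E = enn2real (V_energy \<Omega> s u)"
    have E: "0 \<le> E" "V_energy \<Omega> s u = ennreal E" using fin by (auto simp: E_def)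
    have "cross_energy \<Omega> s u \<le> ennreal a * V_energy \<Omega> s u"
      unfolding a_def by (rule cross_energy_le_V_energy) (use c s in auto)
    then have cr: "cross_energy \<Omega> s u \<le> ennreal (a * E)" using E a by (simp add: ennreal_mult)
    have "sq_integral \<Omega> u \<le> ennreal P * cross_energy \<Omega> s u"
      by (rule P(2)) (use s s' mean in auto)
    also have "\<dots> \<le> ennreal P * ennreal (a * E)" by (intro mult_left_mono cr) simp
    also have "\<dots> = ennreal (P * a * E)" using P(1) a E by (simp add: ennreal_mult mult.assoc)
    finally have U: "sq_integral \<Omega> u \<le> ennreal (P * a * E)" .
    have "T_sqnorm \<Omega> s u \<le> ennreal T * (cross_energy \<Omega> s u + sq_integral \<Omega> u)"
      by (rule T(2)) (use s in auto)
    also have "\<dots> \<le> ennreal T * (ennreal (a * E) + ennreal (P * a * E))" by (intro mult_left_mono add_mono cr U) simp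
    also have "\<dots> = ennreal (T * (a + P * a) * E)"
    proof -
      have "ennreal (a * E) + ennreal (P * a * E) = ennreal (a * E + P * a * E)"
        using P(1) a E by (intro ennreal_plus[symmetric]) auto
      moreover have "ennreal T * ennreal (a * E + P * a * E) = ennreal (T * (a * E + P * a * E))"
        using T(1) P(1) a E by (intro ennreal_mult[symmetric]) auto
      ultimately show ?thesis by (simp only: distrib_right mult.assoc)
    qed
    finally have Tr: "T_sqnorm \<Omega> s u \<le> ennreal (T * (a + P * a) * E)" .
    obtain U' where U': "0 \<le> U'" "sq_integral \<Omega> u = ennreal U'"
      using U by (cases "sq_integral \<Omega> u") (auto simp: top_unique)
    have V: "(V_norm \<Omega> s u)\<^sup>2 = U' + E"
      unfolding V_norm_alt U'(2) E(2) using U'(1) E(1) by (simp add: ennreal_plus[symmetric] del: ennreal_plus)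
    have "U' \<le> P * a * E" using U U' P(1) a E by (simp add: ennreal_le_iff)
    then have "(V_norm \<Omega> s u)\<^sup>2 \<le> (P * a + 1) * E" unfolding V by (simp add: distrib_right)
    also have "\<dots> \<le> C * E" using C E by (intro mult_right_mono) auto
    finally have VC: "(V_norm \<Omega> s u)\<^sup>2 \<le> C * E" .
    have "ennreal (k * E) \<le> ennreal (C * E)" if "k \<le> C" for k
      using that E by (intro ennreal_leI mult_right_mono) auto
    then show "energy_controls \<Omega> C s u"
      unfolding energy_controls_def E_def[symmetric] using VC V U'(1) C U cr Tr by (auto intro: order_trans)
  qed
qed

section \<open>The bilinear form and weak solutions\<close>

text \<open>
  Everything in this context holds for one fixed \<open>s\<close>; uniformity in \<open>s\<close> only enters through the constant of
  \<open>uniform_bounds\<close>.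
\<close>

locale admissible_form =
  fixes \<Omega> :: "'a::euclidean_space set" and \<Lambda> s :: real and J :: "'a \<Rightarrow> 'a \<Rightarrow> real"
  assumes C11: "C11_domain \<Omega>" and bnd: "bounded \<Omega>" and \<Lambda>: "1 \<le> \<Lambda>" and s: "0 < s" "s < 1"
    and adm: "admissible_kernel \<Lambda> s J"
begin

lemma open_\<Omega>: "open \<Omega>" using C11 unfolding C11_domain_def by simp

lemma \<Omega>_borel [measurable]: "\<Omega> \<in> sets borel" using open_\<Omega> by simp

lemma kernel_const_pos: "0 < kappa DIM('a) s" using kappa_pos[OF DIM_positive s] .

definition gagliardo_density :: "('a \<Rightarrow> real) \<Rightarrow> 'a \<times> 'a \<Rightarrow> real" where
  "gagliardo_density u z = indicator (interaction_set \<Omega>) z *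
     ((u (fst z) - u (snd z))\<^sup>2 * norm (fst z - snd z) powr (- (real DIM('a) + 2 * s)))"

definition form_density :: "('a \<Rightarrow> real) \<Rightarrow> ('a \<Rightarrow> real) \<Rightarrow> 'a \<times> 'a \<Rightarrow> real" where
  "form_density u v z = indicator (interaction_set \<Omega>) z *
     ((u (fst z) - u (snd z)) * (v (fst z) - v (snd z)) * J (fst z) (snd z))"

lemma gagliardo_density_measurable [measurable]:
  assumes [measurable]: "u \<in> borel_measurable borel"
  shows "gagliardo_density u \<in> borel_measurable borel"
proof -
  have [measurable]: "interaction_set \<Omega> \<in> sets (borel \<Otimes>\<^sub>M borel)" unfolding borel_prod by measurable
  show ?thesis unfolding gagliardo_density_def borel_prod[symmetric] by measurable
qed

lemma gagliardo_density_nonneg: "0 \<le> gagliardo_density u z"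
  by (simp add: gagliardo_density_def)

text \<open>
  On the diagonal, where \<open>J\<close> is arbitrary, the differences of \<open>u\<close> and \<open>v\<close> vanish. So \<open>J\<close> may be
  replaced by its extension by zero.
\<close>

lemma form_density_measurable [measurable]:
  assumes [measurable]: "u \<in> borel_measurable borel" "v \<in> borel_measurable borel"
  shows "form_density u v \<in> borel_measurable borel"
proof -
  define J' where "J' z = indicator {(x, y). x \<noteq> y} z *\<^sub>R (case z of (x, y) \<Rightarrow> J x y)" for z :: "'a \<times> 'a"
  have "{(x, y). x \<noteq> (y::'a)} \<in> sets borel"
  proof -
    have "{(x, y). x \<noteq> (y::'a)} = {z. fst z \<noteq> snd z}" by auto
    also have "open \<dots>" by (intro open_Collect_neq continuous_intros)
    finally show ?thesis by simp
  qed
  then have [measurable]: "J' \<in> borel_measurable (borel \<Otimes>\<^sub>M borel)"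
    unfolding borel_prod
    using adm unfolding admissible_kernel_def J'_def by (subst (asm) borel_measurable_restrict_space_iff) auto
  have [measurable]: "interaction_set \<Omega> \<in> sets (borel \<Otimes>\<^sub>M borel)" unfolding borel_prod by measurable
  have "form_density u v = (\<lambda>z. indicator (interaction_set \<Omega>) z *
     ((u (fst z) - u (snd z)) * (v (fst z) - v (snd z)) * J' z))"
    unfolding form_density_def J'_def by (auto simp: fun_eq_iff indicator_def)
  then show ?thesis unfolding borel_prod[symmetric] by simp
qed

lemma V_energy_eq: "V_energy \<Omega> s u = ennreal (kappa DIM('a) s / 2) * (\<integral>\<^sup>+z. ennreal (gagliardo_density u z) \<partial>lborel)"
proof -
  have e: "a / t powr q = a * t powr (- q)" for a t q :: real by (simp add: powr_minus divide_inverse)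
  show ?thesis unfolding V_energy_def gagliardo_density_def e
    by (intro arg_cong[where f="\<lambda>x. ennreal (kappa DIM('a) s / 2) * x"] nn_integral_cong) (auto simp: indicator_def split: prod.splits)
qed

lemma V_space_density:
  assumes "u \<in> V_space \<Omega> s"
  shows "integrable lborel (gagliardo_density u)"
    and "V_energy \<Omega> s u = ennreal (kappa DIM('a) s / 2 * (\<integral>z. gagliardo_density u z \<partial>lborel))"
    and "enn2real (V_energy \<Omega> s u) = kappa DIM('a) s / 2 * (\<integral>z. gagliardo_density u z \<partial>lborel)"
proof -
  have [measurable]: "u \<in> borel_measurable borel" and fin: "V_energy \<Omega> s u < \<infinity>"
    using assms by (auto simp: V_space_def)
  have "(\<integral>\<^sup>+z. ennreal (gagliardo_density u z) \<partial>lborel) \<noteq> \<infinity>"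
    using fin kernel_const_pos unfolding V_energy_eq by (auto simp: ennreal_mult_top)
  then show I: "integrable lborel (gagliardo_density u)"
    by (intro integrableI_nonneg) (auto simp: gagliardo_density_nonneg less_top)
  show e: "V_energy \<Omega> s u = ennreal (kappa DIM('a) s / 2 * (\<integral>z. gagliardo_density u z \<partial>lborel))"
    unfolding V_energy_eq nn_integral_eq_integral[OF I AE_I2[OF gagliardo_density_nonneg]]
    using kernel_const_pos by (intro ennreal_mult[symmetric]) (auto simp: gagliardo_density_nonneg)
  show "enn2real (V_energy \<Omega> s u) = kappa DIM('a) s / 2 * (\<integral>z. gagliardo_density u z \<partial>lborel)"
    unfolding e using kernel_const_pos by (simp add: gagliardo_density_nonneg)
qed

lemma form_density_bounds:
  "kappa DIM('a) s / \<Lambda> * gagliardo_density u z \<le> form_density u u z"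
  "form_density u u z \<le> \<Lambda> * kappa DIM('a) s * gagliardo_density u z"
  "\<bar>form_density u v z\<bar> \<le> \<Lambda> * kappa DIM('a) s * (gagliardo_density u z + gagliardo_density v z)"
proof -
  obtain x y where z: "z = (x, y)" by (cases z)
  have "kappa DIM('a) s / \<Lambda> * gagliardo_density u z \<le> form_density u u z \<and> form_density u u z \<le> \<Lambda> * kappa DIM('a) s * gagliardo_density u z \<and>
    \<bar>form_density u v z\<bar> \<le> \<Lambda> * kappa DIM('a) s * (gagliardo_density u z + gagliardo_density v z)"
  proof (cases "x \<noteq> y \<and> z \<in> interaction_set \<Omega>")
    case True
    define N where "N = gagliardo_kernel s (x - y)"
    have eN: "- real DIM('a) - 2 * s = - (real DIM('a) + 2 * s)" by simp
    have J: "kappa DIM('a) s / \<Lambda> * N \<le> J x y" "J x y \<le> \<Lambda> * kappa DIM('a) s * N" "0 < J x y"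
      using adm True unfolding admissible_kernel_def N_def eN by auto
    define a b where "a = u x - u y" and "b = v x - v y"
    have g: "gagliardo_density u z = a\<^sup>2 * N" "gagliardo_density v z = b\<^sup>2 * N"
      "form_density u u z = a\<^sup>2 * J x y" "form_density u v z = a * b * J x y"
      using True by (auto simp: gagliardo_density_def form_density_def z a_def b_def N_def power2_eq_square)
    have "a\<^sup>2 * (kappa DIM('a) s / \<Lambda> * N) \<le> a\<^sup>2 * J x y" "a\<^sup>2 * J x y \<le> a\<^sup>2 * (\<Lambda> * kappa DIM('a) s * N)"
      using J by (intro mult_left_mono; simp)+
    moreover have "\<bar>a * b * J x y\<bar> \<le> (a\<^sup>2 + b\<^sup>2) * (\<Lambda> * kappa DIM('a) s * N)"
    proof -
      have "0 \<le> (\<bar>a\<bar> - \<bar>b\<bar>)\<^sup>2" by simp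
      then have "2 * \<bar>a * b\<bar> \<le> a\<^sup>2 + b\<^sup>2" by (simp add: power2_diff abs_mult)
      then have "\<bar>a * b\<bar> \<le> a\<^sup>2 + b\<^sup>2" using abs_ge_zero[of "a * b"] by linarith
      then have "\<bar>a * b\<bar> * J x y \<le> (a\<^sup>2 + b\<^sup>2) * (\<Lambda> * kappa DIM('a) s * N)" using J by (intro mult_mono) auto
      then show ?thesis using J by (simp add: abs_mult)
    qed
    ultimately show ?thesis unfolding g by (simp add: algebra_simps)
  next
    case False
    then show ?thesis by (auto simp: gagliardo_density_def form_density_def z)
  qed
  then show "kappa DIM('a) s / \<Lambda> * gagliardo_density u z \<le> form_density u u z"
    "form_density u u z \<le> \<Lambda> * kappa DIM('a) s * gagliardo_density u z"
    "\<bar>form_density u v z\<bar> \<le> \<Lambda> * kappa DIM('a) s * (gagliardo_density u z + gagliardo_density v z)" by auto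
qed

lemma form_density_integrable:
  assumes "u \<in> V_space \<Omega> s" "v \<in> V_space \<Omega> s"
  shows "integrable lborel (form_density u v)"
proof (rule Bochner_Integration.integrable_bound)
  show "integrable lborel (\<lambda>z. \<Lambda> * kappa DIM('a) s * (gagliardo_density u z + gagliardo_density v z))"
    using V_space_density(1)[OF assms(1)] V_space_density(1)[OF assms(2)] by simp
  show "form_density u v \<in> borel_measurable lborel" using assms form_density_measurable[of u v] by (simp add: V_space_def)
  show "AE z in lborel. norm (form_density u v z) \<le> norm (\<Lambda> * kappa DIM('a) s * (gagliardo_density u z + gagliardo_density v z))"
  proof (intro AE_I2)
    fix z
    have "\<bar>form_density u v z\<bar> \<le> \<Lambda> * kappa DIM('a) s * (gagliardo_density u z + gagliardo_density v z)" by (rule form_density_bounds(3))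
    also have "\<dots> \<le> \<bar>\<Lambda> * kappa DIM('a) s * (gagliardo_density u z + gagliardo_density v z)\<bar>" by (rule abs_ge_self)
    finally show "norm (form_density u v z) \<le> norm (\<Lambda> * kappa DIM('a) s * (gagliardo_density u z + gagliardo_density v z))" by simp
  qed
qed

lemma energy_form_eq: "energy_form \<Omega> J u v = 1 / 2 * (\<integral>z. form_density u v z \<partial>lborel)"
  unfolding energy_form_def set_lebesgue_integral_def form_density_def
  by (simp add: case_prod_beta)

lemma energy_form_sym: "energy_form \<Omega> J u v = energy_form \<Omega> J v u"
  unfolding energy_form_eq form_density_def by (simp add: mult_ac)

lemma energy_form_add:
  assumes "u \<in> V_space \<Omega> s" "v \<in> V_space \<Omega> s" "w \<in> V_space \<Omega> s"
  shows "energy_form \<Omega> J (\<lambda>x. u x + v x) w = energy_form \<Omega> J u w + energy_form \<Omega> J v w"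
proof -
  have "form_density (\<lambda>x. u x + v x) w = (\<lambda>z. form_density u w z + form_density v w z)"
    by (simp add: fun_eq_iff form_density_def algebra_simps)
  then show ?thesis unfolding energy_form_eq using form_density_integrable assms by simp
qed

lemma energy_form_scale: "energy_form \<Omega> J (\<lambda>x. c * u x) w = c * energy_form \<Omega> J u w"
proof -
  have "form_density (\<lambda>x. c * u x) w = (\<lambda>z. c * form_density u w z)"
    by (simp add: fun_eq_iff form_density_def algebra_simps)
  then show ?thesis unfolding energy_form_eq by simp
qed

lemma energy_form_bounds:
  assumes u: "u \<in> V_space \<Omega> s"
  shows "enn2real (V_energy \<Omega> s u) \<le> \<Lambda> * energy_form \<Omega> J u u"
    and "energy_form \<Omega> J u u \<le> \<Lambda> * enn2real (V_energy \<Omega> s u)"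
proof -
  note Ig = V_space_density(1)[OF u] and Ie = form_density_integrable[OF u u]
  have "(\<integral>z. kappa DIM('a) s / \<Lambda> * gagliardo_density u z \<partial>lborel) \<le> (\<integral>z. form_density u u z \<partial>lborel)"
    using Ig Ie form_density_bounds(1) by (intro integral_mono) auto
  then have "kappa DIM('a) s * (\<integral>z. gagliardo_density u z \<partial>lborel) \<le> \<Lambda> * (\<integral>z. form_density u u z \<partial>lborel)"
    using \<Lambda> by (simp add: field_simps)
  then show "enn2real (V_energy \<Omega> s u) \<le> \<Lambda> * energy_form \<Omega> J u u"
    unfolding V_space_density(3)[OF u] energy_form_eq by simp
  have "(\<integral>z. form_density u u z \<partial>lborel) \<le> (\<integral>z. \<Lambda> * kappa DIM('a) s * gagliardo_density u z \<partial>lborel)"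
    using Ig Ie form_density_bounds(2) by (intro integral_mono) auto
  then show "energy_form \<Omega> J u u \<le> \<Lambda> * enn2real (V_energy \<Omega> s u)"
    unfolding V_space_density(3)[OF u] energy_form_eq by simp
qed

lemma energy_form_nonneg: "u \<in> V_space \<Omega> s \<Longrightarrow> 0 \<le> energy_form \<Omega> J u u"
  using energy_form_bounds(1)[of u] \<Lambda> enn2real_nonneg[of "V_energy \<Omega> s u"]
  by (smt (verit) mult_less_cancel_left_disj mult_nonneg_nonpos)

lemma V_perp_subset: "u \<in> V_perp \<Omega> s \<Longrightarrow> u \<in> V_space \<Omega> s"
  by (simp add: V_perp_def)

lemma V_perp_measurable: "u \<in> V_perp \<Omega> s \<Longrightarrow> u \<in> borel_measurable borel"
  by (simp add: V_perp_def V_space_def)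

lemma V_perp_diff: "u \<in> V_perp \<Omega> s \<Longrightarrow> v \<in> V_perp \<Omega> s \<Longrightarrow> (\<lambda>x. u x - v x) \<in> V_perp \<Omega> s"
  using V_perp_closed(2)[OF C11 bnd s, of u "\<lambda>x. -1 * v x"] V_perp_closed(3)[OF C11 bnd s, of v "-1"] by simp

text \<open>
  The iterated integral is used, so that convergence almost everywhere in one variable suffices.
\<close>

lemma V_energy_Fatou:
  fixes U :: "nat \<Rightarrow> 'a \<Rightarrow> real"
  assumes [measurable]: "\<And>n. U n \<in> borel_measurable borel" "u \<in> borel_measurable borel" "w \<in> borel_measurable borel"
    and lim: "AE x in lborel. (\<lambda>n. U n x) \<longlonglongrightarrow> u x"
    and bound: "\<And>m. n \<le> m \<Longrightarrow> V_energy \<Omega> s (\<lambda>x. U m x - w x) \<le> ennreal b"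
  shows "V_energy \<Omega> s (\<lambda>x. u x - w x) \<le> ennreal b"
proof -
  define I where "I f x y = indicator (interaction_set \<Omega>) (x, y) *
     ennreal ((f x - f y)\<^sup>2 * gagliardo_kernel s (x - y))" for f :: "'a \<Rightarrow> real" and x y
  have [measurable]: "interaction_set \<Omega> \<in> sets (borel \<Otimes>\<^sub>M borel)" unfolding borel_prod by measurable
  have [measurable]: "case_prod (I f) \<in> borel_measurable (borel \<Otimes>\<^sub>M borel)" if [measurable]: "f \<in> borel_measurable borel" for f
    unfolding I_def by measurable
  have V_I: "V_energy \<Omega> s f = ennreal (kappa DIM('a) s / 2) * (\<integral>\<^sup>+x. \<integral>\<^sup>+y. I f x y \<partial>lborel \<partial>lborel)"
    if "f \<in> borel_measurable borel" for f
    unfolding I_def by (rule V_energy_iterated[OF that \<Omega>_borel])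
  define D where "D m x = U m x - w x" for m x
  have [measurable]: "D m \<in> borel_measurable borel" for m unfolding D_def by measurable
  have pt: "I (\<lambda>x. u x - w x) x y = liminf (\<lambda>m. I (D m) x y)"
    if "(\<lambda>n. U n x) \<longlonglongrightarrow> u x" "(\<lambda>n. U n y) \<longlonglongrightarrow> u y" for x y
  proof -
    have "(\<lambda>m. I (D m) x y) \<longlonglongrightarrow> I (\<lambda>x. u x - w x) x y"
    proof (cases "(x, y) \<in> interaction_set \<Omega>")
      case True
      have "(\<lambda>m. (D m x - D m y)\<^sup>2 * gagliardo_kernel s (x - y)) \<longlonglongrightarrow>
        ((u x - w x) - (u y - w y))\<^sup>2 * gagliardo_kernel s (x - y)"
        unfolding D_def by (intro tendsto_mult tendsto_power tendsto_diff tendsto_const that)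
      then show ?thesis using True unfolding I_def by (auto intro: tendsto_ennrealI)
    qed (simp add: I_def)
    then show ?thesis by (rule lim_imp_Liminf[OF sequentially_bot, symmetric])
  qed
  have "(\<integral>\<^sup>+x. \<integral>\<^sup>+y. I (\<lambda>x. u x - w x) x y \<partial>lborel \<partial>lborel) = (\<integral>\<^sup>+x. \<integral>\<^sup>+y. liminf (\<lambda>m. I (D m) x y) \<partial>lborel \<partial>lborel)"
  proof (rule nn_integral_cong_AE)
    show "AE x in lborel. (\<integral>\<^sup>+y. I (\<lambda>x. u x - w x) x y \<partial>lborel) = (\<integral>\<^sup>+y. liminf (\<lambda>m. I (D m) x y) \<partial>lborel)"
      using lim
    proof eventually_elim
      case x: (elim x)
      have "AE y in lborel. I (\<lambda>x. u x - w x) x y = liminf (\<lambda>m. I (D m) x y)"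
        using lim by eventually_elim (rule pt[OF x])
      then show ?case by (rule nn_integral_cong_AE)
    qed
  qed
  also have "\<dots> \<le> (\<integral>\<^sup>+x. liminf (\<lambda>m. \<integral>\<^sup>+y. I (D m) x y \<partial>lborel) \<partial>lborel)"
    by (intro nn_integral_mono nn_integral_liminf) measurable
  also have "\<dots> \<le> liminf (\<lambda>m. \<integral>\<^sup>+x. \<integral>\<^sup>+y. I (D m) x y \<partial>lborel \<partial>lborel)"
    by (intro nn_integral_liminf) measurable
  also have "\<dots> \<le> ennreal (2 / kappa DIM('a) s) * ennreal b"
  proof (rule Liminf_le)
    show "\<forall>\<^sub>F m in sequentially. (\<integral>\<^sup>+x. \<integral>\<^sup>+y. I (D m) x y \<partial>lborel \<partial>lborel) \<le> ennreal (2 / kappa DIM('a) s) * ennreal b"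
      using eventually_ge_at_top[of n]
    proof eventually_elim
      case (elim m)
      have "(\<integral>\<^sup>+x. \<integral>\<^sup>+y. I (D m) x y \<partial>lborel \<partial>lborel) = ennreal (2 / kappa DIM('a) s) * V_energy \<Omega> s (D m)"
        using kernel_const_pos by (simp add: V_I mult.assoc[symmetric] ennreal_mult[symmetric])
      also have "\<dots> \<le> ennreal (2 / kappa DIM('a) s) * ennreal b"
        using bound[OF elim] unfolding D_def by (intro mult_left_mono) auto
      finally show ?case .
    qed
  qed simp
  finally have "V_energy \<Omega> s (\<lambda>x. u x - w x) \<le> ennreal (kappa DIM('a) s / 2) * (ennreal (2 / kappa DIM('a) s) * ennreal b)"
    by (subst V_I, measurable) (rule mult_left_mono, auto)
  also have "\<dots> = ennreal b"
    using kernel_const_pos by (simp add: mult.assoc[symmetric] ennreal_mult[symmetric])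
  finally show ?thesis .
qed

text \<open>
  The energy controls differences of values, not the values on the complement of \<open>\<Omega>\<close>. But the weighted sums of
  \<open>(D n x)\<^sup>2\<close> over \<open>\<Omega>\<close> and of \<open>(D n x - D n y)\<^sup>2\<close> over \<open>\<Omega>\<close> times the whole space are finite, where \<open>D n\<close> are
  the increments of the sequence. So one good point \<open>x\<close> of \<open>\<Omega>\<close> can be fixed, at which the increments
  decay geometrically, and this decay is transported to almost every \<open>y\<close>.
\<close>

lemma energy_Cauchy_AE_convergent:
  fixes U :: "nat \<Rightarrow> 'a \<Rightarrow> real"
  assumes ne: "\<Omega> \<noteq> {}" and U: "\<And>n. U n \<in> V_perp \<Omega> s"
    and b: "\<And>n. enn2real (V_energy \<Omega> s (\<lambda>x. U (Suc n) x - U n x)) \<le> b * (1 / 16) ^ n"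
  shows "AE y in lborel. convergent (\<lambda>n. U n y)"
proof -
  define D where "D n x = U (Suc n) x - U n x" for n x
  have DV: "D n \<in> V_perp \<Omega> s" for n unfolding D_def by (intro V_perp_diff U)
  have [measurable]: "D n \<in> borel_measurable borel" for n using V_perp_measurable[OF DV] .
  obtain C where C: "0 < C" "\<And>t u. s \<le> t \<Longrightarrow> t < 1 \<Longrightarrow> u \<in> V_perp \<Omega> t \<Longrightarrow> energy_controls \<Omega> C t u"
    using uniform_bounds[OF C11 bnd s(1)] by blast
  have b0: "0 \<le> b" using order_trans[OF enn2real_nonneg b[of 0]] by simp
  have small: "ennreal (C * enn2real (V_energy \<Omega> s (D n))) \<le> ennreal (C * b * (1 / 16) ^ n)" for n
    using b[of n] C(1) unfolding D_def by (intro ennreal_leI) (simp add: mult.assoc)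
  have tail: "(\<Sum>n. ennreal (2 ^ n) * ennreal (c * (1 / 16) ^ n)) < \<infinity>" if "0 \<le> c" for c
  proof -
    have "(\<Sum>n. ennreal (2 ^ n) * ennreal (c * (1 / 16) ^ n)) = (\<Sum>n. ennreal (c * (1 / 8) ^ n))"
    proof (intro suminf_cong)
      fix n
      have "2 ^ n * (1 / 16) ^ n = (1 / 8 :: real) ^ n" by (simp add: power_mult_distrib[symmetric])
      then have "2 ^ n * (c * (1 / 16) ^ n) = c * (1 / 8) ^ n" by (simp add: mult.left_commute)
      then show "ennreal (2 ^ n) * ennreal (c * (1 / 16) ^ n) = ennreal (c * (1 / 8) ^ n)"
        using that by (simp add: ennreal_mult[symmetric])
    qed
    moreover have "summable (\<lambda>n. c * (1 / 8 :: real) ^ n)" by (intro summable_mult summable_geometric) auto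
    then have "(\<Sum>n. ennreal (c * (1 / 8) ^ n)) \<noteq> top" using that by (intro ennreal_suminf_neq_top) auto
    ultimately show ?thesis by (simp add: less_top)
  qed
  have s1: "(\<integral>\<^sup>+x. (\<Sum>n. ennreal (2 ^ n) * (indicator \<Omega> x * ennreal ((D n x)\<^sup>2))) \<partial>lborel) \<noteq> \<infinity>"
  proof -
    have "(\<integral>\<^sup>+x. (\<Sum>n. ennreal (2 ^ n) * (indicator \<Omega> x * ennreal ((D n x)\<^sup>2))) \<partial>lborel) =
      (\<Sum>n. ennreal (2 ^ n) * (\<integral>\<^sup>+x. indicator \<Omega> x * ennreal ((D n x)\<^sup>2) \<partial>lborel))"
      by (simp add: nn_integral_suminf nn_integral_cmult)
    also have "\<dots> \<le> (\<Sum>n. ennreal (2 ^ n) * ennreal (C * b * (1 / 16) ^ n))"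
    proof (intro suminf_le mult_left_mono)
      show "(\<integral>\<^sup>+x. indicator \<Omega> x * ennreal ((D n x)\<^sup>2) \<partial>lborel) \<le> ennreal (C * b * (1 / 16) ^ n)" for n
        using C(2)[OF order_refl s(2) DV[of n], unfolded energy_controls_def] small[of n] by (auto intro: order_trans)
    qed auto
    also have "\<dots> < \<infinity>" by (rule tail) (use C b0 in auto)
    finally show ?thesis by simp
  qed
  define k where "k x y = gagliardo_kernel s (x - y)" for x y :: 'a
  have s2: "(\<integral>\<^sup>+x. (\<integral>\<^sup>+y. (\<Sum>n. ennreal (2 ^ n) * (indicator \<Omega> x * ennreal ((D n x - D n y)\<^sup>2 * k x y))) \<partial>lborel) \<partial>lborel) \<noteq> \<infinity>"
  proof -
    have "ennreal (1 - s) * (\<integral>\<^sup>+x. (\<integral>\<^sup>+y. (\<Sum>n. ennreal (2 ^ n) * (indicator \<Omega> x * ennreal ((D n x - D n y)\<^sup>2 * k x y))) \<partial>lborel) \<partial>lborel) =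
      (\<Sum>n. ennreal (2 ^ n) * cross_energy \<Omega> s (D n))"
    proof -
      define c where "c n = (\<integral>\<^sup>+x. (\<integral>\<^sup>+y. indicator \<Omega> x * ennreal ((D n x - D n y)\<^sup>2 * k x y) \<partial>lborel) \<partial>lborel)" for n
      have "(\<integral>\<^sup>+x. (\<integral>\<^sup>+y. (\<Sum>n. ennreal (2 ^ n) * (indicator \<Omega> x * ennreal ((D n x - D n y)\<^sup>2 * k x y))) \<partial>lborel) \<partial>lborel) =
        (\<Sum>n. ennreal (2 ^ n) * c n)"
        unfolding c_def k_def by (simp add: nn_integral_suminf nn_integral_cmult)
      then have "ennreal (1 - s) * (\<integral>\<^sup>+x. (\<integral>\<^sup>+y. (\<Sum>n. ennreal (2 ^ n) * (indicator \<Omega> x * ennreal ((D n x - D n y)\<^sup>2 * k x y))) \<partial>lborel) \<partial>lborel) =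
        (\<Sum>n. ennreal (1 - s) * (ennreal (2 ^ n) * c n))" by simp
      also have "\<dots> = (\<Sum>n. ennreal (2 ^ n) * (ennreal (1 - s) * c n))"
        by (intro suminf_cong mult.left_commute)
      finally show ?thesis unfolding cross_energy_def c_def k_def .
    qed
    also have "\<dots> \<le> (\<Sum>n. ennreal (2 ^ n) * ennreal (C * b * (1 / 16) ^ n))"
    proof (intro suminf_le mult_left_mono)
      show "cross_energy \<Omega> s (D n) \<le> ennreal (C * b * (1 / 16) ^ n)" for n
        using C(2)[OF order_refl s(2) DV[of n], unfolded energy_controls_def] small[of n] by (auto intro: order_trans)
    qed auto
    also have "\<dots> < \<infinity>" by (rule tail) (use C b0 in auto)
    finally show ?thesis using s by (auto simp: ennreal_mult_top)
  qed
  have "AE x in lborel. (\<Sum>n. ennreal (2 ^ n) * (indicator \<Omega> x * ennreal ((D n x)\<^sup>2))) \<noteq> \<infinity>"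
    using s1 by (intro nn_integral_PInf_AE) auto
  moreover have "AE x in lborel. (\<integral>\<^sup>+y. (\<Sum>n. ennreal (2 ^ n) * (indicator \<Omega> x * ennreal ((D n x - D n y)\<^sup>2 * k x y))) \<partial>lborel) \<noteq> \<infinity>"
    using s2 unfolding k_def by (intro nn_integral_PInf_AE) auto
  ultimately have AE2: "AE x in lborel. (\<Sum>n. ennreal (2 ^ n) * (indicator \<Omega> x * ennreal ((D n x)\<^sup>2))) \<noteq> \<infinity> \<and>
     (\<integral>\<^sup>+y. (\<Sum>n. ennreal (2 ^ n) * (indicator \<Omega> x * ennreal ((D n x - D n y)\<^sup>2 * k x y))) \<partial>lborel) \<noteq> \<infinity>"
    by eventually_elim auto
  have "\<not> (AE x in lborel. x \<notin> \<Omega>)"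
    using open_pos_measure[OF open_\<Omega> ne] AE_iff_null_sets[of \<Omega> lborel] by auto
  then obtain x where x: "x \<in> \<Omega>" "(\<Sum>n. ennreal (2 ^ n) * (indicator \<Omega> x * ennreal ((D n x)\<^sup>2))) \<noteq> \<infinity>"
     "(\<integral>\<^sup>+y. (\<Sum>n. ennreal (2 ^ n) * (indicator \<Omega> x * ennreal ((D n x - D n y)\<^sup>2 * k x y))) \<partial>lborel) \<noteq> \<infinity>"
    using AE2 by (metis (mono_tags, lifting) AE_mp AE_I2)
  have "AE y in lborel. (\<Sum>n. ennreal (2 ^ n) * (indicator \<Omega> x * ennreal ((D n x - D n y)\<^sup>2 * k x y))) \<noteq> \<infinity>"
    using x(3) unfolding k_def by (intro nn_integral_PInf_AE) auto
  moreover have "AE y in lborel. y \<noteq> x" by (rule AE_lborel_singleton)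
  ultimately show ?thesis
  proof eventually_elim
    case (elim y)
    have term_le: "\<exists>M. \<forall>n. f n \<le> M" if fin: "(\<Sum>n. ennreal (f n)) \<noteq> \<infinity>" for f :: "nat \<Rightarrow> real"
    proof -
      obtain M where M: "0 \<le> M" "(\<Sum>n. ennreal (f n)) = ennreal M"
        using fin by (cases "\<Sum>n. ennreal (f n)") auto
      have "f n \<le> M" for n
      proof -
        have "(\<Sum>i\<in>{n}. ennreal (f i)) \<le> (\<Sum>n. ennreal (f n))" by (intro sum_le_suminf) auto
        then show ?thesis unfolding M(2) using M(1) by (simp add: ennreal_le_iff)
      qed
      then show ?thesis by blast
    qed
    obtain M1 where M1: "\<And>n. 2 ^ n * (D n x)\<^sup>2 \<le> M1"
      using term_le[of "\<lambda>n. 2 ^ n * (D n x)\<^sup>2"] x(1,2) by (auto simp: ennreal_mult)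
    obtain M2 where M2: "\<And>n. 2 ^ n * ((D n x - D n y)\<^sup>2 * k x y) \<le> M2"
      using term_le[of "\<lambda>n. 2 ^ n * ((D n x - D n y)\<^sup>2 * k x y)"] x(1) elim(1) by (auto simp: ennreal_mult k_def)
    have k: "0 < k x y" using elim(2) by (simp add: k_def)
    show ?case
    proof (rule dyadic_increments_convergent)
      fix n
      have "2 ^ n * (D n x - D n y)\<^sup>2 \<le> M2 / k x y"
        using M2[of n] k by (simp add: field_simps)
      moreover have "(D n y)\<^sup>2 \<le> 2 * (D n x)\<^sup>2 + 2 * (D n x - D n y)\<^sup>2"
      proof -
        have "0 \<le> (2 * D n x - D n y)\<^sup>2" by simp
        then show ?thesis by (simp add: power2_eq_square algebra_simps)
      qed
      then have "2 ^ n * (D n y)\<^sup>2 \<le> 2 ^ n * (2 * (D n x)\<^sup>2 + 2 * (D n x - D n y)\<^sup>2)"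
        by (rule mult_left_mono) simp
      then have "2 ^ n * (D n y)\<^sup>2 \<le> 2 * (2 ^ n * (D n x)\<^sup>2) + 2 * (2 ^ n * (D n x - D n y)\<^sup>2)"
        by (simp add: algebra_simps)
      ultimately show "2 ^ n * (U (Suc n) y - U n y)\<^sup>2 \<le> 2 * M1 + 2 * (M2 / k x y)"
        using M1[of n] unfolding D_def[of n y, symmetric] by linarith
    qed
  qed
qed

text \<open>
  The limit of the energies is found by Fatou's lemma. The mean of the pointwise limit need not be tracked:
  the form does not see constants, so the mean is subtracted at the end.
\<close>

lemma V_perp_complete:
  fixes U :: "nat \<Rightarrow> 'a \<Rightarrow> real"
  assumes U: "\<And>n. U n \<in> V_perp \<Omega> s"
    and cauchy: "\<And>m n. n \<le> m \<Longrightarrow> energy_form \<Omega> J (\<lambda>x. U m x - U n x) (\<lambda>x. U m x - U n x) \<le> (1 / 16) ^ n"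
  shows "\<exists>u\<in>V_perp \<Omega> s. (\<lambda>n. energy_form \<Omega> J (\<lambda>x. U n x - u x) (\<lambda>x. U n x - u x)) \<longlonglongrightarrow> 0"
proof (cases "\<Omega> = {}")
  case True
  then have empty: "interaction_set \<Omega> = {}" by (simp add: interaction_set_def)
  have "form_density f f = (\<lambda>z. 0)" for f
    by (simp add: fun_eq_iff form_density_def empty)
  then have "energy_form \<Omega> J f f = 0" for f by (simp add: energy_form_eq)
  then show ?thesis using V_perp_closed(1)[OF C11 bnd s] by (intro bexI[of _ "\<lambda>x. 0"]) auto
next
  case False
  have [measurable]: "U n \<in> borel_measurable borel" for n using V_perp_measurable[OF U] .
  have E: "enn2real (V_energy \<Omega> s (\<lambda>x. U m x - U n x)) \<le> \<Lambda> * (1 / 16) ^ n" if "n \<le> m" for m n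
  proof -
    have "enn2real (V_energy \<Omega> s (\<lambda>x. U m x - U n x)) \<le> \<Lambda> * energy_form \<Omega> J (\<lambda>x. U m x - U n x) (\<lambda>x. U m x - U n x)"
      by (intro energy_form_bounds V_perp_subset V_perp_diff U)
    also have "\<dots> \<le> \<Lambda> * (1 / 16) ^ n" using \<Lambda> by (intro mult_left_mono cauchy that) auto
    finally show ?thesis .
  qed
  have VE: "V_energy \<Omega> s (\<lambda>x. U m x - U n x) \<le> ennreal (\<Lambda> * (1 / 16) ^ n)" if "n \<le> m" for m n
  proof -
    have "V_energy \<Omega> s (\<lambda>x. U m x - U n x) < \<infinity>"
      using V_perp_diff[OF U U, of m n] by (simp add: V_perp_def V_space_def)
    then have "V_energy \<Omega> s (\<lambda>x. U m x - U n x) = ennreal (enn2real (V_energy \<Omega> s (\<lambda>x. U m x - U n x)))" by simp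
    also have "\<dots> \<le> ennreal (\<Lambda> * (1 / 16) ^ n)" by (intro ennreal_leI E that)
    finally show ?thesis .
  qed
  \<comment> \<open>This step needs a point of \<open>\<Omega>\<close>; for empty \<open>\<Omega>\<close> the energy is zero and the functions need not converge.\<close>
  have conv: "AE y in lborel. convergent (\<lambda>n. U n y)"
    by (rule energy_Cauchy_AE_convergent[OF False U]) (rule E, simp)
  define u where "u y = lim (\<lambda>n. U n y)" for y
  have [measurable]: "u \<in> borel_measurable borel"
    unfolding u_def by (rule borel_measurable_lim_metric) simp
  have lim: "AE y in lborel. (\<lambda>n. U n y) \<longlonglongrightarrow> u y"
    using conv by eventually_elim (simp add: u_def convergent_LIMSEQ_iff)
  have Vu: "V_energy \<Omega> s (\<lambda>x. u x - U n x) \<le> ennreal (\<Lambda> * (1 / 16) ^ n)" for n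
    by (rule V_energy_Fatou[OF _ _ _ lim, of _ n]) (use VE in auto)
  have uV: "u \<in> V_space \<Omega> s"
  proof -
    have "V_energy \<Omega> s (\<lambda>x. U 0 x + (u x - U 0 x)) \<le> 2 * (V_energy \<Omega> s (U 0) + V_energy \<Omega> s (\<lambda>x. u x - U 0 x))"
      by (rule V_energy_add_le) auto
    also have "\<dots> < \<infinity>"
    proof -
      have "V_energy \<Omega> s (\<lambda>x. u x - U 0 x) < \<infinity>" using Vu[of 0] by (rule le_less_trans) simp
      moreover have "V_energy \<Omega> s (U 0) < \<infinity>" using U[of 0] by (simp add: V_perp_def V_space_def)
      ultimately show ?thesis by (simp add: ennreal_mult_less_top)
    qed
    finally show ?thesis by (simp add: V_space_def)
  qed
  define m where "m = (LINT x:\<Omega>|lborel. u x) / measure lborel \<Omega>"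
  define u' where "u' x = u x - m" for x
  have u'V: "u' \<in> V_perp \<Omega> s"
  proof -
    have "u' \<in> V_space \<Omega> s" using uV unfolding u'_def by (auto simp: V_space_def V_energy_shift)
    moreover have "(LINT x:\<Omega>|lborel. u' x) = 0"
    proof -
      have fin: "emeasure lborel \<Omega> < \<infinity>" using emeasure_bounded_finite[OF bnd] by simp
      then have pos: "0 < measure lborel \<Omega>"
        using open_pos_measure[OF open_\<Omega> False] by (auto simp: measure_def zero_less_measure_iff enn2real_positive_iff less_top zero_less_iff_neq_zero)
      have "(LINT x:\<Omega>|lborel. u' x) = (\<integral>x. indicator \<Omega> x * u x - indicator \<Omega> x * m \<partial>lborel)"
        unfolding set_lebesgue_integral_def u'_def by (simp add: right_diff_distrib)
      also have "\<dots> = (LINT x:\<Omega>|lborel. u x) - measure lborel \<Omega> * m"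
        using V_space_integrable[OF C11 bnd s uV] fin by (simp add: set_lebesgue_integral_def)
      also have "\<dots> = 0" using pos by (simp add: m_def)
      finally show ?thesis .
    qed
    ultimately show ?thesis by (simp add: V_perp_def)
  qed
  have "(\<lambda>n. energy_form \<Omega> J (\<lambda>x. U n x - u' x) (\<lambda>x. U n x - u' x)) \<longlonglongrightarrow> 0"
  proof (rule tendsto_sandwich[of "\<lambda>_. 0" _ sequentially "\<lambda>n. \<Lambda> * (\<Lambda> * (1 / 16) ^ n)"])
    have V: "(\<lambda>x. U n x - u' x) \<in> V_space \<Omega> s" for n by (intro V_perp_subset V_perp_diff U u'V)
    show "\<forall>\<^sub>F n in sequentially. 0 \<le> energy_form \<Omega> J (\<lambda>x. U n x - u' x) (\<lambda>x. U n x - u' x)"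
      using energy_form_nonneg[OF V] by simp
    have "energy_form \<Omega> J (\<lambda>x. U n x - u' x) (\<lambda>x. U n x - u' x) \<le> \<Lambda> * (\<Lambda> * (1 / 16) ^ n)" for n
    proof -
      have "V_energy \<Omega> s (\<lambda>x. U n x - u' x) = V_energy \<Omega> s (\<lambda>x. -1 * (u x - U n x) - (- m))"
        unfolding u'_def by (simp add: algebra_simps)
      also have "\<dots> = V_energy \<Omega> s (\<lambda>x. u x - U n x)"
        unfolding V_energy_shift by (subst V_energy_scale) auto
      finally have "enn2real (V_energy \<Omega> s (\<lambda>x. U n x - u' x)) \<le> enn2real (ennreal (\<Lambda> * (1 / 16) ^ n))"
        using Vu[of n] by (auto intro: enn2real_mono)
      then have "enn2real (V_energy \<Omega> s (\<lambda>x. U n x - u' x)) \<le> \<Lambda> * (1 / 16) ^ n" using \<Lambda> by simp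
      then have "\<Lambda> * enn2real (V_energy \<Omega> s (\<lambda>x. U n x - u' x)) \<le> \<Lambda> * (\<Lambda> * (1 / 16) ^ n)"
        using \<Lambda> by (intro mult_left_mono) auto
      then show ?thesis using energy_form_bounds(2)[OF V, of n] by (rule order_trans[rotated])
    qed
    then show "\<forall>\<^sub>F n in sequentially. energy_form \<Omega> J (\<lambda>x. U n x - u' x) (\<lambda>x. U n x - u' x) \<le> \<Lambda> * (\<Lambda> * (1 / 16) ^ n)" by simp
    have "(\<lambda>n. \<Lambda> * (\<Lambda> * (1 / 16) ^ n)) \<longlonglongrightarrow> \<Lambda> * (\<Lambda> * 0)"
      by (intro tendsto_intros LIMSEQ_power_zero) auto
    then show "(\<lambda>n. \<Lambda> * (\<Lambda> * (1 / 16) ^ n)) \<longlonglongrightarrow> 0" by simp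
  qed simp
  then show ?thesis using u'V by blast
qed

lemma restrict_compl_T_space:
  assumes "u \<in> borel_measurable borel" "T_sqnorm \<Omega> s u < \<infinity>"
  shows "restrict_compl \<Omega> u \<in> T_space \<Omega> s"
proof -
  have "restrict_compl \<Omega> u \<in> borel_measurable borel"
    unfolding restrict_compl_def using assms(1) by measurable
  then show ?thesis using assms(2) by (simp add: T_space_def T_sqnorm_restrict) (simp add: restrict_compl_def)
qed

lemma op_norm_V:
  assumes "F \<in> dual_space (V_perp \<Omega> s) (V_norm \<Omega> s)" "u \<in> V_perp \<Omega> s"
  shows "\<bar>F u\<bar> \<le> op_norm (V_perp \<Omega> s) (V_norm \<Omega> s) F * V_norm \<Omega> s u" "0 \<le> op_norm (V_perp \<Omega> s) (V_norm \<Omega> s) F"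
  by (rule op_norm_bound[OF assms(1) V_perp_closed(3)[OF C11 bnd s] V_norm_scale[OF V_perp_measurable \<Omega>_borel] _ assms(2)];
      simp add: V_norm_def)+

lemma T_space_scale:
  assumes "g \<in> T_space \<Omega> s"
  shows "(\<lambda>x. c * g x) \<in> T_space \<Omega> s" "T_norm \<Omega> s (\<lambda>x. c * g x) = \<bar>c\<bar> * T_norm \<Omega> s g"
proof -
  have [measurable]: "g \<in> borel_measurable borel" using assms by (simp add: T_space_def)
  note e = T_sqnorm_scale[OF \<open>g \<in> borel_measurable borel\<close> \<Omega>_borel s(2), of c]
  show "(\<lambda>x. c * g x) \<in> T_space \<Omega> s" using assms by (auto simp: T_space_def e ennreal_mult_less_top)
  show "T_norm \<Omega> s (\<lambda>x. c * g x) = \<bar>c\<bar> * T_norm \<Omega> s g"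
    by (simp add: T_norm_def e enn2real_mult real_sqrt_mult)
qed

lemma op_norm_T:
  assumes "G \<in> dual_space (T_space \<Omega> s) (T_norm \<Omega> s)" "g \<in> T_space \<Omega> s"
  shows "\<bar>G g\<bar> \<le> op_norm (T_space \<Omega> s) (T_norm \<Omega> s) G * T_norm \<Omega> s g" "0 \<le> op_norm (T_space \<Omega> s) (T_norm \<Omega> s) G"
  by (rule op_norm_bound[OF assms(1) T_space_scale(1) T_space_scale(2) _ assms(2)]; simp add: T_norm_def)+

text \<open>
  The restriction to the complement is bounded from \<open>V_perp\<close> to the trace space, so the right side of the equation is
  a bounded functional.
\<close>

lemma functional_bound:
  assumes C: "0 < C" "T_sqnorm \<Omega> s u \<le> ennreal (C * enn2real (V_energy \<Omega> s u))"
    "enn2real (V_energy \<Omega> s u) \<le> (V_norm \<Omega> s u)\<^sup>2"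
    and u: "u \<in> V_perp \<Omega> s"
    and F: "F \<in> dual_space (V_perp \<Omega> s) (V_norm \<Omega> s)" and G: "G \<in> dual_space (T_space \<Omega> s) (T_norm \<Omega> s)"
  shows "\<bar>F u + G (restrict_compl \<Omega> u)\<bar> \<le>
    (1 + sqrt C) * (op_norm (V_perp \<Omega> s) (V_norm \<Omega> s) F + op_norm (T_space \<Omega> s) (T_norm \<Omega> s) G) * V_norm \<Omega> s u"
proof -
  define f g N where "f = op_norm (V_perp \<Omega> s) (V_norm \<Omega> s) F" and "g = op_norm (T_space \<Omega> s) (T_norm \<Omega> s) G"
    and "N = V_norm \<Omega> s u"
  have N: "0 \<le> N" by (simp add: N_def V_norm_def)
  have T: "restrict_compl \<Omega> u \<in> T_space \<Omega> s"
    using C(2) by (intro restrict_compl_T_space V_perp_measurable u) (auto simp: less_top[symmetric] top_unique)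
  have Tn: "T_norm \<Omega> s (restrict_compl \<Omega> u) \<le> sqrt C * N"
  proof -
    have "enn2real (T_sqnorm \<Omega> s u) \<le> enn2real (ennreal (C * enn2real (V_energy \<Omega> s u)))"
      using C(2) by (intro enn2real_mono) auto
    also have "\<dots> \<le> C * N\<^sup>2" using C(1,3) by (simp add: N_def)
    finally have "T_norm \<Omega> s (restrict_compl \<Omega> u) \<le> sqrt (C * N\<^sup>2)" by (simp add: T_norm_def T_sqnorm_restrict)
    also have "\<dots> = sqrt C * N" using N by (simp add: real_sqrt_mult)
    finally show ?thesis .
  qed
  have f: "0 \<le> f" "\<bar>F u\<bar> \<le> f * N" unfolding f_def N_def by (rule op_norm_V[OF F u])+
  have g: "0 \<le> g" "\<bar>G (restrict_compl \<Omega> u)\<bar> \<le> g * T_norm \<Omega> s (restrict_compl \<Omega> u)"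
    unfolding g_def by (rule op_norm_T[OF G T])+
  have "\<bar>F u + G (restrict_compl \<Omega> u)\<bar> \<le> f * N + g * (sqrt C * N)"
    using f(2) order_trans[OF g(2) mult_left_mono[OF Tn g(1)]] by linarith
  also have "\<dots> \<le> (1 + sqrt C) * (f + g) * N"
  proof -
    have "0 \<le> sqrt C * f * N" "0 \<le> g * N" using f g N C by auto
    then show ?thesis by (simp add: algebra_simps)
  qed
  finally show ?thesis unfolding f_def g_def N_def .
qed

lemma weak_solution_exists:
  assumes F: "F \<in> dual_space (V_perp \<Omega> s) (V_norm \<Omega> s)" and G: "G \<in> dual_space (T_space \<Omega> s) (T_norm \<Omega> s)"
  shows "\<exists>u. weak_solution \<Omega> s J F G u"
proof -
  obtain C where C: "0 < C" "\<And>t u. s \<le> t \<Longrightarrow> t < 1 \<Longrightarrow> u \<in> V_perp \<Omega> t \<Longrightarrow> energy_controls \<Omega> C t u"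
    using uniform_bounds[OF C11 bnd s(1)] by blast
  note Cs = C(2)[OF order_refl s(2), unfolded energy_controls_def]
  note closed = V_perp_closed[OF C11 bnd s]
  define M where "M = (1 + sqrt C) * (op_norm (V_perp \<Omega> s) (V_norm \<Omega> s) F + op_norm (T_space \<Omega> s) (T_norm \<Omega> s) G)"
  have M: "0 \<le> M"
  proof -
    have "restrict_compl \<Omega> (\<lambda>x. 0) \<in> T_space \<Omega> s"
      using Cs[OF closed(1)] by (intro restrict_compl_T_space) (auto simp: less_top[symmetric] top_unique)
    then show ?thesis unfolding M_def using C op_norm_V(2)[OF F closed(1)] op_norm_T(2)[OF G] by (intro mult_nonneg_nonneg add_nonneg_nonneg) auto
  qed
  define l where "l v = F v + G (restrict_compl \<Omega> v)" for v
  have T: "restrict_compl \<Omega> v \<in> T_space \<Omega> s" if "v \<in> V_perp \<Omega> s" for v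
    using Cs[OF that] by (intro restrict_compl_T_space V_perp_measurable that) (auto simp: less_top[symmetric] top_unique)
  have radd: "restrict_compl \<Omega> (\<lambda>x. v x + w x) = (\<lambda>x. restrict_compl \<Omega> v x + restrict_compl \<Omega> w x)" for v w
    by (auto simp: restrict_compl_def)
  have rscale: "restrict_compl \<Omega> (\<lambda>x. c * v x) = (\<lambda>x. c * restrict_compl \<Omega> v x)" for c v
    by (auto simp: restrict_compl_def)
  have "\<exists>u\<in>V_perp \<Omega> s. \<forall>v\<in>V_perp \<Omega> s. energy_form \<Omega> J u v = l v"
  proof (rule riesz_representation_functions[where K="M * sqrt (C * \<Lambda>)"])
    show "l (\<lambda>x. u x + v x) = l u + l v" if "u \<in> V_perp \<Omega> s" "v \<in> V_perp \<Omega> s" for u v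
      using F G that T unfolding l_def radd dual_space_def by auto
    show "l (\<lambda>x. c * u x) = c * l u" if "u \<in> V_perp \<Omega> s" for c u
      using F G that T unfolding l_def rscale dual_space_def by (auto simp: distrib_left)
    show "\<bar>l u\<bar> \<le> M * sqrt (C * \<Lambda>) * sqrt (energy_form \<Omega> J u u)" if u: "u \<in> V_perp \<Omega> s" for u
    proof -
      have "\<bar>l u\<bar> \<le> M * V_norm \<Omega> s u"
        unfolding l_def M_def using Cs[OF u] C(1) by (intro functional_bound u F G) auto
      also have "V_norm \<Omega> s u \<le> sqrt (C * \<Lambda> * energy_form \<Omega> J u u)"
      proof (rule real_le_rsqrt)
        have "(V_norm \<Omega> s u)\<^sup>2 \<le> C * enn2real (V_energy \<Omega> s u)" using Cs[OF u] by simp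
        also have "\<dots> \<le> C * (\<Lambda> * energy_form \<Omega> J u u)"
          using C(1) by (intro mult_left_mono energy_form_bounds V_perp_subset u) auto
        finally show "(V_norm \<Omega> s u)\<^sup>2 \<le> C * \<Lambda> * energy_form \<Omega> J u u" by simp
      qed
      then have "M * V_norm \<Omega> s u \<le> M * sqrt (C * \<Lambda>) * sqrt (energy_form \<Omega> J u u)"
        using M by (simp add: real_sqrt_mult mult.assoc mult_left_mono)
      finally show ?thesis by simp
    qed
  qed (use closed V_perp_complete in \<open>auto intro: energy_form_sym energy_form_add energy_form_scale energy_form_nonneg V_perp_subset\<close>)
  then show ?thesis unfolding weak_solution_def l_def by blast
qed

text \<open>
  The equation is tested with the solution itself.
\<close>

lemma weak_solution_bound:
  assumes C: "0 < C" "T_sqnorm \<Omega> s u \<le> ennreal (C * enn2real (V_energy \<Omega> s u))"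
    "(V_norm \<Omega> s u)\<^sup>2 \<le> C * enn2real (V_energy \<Omega> s u)" "enn2real (V_energy \<Omega> s u) \<le> (V_norm \<Omega> s u)\<^sup>2"
    and F: "F \<in> dual_space (V_perp \<Omega> s) (V_norm \<Omega> s)" and G: "G \<in> dual_space (T_space \<Omega> s) (T_norm \<Omega> s)"
    and u: "weak_solution \<Omega> s J F G u"
  shows "V_norm \<Omega> s u \<le> C * \<Lambda> * (1 + sqrt C) *
    (op_norm (V_perp \<Omega> s) (V_norm \<Omega> s) F + op_norm (T_space \<Omega> s) (T_norm \<Omega> s) G)"
proof -
  have uV: "u \<in> V_perp \<Omega> s" and eq: "energy_form \<Omega> J u u = F u + G (restrict_compl \<Omega> u)"
    using u by (auto simp: weak_solution_def)
  define N where "N = V_norm \<Omega> s u"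
  define h where "h = (1 + sqrt C) * (op_norm (V_perp \<Omega> s) (V_norm \<Omega> s) F + op_norm (T_space \<Omega> s) (T_norm \<Omega> s) G)"
  have N: "0 \<le> N" by (simp add: N_def V_norm_def)
  have fb: "\<bar>F u + G (restrict_compl \<Omega> u)\<bar> \<le> h * N"
    unfolding h_def N_def by (rule functional_bound[OF C(1,2,4) uV F G])
  have "N\<^sup>2 \<le> C * enn2real (V_energy \<Omega> s u)" using C(3) by (simp add: N_def)
  also have "\<dots> \<le> C * (\<Lambda> * energy_form \<Omega> J u u)"
    using C(1) by (intro mult_left_mono energy_form_bounds V_perp_subset uV) auto
  also have "\<dots> \<le> C * (\<Lambda> * (h * N))"
    unfolding eq using C(1) \<Lambda> fb by (intro mult_left_mono) auto
  finally have NN: "N * N \<le> (C * \<Lambda> * h) * N" by (simp add: power2_eq_square mult.assoc)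
  have "N \<le> C * \<Lambda> * h"
  proof (cases "N = 0")
    case True
    have T: "restrict_compl \<Omega> u \<in> T_space \<Omega> s"
      using C(2) by (intro restrict_compl_T_space V_perp_measurable uV) (auto simp: less_top[symmetric] top_unique)
    have "0 \<le> h" unfolding h_def using C(1) op_norm_V(2)[OF F uV] op_norm_T(2)[OF G T]
      by (intro mult_nonneg_nonneg add_nonneg_nonneg) auto
    then show ?thesis using True C(1) \<Lambda> by simp
  next
    case False
    then show ?thesis using NN N mult_le_cancel_right[of N N "C * \<Lambda> * h"] by auto
  qed
  then show ?thesis unfolding N_def h_def by (simp add: mult.assoc)
qed

end

theorem theorem5p7:
  fixes \<Omega> :: "'a::euclidean_space set" and \<Lambda> :: real
  assumes "2 \<le> DIM('a)" and "bounded \<Omega>" and "C11_domain \<Omega>" and "1 \<le> \<Lambda>"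
  shows
    "(\<forall>s J F G. 0 < s \<and> s < 1 \<and> admissible_kernel \<Lambda> s J \<and>
        F \<in> dual_space (V_perp \<Omega> s) (V_norm \<Omega> s) \<and> G \<in> dual_space (T_space \<Omega> s) (T_norm \<Omega> s) \<longrightarrow>
        (\<exists>u. weak_solution \<Omega> s J F G u)) \<and>
     (\<forall>s0. 0 < s0 \<and> s0 < 1 \<longrightarrow>
       (\<exists>C>0. \<forall>s J F G u. s0 < s \<and> s < 1 \<and> admissible_kernel \<Lambda> s J \<and>
          F \<in> dual_space (V_perp \<Omega> s) (V_norm \<Omega> s) \<and> G \<in> dual_space (T_space \<Omega> s) (T_norm \<Omega> s) \<and>
          weak_solution \<Omega> s J F G u \<longrightarrow>
          V_norm \<Omega> s u \<le> C * (op_norm (V_perp \<Omega> s) (V_norm \<Omega> s) F + op_norm (T_space \<Omega> s) (T_norm \<Omega> s) G)))"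
proof (intro conjI allI impI)
  fix s :: real and J :: "'a \<Rightarrow> 'a \<Rightarrow> real" and F G :: "('a \<Rightarrow> real) \<Rightarrow> real"
  assume a: "0 < s \<and> s < 1 \<and> admissible_kernel \<Lambda> s J \<and>
        F \<in> dual_space (V_perp \<Omega> s) (V_norm \<Omega> s) \<and> G \<in> dual_space (T_space \<Omega> s) (T_norm \<Omega> s)"
  interpret admissible_form \<Omega> \<Lambda> s J using assms a by unfold_locales auto
  show "\<exists>u. weak_solution \<Omega> s J F G u" using a by (intro weak_solution_exists) auto
next
  fix s0 :: real assume s0: "0 < s0 \<and> s0 < 1"
  obtain C where C: "0 < C" "\<And>s u. s0 \<le> s \<Longrightarrow> s < 1 \<Longrightarrow> u \<in> V_perp \<Omega> s \<Longrightarrow> energy_controls \<Omega> C s u"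
    using uniform_bounds[OF assms(3,2), of s0] s0 by blast
  show "\<exists>C>0. \<forall>s J F G u. s0 < s \<and> s < 1 \<and> admissible_kernel \<Lambda> s J \<and>
          F \<in> dual_space (V_perp \<Omega> s) (V_norm \<Omega> s) \<and> G \<in> dual_space (T_space \<Omega> s) (T_norm \<Omega> s) \<and>
          weak_solution \<Omega> s J F G u \<longrightarrow>
          V_norm \<Omega> s u \<le> C * (op_norm (V_perp \<Omega> s) (V_norm \<Omega> s) F + op_norm (T_space \<Omega> s) (T_norm \<Omega> s) G)"
  proof (intro exI[of _ "C * \<Lambda> * (1 + sqrt C)"] conjI allI impI)
    show "0 < C * \<Lambda> * (1 + sqrt C)" using C(1) assms(4) by (intro mult_pos_pos add_pos_pos) auto
    fix s :: real and J :: "'a \<Rightarrow> 'a \<Rightarrow> real" and F G :: "('a \<Rightarrow> real) \<Rightarrow> real" and u :: "'a \<Rightarrow> real"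
    assume a: "s0 < s \<and> s < 1 \<and> admissible_kernel \<Lambda> s J \<and>
          F \<in> dual_space (V_perp \<Omega> s) (V_norm \<Omega> s) \<and> G \<in> dual_space (T_space \<Omega> s) (T_norm \<Omega> s) \<and>
          weak_solution \<Omega> s J F G u"
    interpret admissible_form \<Omega> \<Lambda> s J using assms a s0 by unfold_locales auto
    have "u \<in> V_perp \<Omega> s" using a by (simp add: weak_solution_def)
    then show "V_norm \<Omega> s u \<le> C * \<Lambda> * (1 + sqrt C) *
      (op_norm (V_perp \<Omega> s) (V_norm \<Omega> s) F + op_norm (T_space \<Omega> s) (T_norm \<Omega> s) G)"
      using C(2)[of s u] a unfolding energy_controls_def by (intro weak_solution_bound C(1)) auto
  qed
qed

end
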